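(* The category of parity complexes $\mathbf{PC}$ is equivalent to the category of strong Steiner complexes (the full subcategory of the category $\mathbf{ADC}$ of augmented directed complexes on the strong Steiner complexes).
   Context: **Multisets.** $\mathcal{M}_f(B)$ is the set of finite multisets of a set $B$, i.e. functions $B\to\mathbb{N}$ of finite support; $\sqcup$ is pointwise addition; $(S\setminus T)(b)=\max(S(b)-T(b),0)$. Finite subsets are identified with multisets of multiplicity at most one. $\mathcal{P}_f(B)$ is the set of finite subsets of $B$. **Parity structures.** A parity structure is a graded set $C=(C_n)_{n\ge 0}$ together with, for each $n\ge0$ and $x\in C_{n+1}$, a disjoint pair of finite subsets $x^-,x^+\subseteq C_n$. For $n>0$ and $S\subseteq C_n$ put $S^-=\bigcup_{x\in S}x^-$, $S^+=\bigcup_{x\in S}x^+$, $S^\mp=S^-\setminus S^+$, $S^\pm=S^+\setminus S^-$. A subset $S\subseteq C_n$ is well-formed if (i) $n=0$ and $S$ is a singleton, or (ii) $n>0$ and for all $x\ne y$ in $S$, $x^-\cap y^-=x^+\cap y^+=\emptyset$. For $x\in C_n$ define $\mu(x)_n=\pi(x)_n=\{x\}$, $\mu(x)_{k-1}=\mu(x)_k^\mp$, $\pi(x)_{k-1}=\pi(x)_k^\pm$ for $1\le k\le n$. $C$ is - globular if for all $n\ge2$, $x\in C_n$: $(x^-)^\mp=(x^+)^\mp$ and $(x^-)^\pm=(x^+)^\pm$; - unital if for all $n\ge 0$, $x\in C_n$, $0\le k\le n$, the subsets $\mu(x)_k,\pi(x)_k$ are well-formed; - weakly loop-free if for each $n\ge1$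 there is a partial order $\triangleleft$ on $C_n$ such that $x\triangleleft y$ whenever $x^+\cap y^-\neq\emptyset$; - strongly loop-free if there is a partial order $\blacktriangleleft$ on $C=\coprod_n C_n$ such that $x\blacktriangleleft y$ whenever $x\in y^-$ or $y\in x^+$. A weak parity complex is a globular, unital, weakly loop-free parity structure. A parity complex is a globular, unital, strongly loop-free parity structure. Every parity complex is a weak parity complex. **Morphisms.** For a finite multiset $S$ of $C_{n+1}$ let $\Phi^\pm(S)=\bigsqcup_{x\in S}x^\pm$ (with multiplicity), $\partial^-(S)=\Phi^-(S)\setminus\Phi^+(S)$, $\partial^+(S)=\Phi^+(S)\setminus\Phi^-(S)$. $S$ moves $M$ to $P$ (finite multisets of $C_n$) if $\partial^-(S)=M\setminus P$ and $\partial^+(S)=P\setminus M$. A morphism of weak parity complexes $f\colon C\to D$ is a family of functions $f_n\colon C_n\to\mathcal{P}_f(D_n)$ ($n\ge0$) such that for each $x\in C_n$ the subset $f_n(x)$ is well-formed and, if $n>0$, $f_n(x)$ moves $\bigcup_{y\in x^-}f_{n-1}(y)$ to $\bigcup_{y\in x^+}f_{n-1}(y)$. Composition is $(g\circ f)_n(x)=\bigcup_{y\in f_n(x)}g_n(y)$, and identities are $x\mapsto\{x\}$. $\mathbf{PC}$ is the full subcategory, on the parity complexes, of the resulting category of weak parity complexes. **Augmented directed complexes.** A preordered abelian group is an abelian group $A$ with a preorder such that $a\le b$ implies $a+c\le b+c$; $A^*=\{a\in A: a\ge0\}$. A basis of $A$ is a subset $B\subseteq A^*$ which is a basis of both the commutative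 monoid $A^*$ and the abelian group $A$ (unique if it exists). Then $A\cong\mathbb{Z}B$ (finitely supported functions $B\to\mathbb{Z}$, pointwise order) is lattice-ordered, and each $x\in A$ is uniquely $x=x_+-x_-$ with $x_\pm\in A^*$, $x_+\wedge x_-=0$ (positive and negative parts). A directed chain complex is a chain complex $K$ of abelian groups in degrees $\ge0$ with each $K_n$ a preordered abelian group (boundary maps not assumed monotone); morphisms are chain maps that are monotone in each degree. An augmented directed complex is a directed chain complex $K$ with a monotone homomorphism $\varepsilon\colon K_0\to\mathbb{Z}$ (natural order on $\mathbb{Z}$) with $\varepsilon\partial=0$; morphisms are augmentation-preserving morphisms of directed chain complexes. A basis of $K$ is a family $B=(B_n)$ with $B_n$ a basis of $K_n$. For $x\in K_{n+1}$, $\partial^-x,\partial^+x$ are the negative and positive parts of $\partial x$. The basis is unital if $\varepsilon((\partial^-)^nx)=\varepsilon((\partial^+)^nx)=1$ for all $n\ge 0$, $x\in B_n$. It is strongly loop-free if there is a partial order $\blacktriangleleft$ on $\coprod_nB_n$ such that $x\blacktriangleleft y$ whenever $x\le\partial^-y$ or $y\le\partial^+x$. A strong Steiner complex is an augmented directed complex with a strongly loop-free unital basis. *)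

theory Defs
  imports "HOL-Algebra.FiniteProduct" "HOL-Algebra.Elementary_Groups" "HOL-Library.Poly_Mapping" "HOL-Library.Multiset"
    "HOL-Library.FuncSet"
begin

section \<open>Categories and equivalence of categories\<close>

text \<open>
  Morphisms are not tagged with their domain and codomain, so that identities, composition and
  functors on arrows take the objects involved as arguments: \<open>Comp C a b c g f\<close> is the composite
  of \<open>g \<in> Hom C b c\<close> after \<open>f \<in> Hom C a b\<close>.
\<close>

record ('o, 'm) cat =
  Ob :: "'o set"
  Hom :: "'o \<Rightarrow> 'o \<Rightarrow> 'm set"
  Id :: "'o \<Rightarrow> 'm"
  Comp :: "'o \<Rightarrow> 'o \<Rightarrow> 'o \<Rightarrow> 'm \<Rightarrow> 'm \<Rightarrow> 'm"

locale category =
  fixes C :: "('o, 'm) cat"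
  assumes Id_in: "a \<in> Ob C \<Longrightarrow> Id C a \<in> Hom C a a"
    and Comp_in: "\<lbrakk>a \<in> Ob C; b \<in> Ob C; c \<in> Ob C; f \<in> Hom C a b; g \<in> Hom C b c\<rbrakk>
      \<Longrightarrow> Comp C a b c g f \<in> Hom C a c"
    and Comp_Id_left: "\<lbrakk>a \<in> Ob C; b \<in> Ob C; f \<in> Hom C a b\<rbrakk> \<Longrightarrow> Comp C a b b (Id C b) f = f"
    and Comp_Id_right: "\<lbrakk>a \<in> Ob C; b \<in> Ob C; f \<in> Hom C a b\<rbrakk> \<Longrightarrow> Comp C a a b f (Id C a) = f"
    and Comp_assoc: "\<lbrakk>a \<in> Ob C; b \<in> Ob C; c \<in> Ob C; d \<in> Ob C;
        f \<in> Hom C a b; g \<in> Hom C b c; h \<in> Hom C c d\<rbrakk>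
      \<Longrightarrow> Comp C a c d h (Comp C a b c g f) = Comp C a b d (Comp C b c d h g) f"

definition full_subcategory :: "('o, 'm) cat \<Rightarrow> 'o set \<Rightarrow> ('o, 'm) cat" where
  "full_subcategory C S = C\<lparr>Ob := Ob C \<inter> S\<rparr>"

record ('o1, 'm1, 'o2, 'm2) fctr =
  ob_map :: "'o1 \<Rightarrow> 'o2"
  arr_map :: "'o1 \<Rightarrow> 'o1 \<Rightarrow> 'm1 \<Rightarrow> 'm2"

locale cat_functor =
  fixes C :: "('o1, 'm1) cat" and D :: "('o2, 'm2) cat" and F :: "('o1, 'm1, 'o2, 'm2) fctr"
  assumes ob_map_in: "a \<in> Ob C \<Longrightarrow> ob_map F a \<in> Ob D"
    and arr_map_in: "\<lbrakk>a \<in> Ob C; b \<in> Ob C; f \<in> Hom C a b\<rbrakk>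
      \<Longrightarrow> arr_map F a b f \<in> Hom D (ob_map F a) (ob_map F b)"
    and arr_map_Id: "a \<in> Ob C \<Longrightarrow> arr_map F a a (Id C a) = Id D (ob_map F a)"
    and arr_map_Comp: "\<lbrakk>a \<in> Ob C; b \<in> Ob C; c \<in> Ob C; f \<in> Hom C a b; g \<in> Hom C b c\<rbrakk>
      \<Longrightarrow> arr_map F a c (Comp C a b c g f)
        = Comp D (ob_map F a) (ob_map F b) (ob_map F c) (arr_map F b c g) (arr_map F a b f)"

definition id_fctr :: "('o, 'm, 'o, 'm) fctr" where
  "id_fctr = \<lparr>ob_map = (\<lambda>a. a), arr_map = (\<lambda>a b f. f)\<rparr>"

definition comp_fctr ::
  "('o2, 'm2, 'o3, 'm3) fctr \<Rightarrow> ('o1, 'm1, 'o2, 'm2) fctr \<Rightarrow> ('o1, 'm1, 'o3, 'm3) fctr" where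
  "comp_fctr G F = \<lparr>ob_map = (\<lambda>a. ob_map G (ob_map F a)),
     arr_map = (\<lambda>a b f. arr_map G (ob_map F a) (ob_map F b) (arr_map F a b f))\<rparr>"

definition is_iso :: "('o, 'm) cat \<Rightarrow> 'o \<Rightarrow> 'o \<Rightarrow> 'm \<Rightarrow> bool" where
  "is_iso C a b f \<longleftrightarrow> f \<in> Hom C a b \<and>
     (\<exists>g \<in> Hom C b a. Comp C a b a g f = Id C a \<and> Comp C b a b f g = Id C b)"

locale natural_isomorphism =
  fixes C :: "('o1, 'm1) cat" and D :: "('o2, 'm2) cat"
    and F G :: "('o1, 'm1, 'o2, 'm2) fctr" and \<eta> :: "'o1 \<Rightarrow> 'm2"
  assumes component_iso: "a \<in> Ob C \<Longrightarrow> is_iso D (ob_map F a) (ob_map G a) (\<eta> a)"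
    and natural: "\<lbrakk>a \<in> Ob C; b \<in> Ob C; f \<in> Hom C a b\<rbrakk>
      \<Longrightarrow> Comp D (ob_map F a) (ob_map F b) (ob_map G b) (\<eta> b) (arr_map F a b f)
        = Comp D (ob_map F a) (ob_map G a) (ob_map G b) (arr_map G a b f) (\<eta> a)"

definition equivalent_categories :: "('o1, 'm1) cat \<Rightarrow> ('o2, 'm2) cat \<Rightarrow> bool" where
  "equivalent_categories C D \<longleftrightarrow> category C \<and> category D \<and>
     (\<exists>F G \<eta> \<theta>. cat_functor C D F \<and> cat_functor D C G \<and>
        natural_isomorphism C C id_fctr (comp_fctr G F) \<eta> \<and>
        natural_isomorphism D D (comp_fctr F G) id_fctr \<theta>)"

section \<open>Parity structures\<close>

text \<open>
  The type \<open>'a\<close> plays the role of the universe: all graded sets, and below all underlying sets of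
  abelian groups, consist of elements of \<open>'a\<close>. When \<open>'a\<close> is infinite, it is as large as the set
  of finitely supported functions \<open>'a \<Rightarrow> int\<close>, so that every free abelian group on a subset of
  \<open>'a\<close> has a copy in this universe.
\<close>

text \<open>
  The faces of \<open>x \<in> cells C (Suc n)\<close> are \<open>mface C n x\<close> (that is, \<open>x\<^sup>-\<close>) and \<open>pface C n x\<close>
  (that is, \<open>x\<^sup>+\<close>), both subsets of \<open>cells C n\<close>: the index is the degree of the faces, not that
  of \<open>x\<close>. The values of \<open>mface C n\<close> and \<open>pface C n\<close> outside \<open>cells C (Suc n)\<close> are irrelevant.
\<close>

record 'a parity_structure =
  cells :: "nat \<Rightarrow> 'a set"
  mface :: "nat \<Rightarrow> 'a \<Rightarrow> 'a set"
  pface :: "nat \<Rightarrow> 'a \<Rightarrow> 'a set"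

locale parity_structure =
  fixes C :: "'a parity_structure"
  assumes mface_in: "x \<in> cells C (Suc n) \<Longrightarrow> mface C n x \<in> Fpow (cells C n)"
    and pface_in: "x \<in> cells C (Suc n) \<Longrightarrow> pface C n x \<in> Fpow (cells C n)"
    and faces_disjoint: "x \<in> cells C (Suc n) \<Longrightarrow> mface C n x \<inter> pface C n x = {}"

text \<open>
  For \<open>S \<subseteq> cells C (Suc n)\<close> the following four subsets of \<open>cells C n\<close> are
  \<open>S\<^sup>-\<close>, \<open>S\<^sup>+\<close>, \<open>S\<^sup>\<mp> = S\<^sup>- - S\<^sup>+\<close> and \<open>S\<^sup>\<plusminus> = S\<^sup>+ - S\<^sup>-\<close>.
\<close>

definition set_mface :: "'a parity_structure \<Rightarrow> nat \<Rightarrow> 'a set \<Rightarrow> 'a set" where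
  "set_mface C n S = (\<Union>x\<in>S. mface C n x)"

definition set_pface :: "'a parity_structure \<Rightarrow> nat \<Rightarrow> 'a set \<Rightarrow> 'a set" where
  "set_pface C n S = (\<Union>x\<in>S. pface C n x)"

definition set_mpface :: "'a parity_structure \<Rightarrow> nat \<Rightarrow> 'a set \<Rightarrow> 'a set" where
  "set_mpface C n S = set_mface C n S - set_pface C n S"

definition set_pmface :: "'a parity_structure \<Rightarrow> nat \<Rightarrow> 'a set \<Rightarrow> 'a set" where
  "set_pmface C n S = set_pface C n S - set_mface C n S"

definition well_formed :: "'a parity_structure \<Rightarrow> nat \<Rightarrow> 'a set \<Rightarrow> bool" where
  "well_formed C n S \<longleftrightarrow> S \<subseteq> cells C n \<and>
     (case n of
        0 \<Rightarrow> is_singleton S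
      | Suc m \<Rightarrow> (\<forall>x\<in>S. \<forall>y\<in>S. x \<noteq> y \<longrightarrow>
          mface C m x \<inter> mface C m y = {} \<and> pface C m x \<inter> pface C m y = {}))"

text \<open>
  \<open>mu C n x k\<close> is \<open>\<mu>(x)\<^sub>k\<close> for \<open>x \<in> cells C n\<close> and \<open>k \<le> n\<close>, and likewise \<open>pi_set\<close> is \<open>\<pi>\<close>.
  The values for \<open>k > n\<close> are irrelevant.
\<close>

function mu :: "'a parity_structure \<Rightarrow> nat \<Rightarrow> 'a \<Rightarrow> nat \<Rightarrow> 'a set" where
  "mu C n x k = (if k < n then set_mpface C k (mu C n x (Suc k)) else {x})"
  by pat_completeness auto
termination by (relation "measure (\<lambda>(C, n, x, k). n - k)") auto

function pi_set :: "'a parity_structure \<Rightarrow> nat \<Rightarrow> 'a \<Rightarrow> nat \<Rightarrow> 'a set" where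
  "pi_set C n x k = (if k < n then set_pmface C k (pi_set C n x (Suc k)) else {x})"
  by pat_completeness auto
termination by (relation "measure (\<lambda>(C, n, x, k). n - k)") auto

declare mu.simps [simp del] pi_set.simps [simp del]

definition globular :: "'a parity_structure \<Rightarrow> bool" where
  "globular C \<longleftrightarrow> (\<forall>n. \<forall>x \<in> cells C (Suc (Suc n)).
     set_mpface C n (mface C (Suc n) x) = set_mpface C n (pface C (Suc n) x) \<and>
     set_pmface C n (mface C (Suc n) x) = set_pmface C n (pface C (Suc n) x))"

definition unital :: "'a parity_structure \<Rightarrow> bool" where
  "unital C \<longleftrightarrow> (\<forall>n. \<forall>x \<in> cells C n. \<forall>k \<le> n.
     well_formed C k (mu C n x k) \<and> well_formed C k (pi_set C n x k))"

definition weakly_loop_free :: "'a parity_structure \<Rightarrow> bool" where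
  "weakly_loop_free C \<longleftrightarrow> (\<forall>n. \<exists>r. partial_order_on (cells C (Suc n)) r \<and>
     (\<forall>x \<in> cells C (Suc n). \<forall>y \<in> cells C (Suc n).
        pface C n x \<inter> mface C n y \<noteq> {} \<longrightarrow> (x, y) \<in> r))"

text \<open>The disjoint union of the \<open>cells C n\<close> is the set of pairs \<open>(n, x)\<close> with \<open>x \<in> cells C n\<close>.\<close>

definition strongly_loop_free :: "'a parity_structure \<Rightarrow> bool" where
  "strongly_loop_free C \<longleftrightarrow> (\<exists>r. partial_order_on (SIGMA n:UNIV. cells C n) r \<and>
     (\<forall>n. \<forall>x \<in> cells C n. \<forall>y \<in> cells C (Suc n). x \<in> mface C n y \<longrightarrow> ((n, x), (Suc n, y)) \<in> r) \<and>
     (\<forall>n. \<forall>x \<in> cells C (Suc n). \<forall>y \<in> cells C n. y \<in> pface C n x \<longrightarrow> ((Suc n, x), (n, y)) \<in> r))"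

definition weak_parity_complex :: "'a parity_structure \<Rightarrow> bool" where
  "weak_parity_complex C \<longleftrightarrow> parity_structure C \<and> globular C \<and> unital C \<and> weakly_loop_free C"

definition parity_complex :: "'a parity_structure \<Rightarrow> bool" where
  "parity_complex C \<longleftrightarrow> parity_structure C \<and> globular C \<and> unital C \<and> strongly_loop_free C"

section \<open>Morphisms of weak parity complexes\<close>

definition Phi_minus :: "'a parity_structure \<Rightarrow> nat \<Rightarrow> 'a multiset \<Rightarrow> 'a multiset" where
  "Phi_minus C n S = (\<Sum>x\<in>#S. mset_set (mface C n x))"

definition Phi_plus :: "'a parity_structure \<Rightarrow> nat \<Rightarrow> 'a multiset \<Rightarrow> 'a multiset" where
  "Phi_plus C n S = (\<Sum>x\<in>#S. mset_set (pface C n x))"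

definition bd_minus :: "'a parity_structure \<Rightarrow> nat \<Rightarrow> 'a multiset \<Rightarrow> 'a multiset" where
  "bd_minus C n S = Phi_minus C n S - Phi_plus C n S"

definition bd_plus :: "'a parity_structure \<Rightarrow> nat \<Rightarrow> 'a multiset \<Rightarrow> 'a multiset" where
  "bd_plus C n S = Phi_plus C n S - Phi_minus C n S"

definition moves ::
  "'a parity_structure \<Rightarrow> nat \<Rightarrow> 'a multiset \<Rightarrow> 'a multiset \<Rightarrow> 'a multiset \<Rightarrow> bool" where
  "moves C n S M P \<longleftrightarrow> bd_minus C n S = M - P \<and> bd_plus C n S = P - M"

text \<open>
  The functions \<open>f n\<close> are taken to be undefined outside \<open>cells C n\<close>, so that equality of
  morphisms is equality of families of functions on cells.
\<close>

definition wpc_hom ::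
  "'a parity_structure \<Rightarrow> 'a parity_structure \<Rightarrow> (nat \<Rightarrow> 'a \<Rightarrow> 'a set) set" where
  "wpc_hom C D = {f. (\<forall>n. f n \<in> cells C n \<rightarrow>\<^sub>E Fpow (cells D n)) \<and>
     (\<forall>n. \<forall>x \<in> cells C n. well_formed D n (f n x)) \<and>
     (\<forall>n. \<forall>x \<in> cells C (Suc n). moves D n (mset_set (f (Suc n) x))
        (mset_set (\<Union>y\<in>mface C n x. f n y)) (mset_set (\<Union>y\<in>pface C n x. f n y)))}"

definition WPC :: "('a parity_structure, nat \<Rightarrow> 'a \<Rightarrow> 'a set) cat" where
  "WPC = \<lparr>Ob = {C. weak_parity_complex C},
     Hom = wpc_hom,
     Id = (\<lambda>C n. \<lambda>x\<in>cells C n. {x}),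
     Comp = (\<lambda>C D E g f n. \<lambda>x\<in>cells C n. \<Union>y\<in>f n x. g n y)\<rparr>"

definition PC :: "('a parity_structure, nat \<Rightarrow> 'a \<Rightarrow> 'a set) cat" where
  "PC = full_subcategory WPC {C. parity_complex C}"

section \<open>Preordered abelian groups\<close>

text \<open>
  Abelian groups are the library's \<open>comm_group\<close>s, whose operations are written multiplicatively:
  \<open>x \<otimes> y\<close>, \<open>\<one>\<close>, \<open>inv x\<close> and \<open>x [^] k\<close> are the sum, zero, negative and \<open>k\<close>-th multiple.
\<close>

record 'a preordered_group = "'a monoid" +
  order_rel :: "'a rel"

abbreviation pg_le :: "('a, 'b) preordered_group_scheme \<Rightarrow> 'a \<Rightarrow> 'a \<Rightarrow> bool"
  (infix \<open>\<preceq>\<index>\<close> 50)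
  where "pg_le A x y \<equiv> (x, y) \<in> order_rel A"

locale preordered_comm_group = comm_group A for A :: "'a preordered_group" (structure) +
  assumes preorder: "preorder_on (carrier A) (order_rel A)"
    and translation: "\<lbrakk>a \<preceq> b; c \<in> carrier A\<rbrakk> \<Longrightarrow> a \<otimes> c \<preceq> b \<otimes> c"

definition pos_cone :: "'a preordered_group \<Rightarrow> 'a set" where
  "pos_cone A = {a \<in> carrier A. \<one>\<^bsub>A\<^esub> \<preceq>\<^bsub>A\<^esub> a}"

text \<open>Linear combinations of elements of the group with finitely supported coefficients.\<close>

definition nat_lincomb :: "'a preordered_group \<Rightarrow> ('a \<Rightarrow>\<^sub>0 nat) \<Rightarrow> 'a" where
  "nat_lincomb A c =
     finprod A (\<lambda>b. b [^]\<^bsub>A\<^esub> Poly_Mapping.lookup c b) (Poly_Mapping.keys c)"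

definition int_lincomb :: "'a preordered_group \<Rightarrow> ('a \<Rightarrow>\<^sub>0 int) \<Rightarrow> 'a" where
  "int_lincomb A c =
     finprod A (\<lambda>b. b [^]\<^bsub>A\<^esub> Poly_Mapping.lookup c b) (Poly_Mapping.keys c)"

definition group_basis :: "'a preordered_group \<Rightarrow> 'a set \<Rightarrow> bool" where
  "group_basis A B \<longleftrightarrow> B \<subseteq> pos_cone A \<and>
     (\<forall>a \<in> pos_cone A. \<exists>!c. Poly_Mapping.keys c \<subseteq> B \<and> a = nat_lincomb A c) \<and>
     (\<forall>a \<in> carrier A. \<exists>!c. Poly_Mapping.keys c \<subseteq> B \<and> a = int_lincomb A c)"

definition is_meet :: "'a preordered_group \<Rightarrow> 'a \<Rightarrow> 'a \<Rightarrow> 'a \<Rightarrow> bool" where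
  "is_meet A p q m \<longleftrightarrow> m \<in> carrier A \<and> m \<preceq>\<^bsub>A\<^esub> p \<and> m \<preceq>\<^bsub>A\<^esub> q \<and>
     (\<forall>c \<in> carrier A. c \<preceq>\<^bsub>A\<^esub> p \<and> c \<preceq>\<^bsub>A\<^esub> q \<longrightarrow> c \<preceq>\<^bsub>A\<^esub> m)"

text \<open>\<open>is_parts A x p q\<close> says that \<open>p\<close> and \<open>q\<close> are the positive and negative parts of \<open>x\<close>.\<close>

definition is_parts :: "'a preordered_group \<Rightarrow> 'a \<Rightarrow> 'a \<Rightarrow> 'a \<Rightarrow> bool" where
  "is_parts A x p q \<longleftrightarrow> p \<in> pos_cone A \<and> q \<in> pos_cone A \<and>
     x = p \<otimes>\<^bsub>A\<^esub> inv\<^bsub>A\<^esub> q \<and> is_meet A p q \<one>\<^bsub>A\<^esub>"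

definition pos_part :: "'a preordered_group \<Rightarrow> 'a \<Rightarrow> 'a" where
  "pos_part A x = (THE p. \<exists>q. is_parts A x p q)"

definition neg_part :: "'a preordered_group \<Rightarrow> 'a \<Rightarrow> 'a" where
  "neg_part A x = (THE q. \<exists>p. is_parts A x p q)"

section \<open>Augmented directed complexes\<close>

text \<open>The boundary \<open>bd K n\<close> goes from \<open>grp K (Suc n)\<close> to \<open>grp K n\<close>.\<close>

record 'a adc =
  grp :: "nat \<Rightarrow> 'a preordered_group"
  bd :: "nat \<Rightarrow> 'a \<Rightarrow> 'a"
  aug :: "'a \<Rightarrow> int"

locale augmented_directed_complex =
  fixes K :: "'a adc"
  assumes grp: "preordered_comm_group (grp K n)"
    and bd_hom: "bd K n \<in> hom (grp K (Suc n)) (grp K n)"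
    and bd_bd: "x \<in> carrier (grp K (Suc (Suc n))) \<Longrightarrow> bd K n (bd K (Suc n) x) = \<one>\<^bsub>grp K n\<^esub>"
    and aug_hom: "aug K \<in> hom (grp K 0) integer_group"
    and aug_mono: "x \<preceq>\<^bsub>grp K 0\<^esub> y \<Longrightarrow> aug K x \<le> aug K y"
    and aug_bd: "x \<in> carrier (grp K (Suc 0)) \<Longrightarrow> aug K (bd K 0 x) = 0"

text \<open>As above, morphisms are undefined outside the carriers of the source.\<close>

definition adc_hom :: "'a adc \<Rightarrow> 'a adc \<Rightarrow> (nat \<Rightarrow> 'a \<Rightarrow> 'a) set" where
  "adc_hom K L = {f. (\<forall>n. f n \<in> extensional (carrier (grp K n))) \<and>
     (\<forall>n. f n \<in> hom (grp K n) (grp L n)) \<and>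
     (\<forall>n x y. x \<preceq>\<^bsub>grp K n\<^esub> y \<longrightarrow> f n x \<preceq>\<^bsub>grp L n\<^esub> f n y) \<and>
     (\<forall>n. \<forall>x \<in> carrier (grp K (Suc n)). f n (bd K n x) = bd L n (f (Suc n) x)) \<and>
     (\<forall>x \<in> carrier (grp K 0). aug L (f 0 x) = aug K x)}"

definition ADC :: "('a adc, nat \<Rightarrow> 'a \<Rightarrow> 'a) cat" where
  "ADC = \<lparr>Ob = {K. augmented_directed_complex K},
     Hom = adc_hom,
     Id = (\<lambda>K n. \<lambda>x\<in>carrier (grp K n). x),
     Comp = (\<lambda>K L M g f n. compose (carrier (grp K n)) (g n) (f n))\<rparr>"

definition adc_basis :: "'a adc \<Rightarrow> (nat \<Rightarrow> 'a set) \<Rightarrow> bool" where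
  "adc_basis K B \<longleftrightarrow> (\<forall>n. group_basis (grp K n) (B n))"

definition adc_bd_minus :: "'a adc \<Rightarrow> nat \<Rightarrow> 'a \<Rightarrow> 'a" where
  "adc_bd_minus K n x = neg_part (grp K n) (bd K n x)"

definition adc_bd_plus :: "'a adc \<Rightarrow> nat \<Rightarrow> 'a \<Rightarrow> 'a" where
  "adc_bd_plus K n x = pos_part (grp K n) (bd K n x)"

text \<open>\<open>iter_bd_minus K n x = (\<partial>\<^sup>-)\<^sup>n x\<close> for \<open>x\<close> of degree \<open>n\<close>, an element of degree \<open>0\<close>.\<close>

primrec iter_bd_minus :: "'a adc \<Rightarrow> nat \<Rightarrow> 'a \<Rightarrow> 'a" where
  "iter_bd_minus K 0 x = x"
| "iter_bd_minus K (Suc n) x = iter_bd_minus K n (adc_bd_minus K n x)"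

primrec iter_bd_plus :: "'a adc \<Rightarrow> nat \<Rightarrow> 'a \<Rightarrow> 'a" where
  "iter_bd_plus K 0 x = x"
| "iter_bd_plus K (Suc n) x = iter_bd_plus K n (adc_bd_plus K n x)"

definition unital_basis :: "'a adc \<Rightarrow> (nat \<Rightarrow> 'a set) \<Rightarrow> bool" where
  "unital_basis K B \<longleftrightarrow> (\<forall>n. \<forall>x \<in> B n.
     aug K (iter_bd_minus K n x) = 1 \<and> aug K (iter_bd_plus K n x) = 1)"

definition strongly_loop_free_basis :: "'a adc \<Rightarrow> (nat \<Rightarrow> 'a set) \<Rightarrow> bool" where
  "strongly_loop_free_basis K B \<longleftrightarrow> (\<exists>r. partial_order_on (SIGMA n:UNIV. B n) r \<and>
     (\<forall>n. \<forall>x \<in> B n. \<forall>y \<in> B (Suc n).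
        x \<preceq>\<^bsub>grp K n\<^esub> adc_bd_minus K n y \<longrightarrow> ((n, x), (Suc n, y)) \<in> r) \<and>
     (\<forall>n. \<forall>x \<in> B (Suc n). \<forall>y \<in> B n.
        y \<preceq>\<^bsub>grp K n\<^esub> adc_bd_plus K n x \<longrightarrow> ((Suc n, x), (n, y)) \<in> r))"

definition strong_steiner_complex :: "'a adc \<Rightarrow> bool" where
  "strong_steiner_complex K \<longleftrightarrow> augmented_directed_complex K \<and>
     (\<exists>B. adc_basis K B \<and> unital_basis K B \<and> strongly_loop_free_basis K B)"

definition SSC :: "('a adc, nat \<Rightarrow> 'a \<Rightarrow> 'a) cat" where
  "SSC = full_subcategory ADC {K. strong_steiner_complex K}"

end

theory Submission
  imports Defs "HOL-Algebra.Free_Abelian_Groups"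
begin

text \<open>
  The functor sends a parity complex \<open>C\<close> to the free augmented directed complex on its cells, with
  \<open>\<partial> x = x\<^sup>+ - x\<^sup>-\<close>. Both sides are governed by one notion: a chain \<open>c\<close> of degree \<open>n + 1\<close> is
  a cell if it is nonnegative and \<open>d + \<partial> c \<ge> 0\<close> for some cell \<open>d\<close> of degree \<open>n\<close>, and in degree \<open>0\<close>
  if it is a single generator. Removing from a cell its generators one at a time, in an order
  provided by loop-freeness, moves \<open>d\<close> through cells of degree \<open>n\<close>; since these have
  coefficients at most \<open>1\<close>, each face is consumed and produced at most once, so that \<open>c\<close> is
  (the sum of) a well-formed set. By unitality every generator and each of its iterated faces is a
  cell, hence a strong Steiner complex is the free complex on a parity complex. Monotone augmented
  chain maps preserve cells, so they send generators to well-formed sets; the same fact makes the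
  unions in the definition of morphisms of parity complexes disjoint, so that such morphisms
  extend linearly to chain maps.
\<close>

section \<open>Integral chains\<close>

text \<open>Objects are compared through coordinates. A \<open>presentation\<close> identifies a
  complex with the free one on the cells of a parity complex, and \<open>extend_hom\<close> matches
  morphisms of parity complexes with chain maps between any two presented complexes. This one
  bijection serves twice: between free complexes it gives full faithfulness, and applied to the
  identity of a parity complex that presents two complexes it gives the isomorphisms for essential
  surjectivity. The inverse functor comes from choice.

  The obstacle on morphisms is a circularity: the unions in the definition of a morphism agree with
  linear extension only if they are disjoint, disjointness comes from images being cells, and that
  uses the chain map equation. The circle is broken by degree: in degree \<open>n\<close> only the
  equations below \<open>n\<close> enter.

  The obstacle on objects is size: chains over \<open>'a\<close> must again be elements of
  \<open>'a\<close>, which is where an infinite \<open>'a\<close> and a coding of chains by elements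
  come in.\<close>

abbreviation "lookup \<equiv> Poly_Mapping.lookup"
abbreviation "keys \<equiv> Poly_Mapping.keys"

definition nonneg :: "('a \<Rightarrow>\<^sub>0 int) \<Rightarrow> bool" where
  "nonneg c \<longleftrightarrow> (\<forall>x. 0 \<le> lookup c x)"

definition pos_chain :: "('a \<Rightarrow>\<^sub>0 int) \<Rightarrow> 'a \<Rightarrow>\<^sub>0 int" where
  "pos_chain c = Poly_Mapping.map (max 0) c"

definition neg_chain :: "('a \<Rightarrow>\<^sub>0 int) \<Rightarrow> 'a \<Rightarrow>\<^sub>0 int" where
  "neg_chain c = pos_chain (- c)"

definition set_chain :: "'a set \<Rightarrow> 'a \<Rightarrow>\<^sub>0 int" where
  "set_chain S = (\<Sum>x\<in>S. frag_of x)"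

definition coeff_sum :: "('a \<Rightarrow>\<^sub>0 int) \<Rightarrow> int" where
  "coeff_sum c = (\<Sum>x\<in>keys c. lookup c x)"

lemma lookup_pos_chain [simp]: "lookup (pos_chain c) x = max 0 (lookup c x)"
  by (auto simp: pos_chain_def Poly_Mapping.map.rep_eq when_def)

lemma lookup_neg_chain [simp]: "lookup (neg_chain c) x = max 0 (- lookup c x)"
  by (simp add: neg_chain_def)

lemma keys_pos_chain: "keys (pos_chain c) = {x. 0 < lookup c x}"
  by (auto simp: in_keys_iff max_def split: if_splits)

lemma keys_neg_chain: "keys (neg_chain c) = {x. lookup c x < 0}"
  by (auto simp: in_keys_iff max_def split: if_splits)

lemma keys_neg_chain_subset: "keys (neg_chain c) \<subseteq> keys c"
  by (auto simp: in_keys_iff max_def split: if_splits)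

lemma keys_pos_chain_subset: "keys (pos_chain c) \<subseteq> keys c"
  by (auto simp: in_keys_iff max_def split: if_splits)

lemma pos_chain_minus_neg_chain: "pos_chain c - neg_chain c = c"
  by (rule poly_mapping_eqI) (simp add: lookup_minus max_def)

lemma nonneg_simps [simp]: "nonneg 0" "nonneg (frag_of x)" "nonneg (pos_chain c)" "nonneg (neg_chain c)"
  by (simp_all add: nonneg_def)

lemma nonnegD: "nonneg c \<Longrightarrow> 0 \<le> lookup c x"
  by (simp add: nonneg_def)

lemma nonneg_keys: "nonneg c \<Longrightarrow> x \<in> keys c \<Longrightarrow> 1 \<le> lookup c x"
  using nonnegD[of c x] by (simp add: in_keys_iff)

lemma nonneg_add: "nonneg c \<Longrightarrow> nonneg d \<Longrightarrow> nonneg (c + d)"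
  by (simp add: nonneg_def lookup_add)

lemma nonneg_sum: "(\<And>i. i \<in> I \<Longrightarrow> nonneg (f i)) \<Longrightarrow> nonneg (sum f I)"
  by (induction I rule: infinite_finite_induct) (auto intro: nonneg_add)

lemma nonneg_pos_chain: "nonneg c \<Longrightarrow> pos_chain c = c"
  by (rule poly_mapping_eqI) (simp add: nonneg_def max_def)

lemma lookup_frag_extend: "lookup (frag_extend f c) z = (\<Sum>x\<in>keys c. lookup c x * lookup (f x) z)"
  by (simp add: frag_extend_def lookup_sum)

lemma nonneg_frag_extend:
  assumes "nonneg c" "\<And>x. x \<in> keys c \<Longrightarrow> nonneg (f x)"
  shows "nonneg (frag_extend f c)"
  using assms by (auto simp: nonneg_def lookup_frag_extend intro!: sum_nonneg)

lemma keys_frag_extend_subset: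
  "(\<And>x. x \<in> keys c \<Longrightarrow> keys (f x) \<subseteq> A) \<Longrightarrow> keys (frag_extend f c) \<subseteq> A"
  using keys_frag_extend[of f c] by blast

lemma keys_add_subset: "keys c \<subseteq> A \<Longrightarrow> keys d \<subseteq> A \<Longrightarrow> keys (c + d) \<subseteq> A"
  using Poly_Mapping.keys_add[of c d] by blast

lemma frag_extend_compose: "frag_extend f (frag_extend g c) = frag_extend (\<lambda>x. frag_extend f (g x)) c"
  using subset_UNIV by (rule frag_induction[where P = "\<lambda>c. frag_extend f (frag_extend g c) = frag_extend (\<lambda>x. frag_extend f (g x)) c"])
    (simp_all add: frag_extend_diff)

lemma frag_extend_frag_of [simp]: "frag_extend frag_of c = c"
  using frag_expansion[of c] by simp

text \<open>Integers are the chains over a one-point set, so the additivity of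
  \<open>coeff_sum\<close> is inherited from \<open>frag_extend\<close>.\<close>

lemma coeff_sum_eq_frag_extend: "coeff_sum c = lookup (frag_extend (\<lambda>_. frag_of ()) c) ()"
  by (simp add: coeff_sum_def lookup_frag_extend)

lemma coeff_sum_simps [simp]: "coeff_sum 0 = 0" "coeff_sum (frag_of x) = 1"
    "coeff_sum (c + d) = coeff_sum c + coeff_sum d" "coeff_sum (c - d) = coeff_sum c - coeff_sum d"
  by (simp_all add: coeff_sum_eq_frag_extend frag_extend_add frag_extend_diff lookup_add lookup_minus)

lemma coeff_sum_frag_extend:
  assumes "\<And>x. x \<in> keys c \<Longrightarrow> coeff_sum (f x) = 1"
  shows "coeff_sum (frag_extend f c) = coeff_sum c"
  using subset_refl[of "keys c"]
  by (rule frag_induction) (use assms in \<open>simp_all add: frag_extend_diff\<close>)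

lemma coeff_sum_frag_extend_0:
  assumes "keys c \<subseteq> A" "\<And>x. x \<in> A \<Longrightarrow> coeff_sum (f x) = 0"
  shows "coeff_sum (frag_extend f c) = 0"
  using assms(1) by (rule frag_induction) (use assms in \<open>simp_all add: frag_extend_diff\<close>)

text \<open>Every coefficient on the support is at least 1, so a sum of 1 leaves room for one
  generator only. This is why cells of degree 0 are singletons.\<close>

lemma nonneg_coeff_sum_1:
  assumes "nonneg c" "coeff_sum c = 1"
  obtains x where "c = frag_of x"
proof -
  have "keys c \<noteq> {}"
    using assms(2) by (auto simp: coeff_sum_def)
  then obtain x where x: "x \<in> keys c" by blast
  have pos: "0 < lookup c y" if "y \<in> keys c" for y
    using that assms(1) by (metis in_keys_iff nonnegD order_le_less)
  have split: "1 = lookup c x + (\<Sum>y\<in>keys c - {x}. lookup c y)"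
    using assms(2) x by (simp add: coeff_sum_def sum.remove)
  have rest: "0 \<le> (\<Sum>y\<in>keys c - {x}. lookup c y)"
    by (intro sum_nonneg nonnegD assms)
  have "(\<Sum>y\<in>keys c - {x}. lookup c y) = 0" and one: "lookup c x = 1"
    using split rest pos[OF x] by linarith+
  then have "\<forall>y\<in>keys c - {x}. lookup c y = 0"
    by (subst (asm) sum_nonneg_eq_0_iff) (auto intro: nonnegD assms)
  then have "c = frag_of x"
    using one by (intro poly_mapping_eqI) (auto simp: in_keys_iff)
  then show ?thesis by (rule that)
qed

lemma lookup_set_chain: "finite S \<Longrightarrow> lookup (set_chain S) x = (if x \<in> S then 1 else 0)"
  by (simp add: set_chain_def lookup_sum)

lemma keys_set_chain: "finite S \<Longrightarrow> keys (set_chain S) = S"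
  unfolding set_eq_iff in_keys_iff by (auto simp: lookup_set_chain)

lemma set_chain_simps [simp]: "set_chain {} = 0" "set_chain {x} = frag_of x"
  by (simp_all add: set_chain_def)

lemma nonneg_set_chain [simp]: "nonneg (set_chain S)"
  unfolding set_chain_def by (rule nonneg_sum) simp

lemma frag_extend_set_chain: "finite S \<Longrightarrow> frag_extend f (set_chain S) = (\<Sum>x\<in>S. f x)"
  by (simp add: set_chain_def frag_extend_sum o_def)

lemma coeff_sum_set_chain: "finite S \<Longrightarrow> coeff_sum (set_chain S) = int (card S)"
  by (simp add: coeff_sum_def keys_set_chain lookup_set_chain)

lemma set_chain_keys:
  assumes "nonneg c" "\<And>x. lookup c x \<le> 1"
  shows "set_chain (keys c) = c"
proof (rule poly_mapping_eqI)
  fix x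
  show "lookup (set_chain (keys c)) x = lookup c x"
    using assms(2)[of x] nonnegD[OF assms(1), of x] by (auto simp: lookup_set_chain in_keys_iff)
qed

text \<open>A union forgets multiplicities; the bound 1 on the sum says that there are none to
  forget. All passages from unions of images to linear extensions go through this.\<close>

lemma set_chain_UN:
  assumes "finite Y" "\<And>y. y \<in> Y \<Longrightarrow> finite (f y)"
    and "\<And>z. lookup (\<Sum>y\<in>Y. set_chain (f y)) z \<le> 1"
  shows "set_chain (\<Union>y\<in>Y. f y) = (\<Sum>y\<in>Y. set_chain (f y))"
proof -
  let ?c = "\<Sum>y\<in>Y. set_chain (f y)"
  have nn: "nonneg ?c" by (intro nonneg_sum) simp
  have "z \<in> keys ?c \<longleftrightarrow> z \<in> (\<Union>y\<in>Y. f y)" for z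
    using assms(1,2)
    by (simp add: in_keys_iff lookup_sum lookup_set_chain sum_nonneg_eq_0_iff)
  then have "keys ?c = (\<Union>y\<in>Y. f y)" by blast
  then show ?thesis using set_chain_keys[OF nn] assms(3) by metis
qed

lemma keys_map_int: "keys (Poly_Mapping.map int c) = keys c"
  by transfer (auto simp: when_def)

lemma lookup_map_int: "lookup (Poly_Mapping.map int c) x = int (lookup c x)"
  by transfer (auto simp: when_def)

text \<open>The size is the coefficient sum, so a generator of multiplicity \<open>k\<close> is
  removed in \<open>k\<close> separate steps. Multiplicities must be allowed, since their absence is
  what the induction will prove.\<close>

lemma chain_size_induct [consumes 1, case_names step]:
  assumes "nonneg c"
    and step: "\<And>c. nonneg c \<Longrightarrow> (\<And>b. b \<in> keys c \<Longrightarrow> P (c - frag_of b)) \<Longrightarrow> P c"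
  shows "P c"
  using assms(1)
proof (induction "nat (coeff_sum c)" arbitrary: c rule: less_induct)
  case less
  show ?case
  proof (rule step[OF less.prems])
    fix b assume b: "b \<in> keys c"
    then have 1: "1 \<le> lookup c b"
      using nonnegD[OF less.prems, of b] by (simp add: in_keys_iff)
    \<comment> \<open>The size is therefore positive, and \<open>nat\<close> of it really
      decreases.\<close>
    have "lookup c b \<le> coeff_sum c"
      unfolding coeff_sum_def using b by (intro member_le_sum nonnegD less.prems) auto
    moreover have "nonneg (c - frag_of b)"
      using 1 less.prems by (auto simp: nonneg_def lookup_minus)
    ultimately show "P (c - frag_of b)"
      using 1 by (intro less.hyps) auto
  qed
qed

section \<open>Free complexes with a loop-free unital basis\<close>

lemma finite_partial_order_extremal:
  assumes r: "partial_order_on A r" and S: "finite S" "S \<noteq> {}"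
  obtains b where "b \<in> S" "\<And>x. x \<in> S \<Longrightarrow> (x, b) \<in> r \<Longrightarrow> x = b"
proof -
  have "acyclic (r - Relation.Id)" using r by (rule partial_order_on_acyclic)
  \<comment> \<open>On the finite square S \<times> S acyclicity yields well-foundedness, and
    thereby a minimal element.\<close>
  then have "acyclic ((r - Relation.Id) \<inter> S \<times> S)" by (rule acyclic_subset) blast
  then have "wf ((r - Relation.Id) \<inter> S \<times> S)"
    using S(1) by (intro finite_acyclic_wf) auto
  then obtain b where "b \<in> S" "\<And>y. (y, b) \<in> (r - Relation.Id) \<inter> S \<times> S \<Longrightarrow> y \<notin> S"
    using S(2) by (metis all_not_in_conv wfE_min)
  then show ?thesis using that by blast
qed

text \<open>The coordinate forms of \<open>iter_bd_minus\<close> and \<open>iter_bd_plus\<close>: at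
  each stage the parts are taken of the boundary of the whole chain, after cancellation.\<close>

primrec iter_neg :: "(nat \<Rightarrow> 'a \<Rightarrow> 'a \<Rightarrow>\<^sub>0 int) \<Rightarrow> nat \<Rightarrow> ('a \<Rightarrow>\<^sub>0 int) \<Rightarrow> 'a \<Rightarrow>\<^sub>0 int" where
  "iter_neg \<delta> 0 c = c"
| "iter_neg \<delta> (Suc n) c = iter_neg \<delta> n (neg_chain (frag_extend (\<delta> n) c))"

primrec iter_pos :: "(nat \<Rightarrow> 'a \<Rightarrow> 'a \<Rightarrow>\<^sub>0 int) \<Rightarrow> nat \<Rightarrow> ('a \<Rightarrow>\<^sub>0 int) \<Rightarrow> 'a \<Rightarrow>\<^sub>0 int" where
  "iter_pos \<delta> 0 c = c"
| "iter_pos \<delta> (Suc n) c = iter_pos \<delta> n (pos_chain (frag_extend (\<delta> n) c))"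

text \<open>The common coordinate form of both kinds of objects. Unitality is stated for negative
  faces and transferred to positive ones in \<open>unit_chain_iter_pos\<close>.\<close>

locale steiner_data =
  fixes B :: "nat \<Rightarrow> 'a set" and \<delta> :: "nat \<Rightarrow> 'a \<Rightarrow> 'a \<Rightarrow>\<^sub>0 int"
  assumes keys_bd: "x \<in> B (Suc n) \<Longrightarrow> keys (\<delta> n x) \<subseteq> B n"
    and bd_bd: "x \<in> B (Suc (Suc n)) \<Longrightarrow> frag_extend (\<delta> n) (\<delta> (Suc n) x) = 0"
    and coeff_sum_bd: "x \<in> B (Suc 0) \<Longrightarrow> coeff_sum (\<delta> 0 x) = 0"
    and unital: "x \<in> B n \<Longrightarrow> coeff_sum (iter_neg \<delta> n (frag_of x)) = 1"
    and loop_free: "\<exists>r. partial_order_on (SIGMA n:UNIV. B n) r \<and>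
      (\<forall>n. \<forall>x \<in> B n. \<forall>y \<in> B (Suc n). lookup (\<delta> n y) x < 0 \<longrightarrow> ((n, x), (Suc n, y)) \<in> r) \<and>
      (\<forall>n. \<forall>x \<in> B (Suc n). \<forall>y \<in> B n. 0 < lookup (\<delta> n x) y \<longrightarrow> ((Suc n, x), (n, y)) \<in> r)"
begin

abbreviation "bdry n \<equiv> frag_extend (\<delta> n)"

section \<open>Boundaries and cells\<close>

lemma keys_bdry: "keys c \<subseteq> B (Suc n) \<Longrightarrow> keys (bdry n c) \<subseteq> B n"
  by (intro keys_frag_extend_subset keys_bd) auto

lemma bdry_bdry: "keys c \<subseteq> B (Suc (Suc n)) \<Longrightarrow> bdry n (bdry (Suc n) c) = 0"
  unfolding frag_extend_compose by (rule frag_extend_eq_0) (use bd_bd in blast)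

lemma coeff_sum_bdry: "keys c \<subseteq> B (Suc 0) \<Longrightarrow> coeff_sum (bdry 0 c) = 0"
  by (rule coeff_sum_frag_extend_0) (use coeff_sum_bd in auto)

text \<open>
  Unlike the chains \<open>c\<close> with \<open>coeff_sum ((\<partial>\<^sup>-)\<^sup>n c) = 1\<close>, the cells below are visibly
  preserved by monotone augmented chain maps and by replacing \<open>c\<close> with \<open>c + \<partial> e\<close>.
\<close>

primrec cell :: "nat \<Rightarrow> ('a \<Rightarrow>\<^sub>0 int) \<Rightarrow> bool" where
  "cell 0 c \<longleftrightarrow> nonneg c \<and> keys c \<subseteq> B 0 \<and> coeff_sum c = 1"
| "cell (Suc n) c \<longleftrightarrow> nonneg c \<and> keys c \<subseteq> B (Suc n) \<and> (\<exists>d. cell n d \<and> nonneg (d + bdry n c))"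

lemma cell_nonneg: "cell n c \<Longrightarrow> nonneg c"
  by (cases n) auto

lemma cell_keys: "cell n c \<Longrightarrow> keys c \<subseteq> B n"
  by (cases n) auto

text \<open>In degree 0 boundaries have coefficient sum 0. In higher degrees
  \<open>bdry_bdry\<close> leaves the boundary unchanged, so the same witness \<open>d\<close>
  works.\<close>

lemma cell_add_bdry:
  assumes "cell n c" "keys e \<subseteq> B (Suc n)" "nonneg (c + bdry n e)"
  shows "cell n (c + bdry n e)"
proof (cases n)
  case 0
  then show ?thesis
    using assms keys_bdry[of e n] coeff_sum_bdry[of e] keys_add_subset[of c "B 0" "bdry 0 e"] by auto
next
  case (Suc m)
  then show ?thesis
    using assms keys_bdry[of e n] bdry_bdry[of e m]
      keys_add_subset[of c "B n" "bdry n e"] by (auto simp: frag_extend_add)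
qed

text \<open>The witness in each degree is the negative part \<open>d\<close> of the boundary, for
  which \<open>d + bdry n c\<close> is the positive part.\<close>

lemma cellI:
  assumes "nonneg c" "keys c \<subseteq> B n" "coeff_sum (iter_neg \<delta> n c) = 1"
  shows "cell n c"
  using assms
proof (induction n arbitrary: c)
  case (Suc n)
  let ?d = "neg_chain (bdry n c)"
  have "cell n ?d"
    using Suc.prems keys_bdry[of c n] keys_neg_chain_subset[of "bdry n c"]
    by (intro Suc.IH) auto
  moreover have "?d + bdry n c = pos_chain (bdry n c)"
    using pos_chain_minus_neg_chain[of "bdry n c"] by (simp add: algebra_simps)
  ultimately show ?case using Suc.prems by auto
qed simp

text \<open>In the global order the shared face \<open>z\<close> lies between \<open>x\<close> and
  \<open>y\<close>, so transitivity compares the two generators inside one degree.\<close>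

lemma loop_free_order:
  obtains r where "partial_order_on (B (Suc n)) r"
    "\<And>x y z. \<lbrakk>x \<in> B (Suc n); y \<in> B (Suc n); 0 < lookup (\<delta> n x) z; lookup (\<delta> n y) z < 0\<rbrakk> \<Longrightarrow> (x, y) \<in> r"
proof -
  obtain r where r: "partial_order_on (SIGMA n:UNIV. B n) r"
    and r1: "\<And>n x y. x \<in> B n \<Longrightarrow> y \<in> B (Suc n) \<Longrightarrow> lookup (\<delta> n y) x < 0 \<Longrightarrow> ((n, x), (Suc n, y)) \<in> r"
    and r2: "\<And>n x y. x \<in> B (Suc n) \<Longrightarrow> y \<in> B n \<Longrightarrow> 0 < lookup (\<delta> n x) y \<Longrightarrow> ((Suc n, x), (n, y)) \<in> r"
    using loop_free by meson
  define r' where "r' = {(x, y). ((Suc n, x), (Suc n, y)) \<in> r}"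
  have "partial_order_on (B (Suc n)) r'"
    using r unfolding r'_def order_on_defs refl_on_def trans_def antisym_def by blast
  moreover have "(x, y) \<in> r'"
    if "x \<in> B (Suc n)" "y \<in> B (Suc n)" "0 < lookup (\<delta> n x) z" "lookup (\<delta> n y) z < 0" for x y z
  proof -
    have "z \<in> B n" using keys_bd[OF that(1)] that(3) by (auto simp: in_keys_iff)
    then have "((Suc n, x), (n, z)) \<in> r" "((n, z), (Suc n, y)) \<in> r"
      using r1 r2 that by auto
    then show ?thesis
      using partial_order_onD(2)[OF r] unfolding r'_def trans_def by blast
  qed
  ultimately show ?thesis using that by blast
qed

text \<open>Take \<open>b\<close> minimal in the support. A generator \<open>x\<close> that produces
  a face consumed by \<open>b\<close> would lie below \<open>b\<close>, hence equal
  \<open>b\<close>, and one coefficient cannot have both signs.\<close>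

lemma first_generator:
  assumes "keys c \<subseteq> B (Suc n)" "c \<noteq> 0"
  obtains b where "b \<in> keys c" "\<And>x z. \<lbrakk>x \<in> keys c; lookup (\<delta> n b) z < 0\<rbrakk> \<Longrightarrow> lookup (\<delta> n x) z \<le> 0"
proof -
  obtain r where r: "partial_order_on (B (Suc n)) r"
    and step: "\<And>x y z. \<lbrakk>x \<in> B (Suc n); y \<in> B (Suc n); 0 < lookup (\<delta> n x) z; lookup (\<delta> n y) z < 0\<rbrakk>
      \<Longrightarrow> (x, y) \<in> r"
    using loop_free_order by metis
  obtain b where b: "b \<in> keys c" "\<And>x. x \<in> keys c \<Longrightarrow> (x, b) \<in> r \<Longrightarrow> x = b"
    using finite_partial_order_extremal[OF r, of "keys c"] assms(2) by auto
  show ?thesis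
    by (rule that[OF b(1)]) (metis assms(1) b not_less order.asym step subsetD)
qed

text \<open>The maximal counterpart, obtained from the converse order.\<close>

lemma last_generator:
  assumes "keys c \<subseteq> B (Suc n)" "c \<noteq> 0"
  obtains b where "b \<in> keys c" "\<And>x z. \<lbrakk>x \<in> keys c; 0 < lookup (\<delta> n b) z\<rbrakk> \<Longrightarrow> 0 \<le> lookup (\<delta> n x) z"
proof -
  obtain r where r: "partial_order_on (B (Suc n)) r"
    and step: "\<And>x y z. \<lbrakk>x \<in> B (Suc n); y \<in> B (Suc n); 0 < lookup (\<delta> n x) z; lookup (\<delta> n y) z < 0\<rbrakk>
      \<Longrightarrow> (x, y) \<in> r"
    using loop_free_order by metis
  obtain b where b: "b \<in> keys c" "\<And>x. x \<in> keys c \<Longrightarrow> (x, b) \<in> r\<inverse> \<Longrightarrow> x = b"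
    using finite_partial_order_extremal[of "B (Suc n)" "r\<inverse>" "keys c"] assms(2) r by auto
  show ?thesis
    by (rule that[OF b(1)]) (metis assms(1) b converse_iff not_less order.asym step subsetD)
qed

section \<open>Faces counted with multiplicity\<close>

abbreviation "neg_faces n \<equiv> frag_extend (\<lambda>x. neg_chain (\<delta> n x))"
abbreviation "pos_faces n \<equiv> frag_extend (\<lambda>x. pos_chain (\<delta> n x))"

text \<open>The counts \<open>neg_faces\<close> and \<open>pos_faces\<close> are taken before
  cancellation, and only their difference is visible in the boundary. Well-formedness is a condition
  on the uncancelled counts, so bounding the boundary would not suffice.\<close>

lemma bdry_faces: "lookup (bdry n c) z = lookup (pos_faces n c) z - lookup (neg_faces n c) z"
proof -
  have "bdry n c = frag_extend (\<lambda>x. pos_chain (\<delta> n x) - neg_chain (\<delta> n x)) c"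
    by (simp add: pos_chain_minus_neg_chain)
  also have "\<dots> = pos_faces n c - neg_faces n c"
    using subset_UNIV by (rule frag_induction[where P = "\<lambda>c. frag_extend (\<lambda>x. pos_chain (\<delta> n x) - neg_chain (\<delta> n x)) c
      = pos_faces n c - neg_faces n c"]) (simp_all add: frag_extend_diff)
  finally show ?thesis by (simp add: lookup_minus)
qed

lemma nonneg_faces: "nonneg c \<Longrightarrow> nonneg (neg_faces n c)" "nonneg c \<Longrightarrow> nonneg (pos_faces n c)"
  by (auto intro: nonneg_frag_extend)

lemma nonneg_remove:
  "nonneg c \<Longrightarrow> b \<in> keys c \<Longrightarrow> nonneg (c - frag_of b)"
  by (auto simp: nonneg_def lookup_minus in_keys_iff) (metis linorder_not_le order_antisym zless_imp_add1_zle add_0)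

lemma keys_remove: "b \<in> keys c \<Longrightarrow> keys (c - frag_of b) \<subseteq> keys c"
  by (auto simp: in_keys_iff lookup_minus split: if_splits)

lemma faces_remove:
  "lookup (neg_faces n c) z = lookup (neg_faces n (c - frag_of b)) z + max 0 (- lookup (\<delta> n b) z)"
  "lookup (pos_faces n c) z = lookup (pos_faces n (c - frag_of b)) z + max 0 (lookup (\<delta> n b) z)"
  by (simp_all add: frag_extend_diff lookup_minus)

text \<open>
  If no face in \<open>\<partial>\<^sup>- b\<close> is a positive face of \<open>c\<close>, then the negative faces of \<open>c\<close> in \<open>\<partial>\<^sup>- b\<close>
  are all supplied by \<open>d\<close>, which has coefficients at most \<open>1\<close>; and \<open>d + \<partial> b\<close> is again a cell
  to which the induction hypothesis for \<open>c - b\<close> applies.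
\<close>

lemma neg_faces_le_1:
  assumes le1: "\<And>d z. cell n d \<Longrightarrow> lookup d z \<le> 1"
    and "nonneg c" "keys c \<subseteq> B (Suc n)" "cell n d" "nonneg (d + bdry n c)"
  shows "lookup (neg_faces n c) z \<le> 1"
  using assms(2-)
proof (induction c arbitrary: d z rule: chain_size_induct)
  case (step c)
  note pc = \<open>nonneg c\<close>
  show ?case
  proof (cases "c = 0")
    case False
    then obtain b where b: "b \<in> keys c"
      and first: "\<And>x z. \<lbrakk>x \<in> keys c; lookup (\<delta> n b) z < 0\<rbrakk> \<Longrightarrow> lookup (\<delta> n x) z \<le> 0"
      using first_generator step.prems by metis
    have bB: "b \<in> B (Suc n)" using b step.prems by auto
    have c': "nonneg (c - frag_of b)" "keys (c - frag_of b) \<subseteq> B (Suc n)"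
      using nonneg_remove[OF pc b] keys_remove[OF b] step.prems by auto
    have pos0: "lookup (neg_faces n c) z \<le> lookup d z" if "lookup (\<delta> n b) z < 0" for z
    proof -
      have "lookup (pos_faces n c) z = 0"
        unfolding lookup_frag_extend using first[OF _ that] by (intro sum.neutral ballI) simp
      then show ?thesis
        using nonnegD[OF step.prems(3), of z] bdry_faces[of n c z] by (simp add: lookup_add)
    qed
    show ?thesis
    proof (cases "lookup (\<delta> n b) z < 0")
      case True
      then show ?thesis using pos0[of z] le1[OF step.prems(2), of z] by linarith
    next
      case nz: False
      \<comment> \<open>Where \<open>b\<close> consumes \<open>y\<close>, the value of
        \<open>d\<close> covers the whole negative count of \<open>c\<close> at \<open>y\<close>, in
        particular the share of \<open>b\<close>. Elsewhere adding the boundary of \<open>b\<close>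
        only increases \<open>d\<close>.\<close>
      have "nonneg (d + bdry n (frag_of b))"
        unfolding nonneg_def
      proof
        fix y
        show "0 \<le> lookup (d + bdry n (frag_of b)) y"
          using pos0[of y] faces_remove(1)[of n c y b] nonnegD[OF nonneg_faces(1)[OF c'(1)], of n y]
            nonnegD[OF cell_nonneg[OF step.prems(2)], of y]
          by (cases "lookup (\<delta> n b) y < 0") (auto simp: lookup_add)
      qed
      then have "cell n (d + bdry n (frag_of b))"
        using step.prems bB by (intro cell_add_bdry) auto
      moreover have "nonneg (d + bdry n (frag_of b) + bdry n (c - frag_of b))"
        using step.prems(3) by (simp add: frag_extend_diff)
      ultimately have "lookup (neg_faces n (c - frag_of b)) z \<le> 1"
        using c'(2) by (intro step.IH[OF b])
      then show ?thesis using faces_remove(1)[of n c z b] nz by simp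
    qed
  qed simp
qed

text \<open>Here the last generator \<open>b\<close> is removed, so the source \<open>d\<close>
  stays fixed and the target changes. Nothing in \<open>c\<close> consumes a positive face of
  \<open>b\<close>, so the positive count of \<open>c\<close> there survives in the target
  \<open>d + bdry n c\<close>, a cell with coefficients at most 1.\<close>

lemma pos_faces_le_1:
  assumes le1: "\<And>d z. cell n d \<Longrightarrow> lookup d z \<le> 1"
    and "nonneg c" "keys c \<subseteq> B (Suc n)" "cell n d" "nonneg (d + bdry n c)"
  shows "lookup (pos_faces n c) z \<le> 1"
  using assms(2-)
proof (induction c arbitrary: z rule: chain_size_induct)
  case (step c)
  note pc = \<open>nonneg c\<close>
  have cell': "cell n (d + bdry n c)"
    using step.prems by (intro cell_add_bdry) auto
  show ?case
  proof (cases "c = 0")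
    case False
    then obtain b where b: "b \<in> keys c"
      and last: "\<And>x z. \<lbrakk>x \<in> keys c; 0 < lookup (\<delta> n b) z\<rbrakk> \<Longrightarrow> 0 \<le> lookup (\<delta> n x) z"
      using last_generator step.prems by metis
    have c': "nonneg (c - frag_of b)" "keys (c - frag_of b) \<subseteq> B (Suc n)"
      using nonneg_remove[OF pc b] keys_remove[OF b] step.prems by auto
    have neg0: "lookup (d + bdry n c) z = lookup d z + lookup (pos_faces n c) z"
      if "0 < lookup (\<delta> n b) z" for z
    proof -
      have "lookup (neg_faces n c) z = 0"
        unfolding lookup_frag_extend using last[OF _ that] by (intro sum.neutral ballI) simp
      then show ?thesis using bdry_faces[of n c z] by (simp add: lookup_add)
    qed
    show ?thesis
    proof (cases "0 < lookup (\<delta> n b) z")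
      case True
      then show ?thesis
        using neg0[of z] le1[OF cell', of z] nonnegD[OF cell_nonneg[OF step.prems(2)], of z] by linarith
    next
      case nz: False
      \<comment> \<open>Undoing \<open>b\<close> subtracts its coefficient at \<open>y\<close>. If
        that is positive, \<open>neg0\<close> shows that the target contains the full positive
        count, which includes it.\<close>
      have "nonneg (d + bdry n (c - frag_of b))"
        unfolding nonneg_def
      proof
        fix y
        have "lookup (d + bdry n (c - frag_of b)) y = lookup (d + bdry n c) y - lookup (\<delta> n b) y"
          by (simp add: lookup_add lookup_minus frag_extend_diff)
        then show "0 \<le> lookup (d + bdry n (c - frag_of b)) y"
          using neg0[of y] faces_remove(2)[of n c y b] nonnegD[OF nonneg_faces(2)[OF c'(1)], of n y]
            nonnegD[OF cell_nonneg[OF step.prems(2)], of y] nonnegD[OF step.prems(3), of y]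
          by linarith
      qed
      then have "lookup (pos_faces n (c - frag_of b)) z \<le> 1"
        using step.IH[OF b] step.prems c' by simp
      then show ?thesis using faces_remove(2)[of n c z b] nz by simp
    qed
  qed simp
qed

text \<open>If the negative part vanished, so would all its iterated negative faces, against the
  coefficient sum 1 required by unitality.\<close>

lemma generator_neg_face:
  assumes "b \<in> B (Suc n)"
  obtains z where "lookup (\<delta> n b) z < 0"
proof -
  have iter0: "iter_neg \<delta> k 0 = 0" for k
    by (induction k) (simp_all add: neg_chain_def nonneg_pos_chain)
  have "neg_chain (\<delta> n b) \<noteq> 0"
    using unital[OF assms] iter0[of n] by auto
  then obtain z where "lookup (neg_chain (\<delta> n b)) z \<noteq> 0"
    by (metis lookup_zero poly_mapping_eqI)
  then show ?thesis using that[of z] by (auto simp: max_def split: if_splits)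
qed

text \<open>A generator of multiplicity \<open>k\<close> contributes at least \<open>k\<close> to
  the count of any of its negative faces, and it has one. The induction hypothesis in the degree
  below bounds that count by 1.\<close>

lemma cell_le_1: "cell n c \<Longrightarrow> lookup c x \<le> 1"
proof (induction n arbitrary: c x)
  case 0
  then obtain y where "c = frag_of y" using nonneg_coeff_sum_1 by auto
  then show ?case by simp
next
  case (Suc n)
  obtain d where d: "cell n d" "nonneg (d + bdry n c)" and c: "nonneg c" "keys c \<subseteq> B (Suc n)"
    using Suc.prems by auto
  show ?case
  proof (cases "x \<in> keys c")
    case True
    then obtain z where z: "lookup (\<delta> n x) z < 0"
      using generator_neg_face c by blast
    have "lookup c x * 1 \<le> lookup c x * lookup (neg_chain (\<delta> n x)) z"
      using z by (intro mult_left_mono nonnegD c) auto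
    also have "\<dots> \<le> lookup (neg_faces n c) z"
      unfolding lookup_frag_extend using True
      by (intro member_le_sum[where f = "\<lambda>x. lookup c x * lookup (neg_chain (\<delta> n x)) z"])
        (auto intro!: mult_nonneg_nonneg nonnegD c)
    also have "\<dots> \<le> 1"
      using neg_faces_le_1[OF Suc.IH c d] by simp
    finally show ?thesis by simp
  qed (simp add: in_keys_iff)
qed

lemma cell_faces_le_1:
  assumes "cell (Suc n) c"
  shows "lookup (neg_faces n c) z \<le> 1" "lookup (pos_faces n c) z \<le> 1"
  using assms neg_faces_le_1[of n c] pos_faces_le_1[of n c] cell_le_1 by auto

lemma set_chain_cell: "cell n c \<Longrightarrow> set_chain (keys c) = c"
  by (rule set_chain_keys) (auto intro: cell_nonneg cell_le_1)

section \<open>Generators as cells, and unit chains\<close>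

lemma cell_generator: "b \<in> B n \<Longrightarrow> cell n (frag_of b)"
  by (rule cellI) (auto intro: unital)

text \<open>A generator is itself a cell, so its own faces are counted at most once. Hence its
  boundary can be recovered from two sets of faces.\<close>

lemma bd_coeffs:
  assumes "b \<in> B (Suc n)"
  shows "lookup (\<delta> n b) z \<in> {-1, 0, 1}"
  using cell_faces_le_1[OF cell_generator[OF assms], of z] by auto

text \<open>Unlike cells, these chains are closed under both parts of the boundary, as iterating
  faces requires: if \<open>B 0\<close> is nonempty, the zero chain of degree 1 is a cell, but its
  faces are not.\<close>

definition unit_chain :: "nat \<Rightarrow> ('a \<Rightarrow>\<^sub>0 int) \<Rightarrow> bool" where
  "unit_chain n c \<longleftrightarrow> nonneg c \<and> keys c \<subseteq> B n \<and> coeff_sum (iter_neg \<delta> n c) = 1"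

lemma unit_chain_cell: "unit_chain n c \<Longrightarrow> cell n c"
  by (simp add: unit_chain_def cellI)

lemma unit_chain_generator: "b \<in> B n \<Longrightarrow> unit_chain n (frag_of b)"
  by (simp add: unit_chain_def unital)

lemma unit_chain_neg: "unit_chain (Suc n) c \<Longrightarrow> unit_chain n (neg_chain (bdry n c))"
  using keys_neg_chain_subset[of "bdry n c"] keys_bdry[of c n] by (auto simp: unit_chain_def)

text \<open>The two chains inside differ by a boundary, which \<open>bdry n\<close> kills. This is
  globularity at the level of chains.\<close>

lemma bdry_pos_neg: "keys c \<subseteq> B (Suc (Suc n)) \<Longrightarrow>
  bdry n (pos_chain (bdry (Suc n) c)) = bdry n (neg_chain (bdry (Suc n) c))"
  using bdry_bdry[of c n] frag_extend_diff[of "\<delta> n" "pos_chain (bdry (Suc n) c)" "neg_chain (bdry (Suc n) c)"]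
  by (simp add: pos_chain_minus_neg_chain)

text \<open>For positive \<open>n\<close> the iteration sees a chain only through its boundary,
  which is the same for both parts by \<open>bdry_pos_neg\<close>. For \<open>n = 0\<close> the
  parts have equal coefficient sums because a boundary has sum 0.\<close>

lemma unit_chain_pos:
  assumes "unit_chain (Suc n) c"
  shows "unit_chain n (pos_chain (bdry n c))"
proof -
  have keys: "keys (pos_chain (bdry n c)) \<subseteq> B n"
    using assms keys_pos_chain_subset[of "bdry n c"] keys_bdry[of c n] by (auto simp: unit_chain_def)
  have "iter_neg \<delta> n (pos_chain (bdry n c)) = iter_neg \<delta> n (neg_chain (bdry n c))" if "n = Suc m" for m
    using assms that by (simp add: unit_chain_def bdry_pos_neg)
  moreover have "coeff_sum (pos_chain (bdry n c)) = coeff_sum (neg_chain (bdry n c))" if "n = 0"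
    using assms that coeff_sum_bdry[of c]
      coeff_sum_simps(4)[of "pos_chain (bdry 0 c)" "neg_chain (bdry 0 c)"]
    by (simp add: unit_chain_def pos_chain_minus_neg_chain)
  ultimately have "coeff_sum (iter_neg \<delta> n (pos_chain (bdry n c))) = coeff_sum (iter_neg \<delta> n (neg_chain (bdry n c)))"
    by (cases n) simp_all
  then show ?thesis using assms keys by (simp add: unit_chain_def)
qed

lemma unit_chain_iter_pos: "unit_chain n c \<Longrightarrow> coeff_sum (iter_pos \<delta> n c) = 1"
proof (induction n arbitrary: c)
  case (Suc n)
  then show ?case using unit_chain_pos by simp
qed (simp add: unit_chain_def)

end

section \<open>Parity complexes and their chains\<close>

definition cell_bd :: "'a parity_structure \<Rightarrow> nat \<Rightarrow> 'a \<Rightarrow> 'a \<Rightarrow>\<^sub>0 int" where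
  "cell_bd C n x = set_chain (pface C n x) - set_chain (mface C n x)"

lemma set_chain_UN_disjoint:
  assumes "finite S" "\<And>x. x \<in> S \<Longrightarrow> finite (f x)"
    and "\<And>x y. \<lbrakk>x \<in> S; y \<in> S; x \<noteq> y\<rbrakk> \<Longrightarrow> f x \<inter> f y = {}"
  shows "set_chain (\<Union>x\<in>S. f x) = (\<Sum>x\<in>S. set_chain (f x))"
  unfolding set_chain_def using assms by (intro sum.UNION_disjoint) auto

lemma pos_neg_chain_diff:
  assumes "finite P" "finite M"
  shows "neg_chain (set_chain P - set_chain M) = set_chain (M - P)"
    "pos_chain (set_chain P - set_chain M) = set_chain (P - M)"
  using assms by (auto intro!: poly_mapping_eqI simp: lookup_minus lookup_set_chain)

section \<open>Faces of well-formed sets as parts of boundaries\<close>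

context parity_structure
begin

lemma finite_faces: "x \<in> cells C (Suc n) \<Longrightarrow> finite (mface C n x)" "x \<in> cells C (Suc n) \<Longrightarrow> finite (pface C n x)"
  using mface_in pface_in by (auto simp: Fpow_def)

lemma faces_subset: "x \<in> cells C (Suc n) \<Longrightarrow> mface C n x \<subseteq> cells C n" "x \<in> cells C (Suc n) \<Longrightarrow> pface C n x \<subseteq> cells C n"
  using mface_in pface_in by (auto simp: Fpow_def)

lemma finite_set_faces:
  assumes "finite S" "S \<subseteq> cells C (Suc n)"
  shows "finite (set_mface C n S)" "finite (set_pface C n S)"
  using assms finite_faces by (auto simp: set_mface_def set_pface_def)

lemma lookup_cell_bd:
  assumes "x \<in> cells C (Suc n)"
  shows "lookup (cell_bd C n x) z < 0 \<longleftrightarrow> z \<in> mface C n x"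
    "0 < lookup (cell_bd C n x) z \<longleftrightarrow> z \<in> pface C n x"
  using finite_faces[OF assms] faces_disjoint[OF assms]
  by (auto simp: cell_bd_def lookup_minus lookup_set_chain)

lemma neg_pos_cell_bd:
  assumes "x \<in> cells C (Suc n)"
  shows "neg_chain (cell_bd C n x) = set_chain (mface C n x)"
    "pos_chain (cell_bd C n x) = set_chain (pface C n x)"
proof -
  have "mface C n x - pface C n x = mface C n x" "pface C n x - mface C n x = pface C n x"
    using faces_disjoint[OF assms] by auto
  then show "neg_chain (cell_bd C n x) = set_chain (mface C n x)"
    "pos_chain (cell_bd C n x) = set_chain (pface C n x)"
    using finite_faces[OF assms] by (simp_all add: cell_bd_def pos_neg_chain_diff)
qed

text \<open>Well-formedness makes the unions of faces disjoint, so that they agree with the sums in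
  the linear boundary.\<close>

lemma bd_well_formed:
  assumes "well_formed C (Suc n) S" "finite S"
  shows "frag_extend (cell_bd C n) (set_chain S) = set_chain (set_pface C n S) - set_chain (set_mface C n S)"
proof -
  have S: "S \<subseteq> cells C (Suc n)" using assms by (simp add: well_formed_def)
  have "set_chain (set_pface C n S) = (\<Sum>x\<in>S. set_chain (pface C n x))"
    unfolding set_pface_def using assms S finite_faces
    by (intro set_chain_UN_disjoint) (auto simp: well_formed_def)
  moreover have "set_chain (set_mface C n S) = (\<Sum>x\<in>S. set_chain (mface C n x))"
    unfolding set_mface_def using assms S finite_faces
    by (intro set_chain_UN_disjoint) (auto simp: well_formed_def)
  ultimately show ?thesis
    using assms(2) by (simp add: frag_extend_set_chain cell_bd_def sum_subtractf)
qed

lemma neg_pos_bd_well_formed: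
  assumes "well_formed C (Suc n) S" "finite S"
  shows "neg_chain (frag_extend (cell_bd C n) (set_chain S)) = set_chain (set_mpface C n S)"
    "pos_chain (frag_extend (cell_bd C n) (set_chain S)) = set_chain (set_pmface C n S)"
proof -
  have "finite (set_mface C n S)" "finite (set_pface C n S)"
    using assms finite_set_faces by (auto simp: well_formed_def)
  then show "neg_chain (frag_extend (cell_bd C n) (set_chain S)) = set_chain (set_mpface C n S)"
    "pos_chain (frag_extend (cell_bd C n) (set_chain S)) = set_chain (set_pmface C n S)"
    using assms by (simp_all add: bd_well_formed pos_neg_chain_diff set_mpface_def set_pmface_def)
qed

lemma finite_mu:
  assumes "unital C" "x \<in> cells C n" "k \<le> n"
  shows "finite (mu C n x k)"
  using assms(3)
proof (induction k rule: inc_induct)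
  case base
  then show ?case by (simp add: mu.simps[of C n x n])
next
  case (step k)
  have "mu C n x (Suc k) \<subseteq> cells C (Suc k)"
    using assms step by (auto simp: unital_def well_formed_def)
  then show ?case
    using step finite_set_faces by (simp add: mu.simps[of C n x k] set_mpface_def)
qed

text \<open>Unitality keeps every stage well-formed, so set faces and chain faces agree all the way
  down. The case \<open>k = n\<close> turns unitality of \<open>C\<close> into unitality of its
  chains.\<close>

lemma iter_neg_mu:
  assumes "unital C" "x \<in> cells C n" "k \<le> n"
  shows "iter_neg (cell_bd C) k (set_chain (mu C n x k)) = set_chain (mu C n x 0)"
  using assms(3)
proof (induction k)
  case (Suc k)
  have "well_formed C (Suc k) (mu C n x (Suc k))"
    using assms Suc by (auto simp: unital_def)
  then show ?case
    using Suc finite_mu[OF assms(1,2), of "Suc k"]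
    by (simp add: neg_pos_bd_well_formed mu.simps[of C n x k])
qed simp

text \<open>The faces are the first stage below \<open>x\<close> of \<open>mu\<close> and
  \<open>pi_set\<close>, where disjointness makes the set differences trivial.\<close>

lemma well_formed_faces:
  assumes "unital C" "x \<in> cells C (Suc n)"
  shows "well_formed C n (mface C n x)" "well_formed C n (pface C n x)"
proof -
  have "mu C (Suc n) x n = mface C n x" "pi_set C (Suc n) x n = pface C n x"
    using faces_disjoint[OF assms(2)]
    by (auto simp: mu.simps[of C "Suc n"] pi_set.simps[of C "Suc n"]
        set_mpface_def set_pmface_def set_mface_def set_pface_def)
  then show "well_formed C n (mface C n x)" "well_formed C n (pface C n x)"
    using assms unfolding unital_def by (metis le_SucI order_refl)+
qed

end

lemma parity_complex_steiner_data:
  assumes "parity_complex C"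
  shows "steiner_data (cells C) (cell_bd C)"
proof -
  interpret parity_structure C using assms by (simp add: parity_complex_def)
  have u: "unital C" using assms by (simp add: parity_complex_def)
  show ?thesis
  proof
    fix x n assume x: "x \<in> cells C (Suc n)"
    show "keys (cell_bd C n x) \<subseteq> cells C n"
      using finite_faces[OF x] faces_subset[OF x]
        keys_diff[of "set_chain (pface C n x)" "set_chain (mface C n x)"]
      by (auto simp: cell_bd_def keys_set_chain)
  next
    fix x n assume x: "x \<in> cells C (Suc (Suc n))"
    let ?M = "mface C (Suc n) x" and ?P = "pface C (Suc n) x"
    note wf = well_formed_faces[OF u x] and fin = finite_faces[OF x]
    let ?d = "frag_extend (cell_bd C n)"
    \<comment> \<open>A boundary is the difference of its parts, so globularity makes the boundaries
      of the two face sets equal.\<close>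
    have "set_mpface C n ?M = set_mpface C n ?P" "set_pmface C n ?M = set_pmface C n ?P"
      using assms x by (auto simp: parity_complex_def globular_def)
    then have "?d (set_chain ?M) = ?d (set_chain ?P)"
      using neg_pos_bd_well_formed[OF wf(1) fin(1)] neg_pos_bd_well_formed[OF wf(2) fin(2)]
      by (metis pos_chain_minus_neg_chain)
    then show "?d (cell_bd C (Suc n) x) = 0"
      by (simp add: cell_bd_def frag_extend_diff)
  next
    fix x assume x: "x \<in> cells C (Suc 0)"
    have "card (mface C 0 x) = 1" "card (pface C 0 x) = 1"
      using well_formed_faces[OF u x] by (auto simp: well_formed_def is_singleton_altdef)
    then show "coeff_sum (cell_bd C 0 x) = 0"
      using finite_faces[OF x] by (simp add: cell_bd_def coeff_sum_set_chain)
  next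
    fix x n assume x: "x \<in> cells C n"
    have "well_formed C 0 (mu C n x 0)"
      using u x by (simp add: unital_def)
    then have "is_singleton (mu C n x 0)"
      by (simp add: well_formed_def)
    then show "coeff_sum (iter_neg (cell_bd C) n (frag_of x)) = 1"
      using iter_neg_mu[OF u x, of n] by (auto simp: mu.simps[of C n x n] elim!: is_singletonE)
  next
    show "\<exists>r. partial_order_on (SIGMA n:UNIV. cells C n) r \<and>
      (\<forall>n. \<forall>x\<in>cells C n. \<forall>y\<in>cells C (Suc n). lookup (cell_bd C n y) x < 0 \<longrightarrow> ((n, x), Suc n, y) \<in> r) \<and>
      (\<forall>n. \<forall>x\<in>cells C (Suc n). \<forall>y\<in>cells C n. 0 < lookup (cell_bd C n x) y \<longrightarrow> ((Suc n, x), n, y) \<in> r)"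
      using assms by (simp add: parity_complex_def strongly_loop_free_def lookup_cell_bd cong: ball_cong)
  qed
qed

text \<open>The construction inverse to \<open>cell_bd\<close>. Passing to supports forgets
  multiplicities, harmlessly so by \<open>bd_coeffs\<close>.\<close>

definition skeleton :: "(nat \<Rightarrow> 'a set) \<Rightarrow> (nat \<Rightarrow> 'a \<Rightarrow> 'a \<Rightarrow>\<^sub>0 int) \<Rightarrow> 'a parity_structure" where
  "skeleton B \<delta> = \<lparr>cells = B, mface = (\<lambda>n x. keys (neg_chain (\<delta> n x))), pface = (\<lambda>n x. keys (pos_chain (\<delta> n x)))\<rparr>"

lemma skeleton_simps [simp]:
  "cells (skeleton B \<delta>) = B" "mface (skeleton B \<delta>) n x = keys (neg_chain (\<delta> n x))"
  "pface (skeleton B \<delta>) n x = keys (pos_chain (\<delta> n x))"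
  by (simp_all add: skeleton_def)

section \<open>The skeleton is a parity complex\<close>

context steiner_data
begin

lemma skeleton_parity_structure: "parity_structure (skeleton B \<delta>)"
proof
  fix x n assume "x \<in> cells (skeleton B \<delta>) (Suc n)"
  then show "mface (skeleton B \<delta>) n x \<in> Fpow (cells (skeleton B \<delta>) n)"
    "pface (skeleton B \<delta>) n x \<in> Fpow (cells (skeleton B \<delta>) n)"
    using keys_bd[of x n] keys_neg_chain_subset[of "\<delta> n x"] keys_pos_chain_subset[of "\<delta> n x"]
    by (auto simp: Fpow_def)
qed (auto simp: keys_neg_chain keys_pos_chain)

sublocale skeleton: parity_structure "skeleton B \<delta>"
  by (rule skeleton_parity_structure)

lemma cell_bd_skeleton:
  assumes x: "x \<in> B (Suc n)"
  shows "cell_bd (skeleton B \<delta>) n x = \<delta> n x"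
  unfolding cell_bd_def
proof (rule poly_mapping_eqI)
  fix z
  have "z \<in> keys (pos_chain (\<delta> n x)) \<longleftrightarrow> 0 < lookup (\<delta> n x) z"
    "z \<in> keys (neg_chain (\<delta> n x)) \<longleftrightarrow> lookup (\<delta> n x) z < 0"
    by (simp_all add: keys_pos_chain keys_neg_chain)
  then show "lookup (set_chain (pface (skeleton B \<delta>) n x) - set_chain (mface (skeleton B \<delta>) n x)) z
      = lookup (\<delta> n x) z"
    using bd_coeffs[OF x, of z] by (auto simp: lookup_minus lookup_set_chain)
qed

lemma frag_extend_skeleton:
  "keys c \<subseteq> B (Suc n) \<Longrightarrow> frag_extend (cell_bd (skeleton B \<delta>) n) c = bdry n c"
  by (rule frag_extend_eq) (use cell_bd_skeleton in blast)

text \<open>A face shared by two generators of \<open>c\<close> would be counted at least twice,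
  against \<open>cell_faces_le_1\<close>. The inner claim leaves the face map \<open>g\<close> open,
  to serve for both signs.\<close>

lemma cell_well_formed:
  assumes "cell n c"
  shows "well_formed (skeleton B \<delta>) n (keys c)"
proof (cases n)
  case 0
  then obtain x where "c = frag_of x" using assms nonneg_coeff_sum_1 by auto
  then have "keys c = {x}" by (simp add: keys_frag_of)
  then show ?thesis using 0 cell_keys[OF assms] by (simp add: well_formed_def)
next
  case (Suc m)
  have c1: "1 \<le> lookup c x" if "x \<in> keys c" for x
    by (rule nonneg_keys[OF cell_nonneg[OF assms] that])
  have disjoint: "keys (g x) \<inter> keys (g y) = {}"
    if xy: "x \<in> keys c" "y \<in> keys c" "x \<noteq> y" and g: "\<And>x. nonneg (g x)"
      "\<And>z. lookup (frag_extend g c) z \<le> 1" for x y and g :: "'a \<Rightarrow> 'a \<Rightarrow>\<^sub>0 int"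
  proof (rule ccontr)
    assume "keys (g x) \<inter> keys (g y) \<noteq> {}"
    then obtain z where z: "z \<in> keys (g x)" "z \<in> keys (g y)" by blast
    have "(\<Sum>u\<in>{x, y}. lookup c u * lookup (g u) z) \<le> (\<Sum>u\<in>keys c. lookup c u * lookup (g u) z)"
      using xy g(1) by (intro sum_mono2) (auto intro!: mult_nonneg_nonneg nonnegD cell_nonneg[OF assms])
    moreover have "1 * 1 \<le> lookup c x * lookup (g x) z" "1 * 1 \<le> lookup c y * lookup (g y) z"
      using c1 xy nonneg_keys[OF g(1)] z by (intro mult_mono; force)+
    ultimately show False using xy(3) g(2)[of z] by (simp add: lookup_frag_extend)
  qed
  have "keys (neg_chain (\<delta> m x)) \<inter> keys (neg_chain (\<delta> m y)) = {} \<and>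
        keys (pos_chain (\<delta> m x)) \<inter> keys (pos_chain (\<delta> m y)) = {}"
    if xy: "x \<in> keys c" "y \<in> keys c" "x \<noteq> y" for x y
    using disjoint[OF xy, of "\<lambda>x. neg_chain (\<delta> m x)"] disjoint[OF xy, of "\<lambda>x. pos_chain (\<delta> m x)"]
      cell_faces_le_1[of m c] assms Suc by simp
  then show ?thesis using Suc cell_keys[OF assms] by (auto simp: well_formed_def)
qed

lemma set_faces_cell:
  assumes "cell (Suc n) c"
  shows "set_mpface (skeleton B \<delta>) n (keys c) = keys (neg_chain (bdry n c))"
    "set_pmface (skeleton B \<delta>) n (keys c) = keys (pos_chain (bdry n c))"
proof -
  have "finite (set_mpface (skeleton B \<delta>) n (keys c))" "finite (set_pmface (skeleton B \<delta>) n (keys c))"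
    using skeleton.finite_set_faces[of "keys c" n] cell_keys[OF assms] by (auto simp: set_mpface_def set_pmface_def)
  then show "set_mpface (skeleton B \<delta>) n (keys c) = keys (neg_chain (bdry n c))"
    "set_pmface (skeleton B \<delta>) n (keys c) = keys (pos_chain (bdry n c))"
    using skeleton.neg_pos_bd_well_formed[OF cell_well_formed[OF assms] finite_keys]
      set_chain_cell[OF assms] frag_extend_skeleton[OF cell_keys[OF assms]]
    by (metis keys_set_chain)+
qed

text \<open>Carrying unit chains down the recursion, rather than well-formed sets, allows
  \<open>set_faces_cell\<close> to be applied again at every stage.\<close>

lemma mu_skeleton:
  assumes "x \<in> B n" "k \<le> n"
  shows "\<exists>c. unit_chain k c \<and> mu (skeleton B \<delta>) n x k = keys c"
  using assms(2)
proof (induction k rule: inc_induct)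
  case base
  then show ?case using unit_chain_generator[OF assms(1)] by (auto simp: mu.simps[of _ n])
next
  case (step k)
  then obtain c where "unit_chain (Suc k) c" "mu (skeleton B \<delta>) n x (Suc k) = keys c" by blast
  then show ?case
    using step unit_chain_neg[of k c] set_faces_cell[of k c] unit_chain_cell[of "Suc k" c]
    by (auto simp: mu.simps[of _ n x k] simp del: cell.simps)
qed

lemma pi_set_skeleton:
  assumes "x \<in> B n" "k \<le> n"
  shows "\<exists>c. unit_chain k c \<and> pi_set (skeleton B \<delta>) n x k = keys c"
  using assms(2)
proof (induction k rule: inc_induct)
  case base
  then show ?case using unit_chain_generator[OF assms(1)] by (auto simp: pi_set.simps[of _ n])
next
  case (step k)
  then obtain c where "unit_chain (Suc k) c" "pi_set (skeleton B \<delta>) n x (Suc k) = keys c" by blast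
  then show ?case
    using step unit_chain_pos[of k c] set_faces_cell[of k c] unit_chain_cell[of "Suc k" c]
    by (auto simp: pi_set.simps[of _ n x k] simp del: cell.simps)
qed

lemma unit_chain_faces:
  assumes "x \<in> B (Suc n)"
  shows "unit_chain n (neg_chain (\<delta> n x))" "unit_chain n (pos_chain (\<delta> n x))"
  using unit_chain_neg[OF unit_chain_generator[OF assms]] unit_chain_pos[OF unit_chain_generator[OF assms]]
  by simp_all

lemma skeleton_parity_complex: "parity_complex (skeleton B \<delta>)"
  unfolding parity_complex_def
proof (intro conjI)
  show "globular (skeleton B \<delta>)"
    unfolding globular_def
  proof (intro allI ballI)
    fix n x assume "x \<in> cells (skeleton B \<delta>) (Suc (Suc n))"
    then have x: "x \<in> B (Suc (Suc n))" by simp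
    have "bdry n (pos_chain (\<delta> (Suc n) x)) = bdry n (neg_chain (\<delta> (Suc n) x))"
      using bdry_pos_neg[of "frag_of x" n] x by simp
    then show "set_mpface (skeleton B \<delta>) n (mface (skeleton B \<delta>) (Suc n) x)
        = set_mpface (skeleton B \<delta>) n (pface (skeleton B \<delta>) (Suc n) x) \<and>
      set_pmface (skeleton B \<delta>) n (mface (skeleton B \<delta>) (Suc n) x)
        = set_pmface (skeleton B \<delta>) n (pface (skeleton B \<delta>) (Suc n) x)"
      using unit_chain_faces[OF x] unit_chain_cell by (simp add: set_faces_cell del: cell.simps)
  qed
  show "unital (skeleton B \<delta>)"
    unfolding unital_def using mu_skeleton pi_set_skeleton unit_chain_cell cell_well_formed
    by (metis skeleton_simps(1))
  show "strongly_loop_free (skeleton B \<delta>)"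
    using loop_free by (simp add: strongly_loop_free_def keys_neg_chain keys_pos_chain)
qed (rule skeleton_parity_structure)

end

text \<open>\<open>PC\<close> is cut out inside \<open>WPC\<close>, so this makes every parity
  complex an object of it.\<close>

lemma parity_complex_weak:
  assumes "parity_complex C"
  shows "weak_parity_complex C"
proof -
  interpret parity_structure C using assms by (simp add: parity_complex_def)
  interpret steiner_data "cells C" "cell_bd C" by (rule parity_complex_steiner_data[OF assms])
  have "weakly_loop_free C"
    unfolding weakly_loop_free_def
  proof
    fix n
    obtain r where "partial_order_on (cells C (Suc n)) r"
      "\<And>x y z. \<lbrakk>x \<in> cells C (Suc n); y \<in> cells C (Suc n);
        0 < lookup (cell_bd C n x) z; lookup (cell_bd C n y) z < 0\<rbrakk> \<Longrightarrow> (x, y) \<in> r"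
      using loop_free_order by metis
    then show "\<exists>r. partial_order_on (cells C (Suc n)) r \<and>
        (\<forall>x\<in>cells C (Suc n). \<forall>y\<in>cells C (Suc n). pface C n x \<inter> mface C n y \<noteq> {} \<longrightarrow> (x, y) \<in> r)"
      using lookup_cell_bd by blast
  qed
  then show ?thesis using assms by (simp add: parity_complex_def weak_parity_complex_def)
qed

section \<open>Morphisms of parity complexes as positive chain maps\<close>

text \<open>The matrix of a monotone augmented chain map: values are given on generators and
  unconstrained elsewhere.\<close>

definition chain_hom :: "(nat \<Rightarrow> 'a set) \<Rightarrow> (nat \<Rightarrow> 'a \<Rightarrow> 'a \<Rightarrow>\<^sub>0 int) \<Rightarrow> (nat \<Rightarrow> 'b set) \<Rightarrow>
    (nat \<Rightarrow> 'b \<Rightarrow> 'b \<Rightarrow>\<^sub>0 int) \<Rightarrow> (nat \<Rightarrow> 'a \<Rightarrow> 'b \<Rightarrow>\<^sub>0 int) \<Rightarrow> bool" where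
  "chain_hom B \<delta> B' \<delta>' g \<longleftrightarrow>
     (\<forall>n. \<forall>x \<in> B n. nonneg (g n x) \<and> keys (g n x) \<subseteq> B' n) \<and>
     (\<forall>x \<in> B 0. coeff_sum (g 0 x) = 1) \<and>
     (\<forall>n. \<forall>x \<in> B (Suc n). frag_extend (g n) (\<delta> n x) = frag_extend (\<delta>' n) (g (Suc n) x))"

lemma chain_homD:
  assumes "chain_hom B \<delta> B' \<delta>' g"
  shows "x \<in> B n \<Longrightarrow> nonneg (g n x)" "x \<in> B n \<Longrightarrow> keys (g n x) \<subseteq> B' n"
    "x \<in> B 0 \<Longrightarrow> coeff_sum (g 0 x) = 1"
    "x \<in> B (Suc n) \<Longrightarrow> frag_extend (g n) (\<delta> n x) = frag_extend (\<delta>' n) (g (Suc n) x)"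
  using assms by (auto simp: chain_hom_def)

lemma chain_hom_cong:
  assumes "steiner_data B \<delta>" "chain_hom B \<delta> B' \<delta>' g" "\<And>n x. x \<in> B n \<Longrightarrow> h n x = g n x"
  shows "chain_hom B \<delta> B' \<delta>' h"
proof -
  interpret S: steiner_data B \<delta> by fact
  have "frag_extend (h n) (\<delta> n x) = frag_extend (g n) (\<delta> n x)" if "x \<in> B (Suc n)" for n x
    using S.keys_bd[OF that] assms(3) by (intro frag_extend_eq) blast
  then show ?thesis using assms(2,3) by (simp add: chain_hom_def)
qed

lemma frag_extend_chain_map:
  assumes "keys c \<subseteq> A" "\<And>x. x \<in> A \<Longrightarrow> frag_extend g (\<delta> x) = frag_extend \<delta>' (h x)"
  shows "frag_extend g (frag_extend \<delta> c) = frag_extend \<delta>' (frag_extend h c)"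
  unfolding frag_extend_compose by (rule frag_extend_eq) (use assms in blast)

text \<open>The image of a witness \<open>d\<close> is a witness for the image of \<open>c\<close>.
  The chain map equation is assumed only below \<open>n\<close>, so that the lemma is available
  while that equation is still being proved by induction on the degree.\<close>

lemma cell_image_upto:
  assumes "steiner_data B \<delta>" "steiner_data B' \<delta>'"
    and "\<And>n x. x \<in> B n \<Longrightarrow> nonneg (g n x) \<and> keys (g n x) \<subseteq> B' n"
    and "\<And>x. x \<in> B 0 \<Longrightarrow> coeff_sum (g 0 x) = 1"
    and "\<And>m x. m < n \<Longrightarrow> x \<in> B (Suc m) \<Longrightarrow> frag_extend (g m) (\<delta> m x) = frag_extend (\<delta>' m) (g (Suc m) x)"
    and "steiner_data.cell B \<delta> n c"
  shows "steiner_data.cell B' \<delta>' n (frag_extend (g n) c)"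
proof -
  interpret S: steiner_data B \<delta> by fact
  interpret T: steiner_data B' \<delta>' by fact
  have image: "nonneg (frag_extend (g n) c) \<and> keys (frag_extend (g n) c) \<subseteq> B' n"
    if "nonneg c" "keys c \<subseteq> B n" for n c
    using that assms(3) by (auto intro!: nonneg_frag_extend dest!: subsetD[OF keys_frag_extend])
  show ?thesis
    using assms(5,6)
  proof (induction n arbitrary: c)
    case 0
    then have "coeff_sum (frag_extend (g 0) c) = coeff_sum c"
      using assms(4) by (intro coeff_sum_frag_extend) auto
    then show ?case using 0 image[of c 0] by auto
  next
    case (Suc n)
    then obtain d where d: "S.cell n d" "nonneg (d + S.bdry n c)" and c: "nonneg c" "keys c \<subseteq> B (Suc n)"
      by auto
    have "T.cell n (frag_extend (g n) d)" using Suc d by simp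
    moreover have "frag_extend (g n) (S.bdry n c) = T.bdry n (frag_extend (g (Suc n)) c)"
      using Suc.prems(1)[of n] by (intro frag_extend_chain_map[OF c(2)]) simp
    then have "nonneg (frag_extend (g n) d + T.bdry n (frag_extend (g (Suc n)) c))"
      using image[OF d(2) keys_add_subset[OF S.cell_keys[OF d(1)] S.keys_bdry[OF c(2)]]]
      by (simp add: frag_extend_add)
    ultimately show ?case using image[OF c] by auto
  qed
qed

lemma cell_image:
  assumes "steiner_data B \<delta>" "steiner_data B' \<delta>'" "chain_hom B \<delta> B' \<delta>' g" "steiner_data.cell B \<delta> n c"
  shows "steiner_data.cell B' \<delta>' n (frag_extend (g n) c)"
  using assms chain_homD[OF assms(3)] by (intro cell_image_upto[of B \<delta> B' \<delta>']) auto

text \<open>The image of a generator is a cell, so its support determines it.\<close>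

lemma chain_hom_set_chain:
  assumes "steiner_data B \<delta>" "steiner_data B' \<delta>'" "chain_hom B \<delta> B' \<delta>' g" "x \<in> B n"
  shows "set_chain (keys (g n x)) = g n x"
proof -
  interpret S: steiner_data B \<delta> by fact
  interpret T: steiner_data B' \<delta>' by fact
  show ?thesis
    using T.set_chain_cell[OF cell_image[OF assms(1-3) S.cell_generator[OF assms(4)]]] by simp
qed

lemma chain_hom_compose:
  assumes g: "chain_hom B \<delta> B' \<delta>' g" and h: "chain_hom B' \<delta>' B'' \<delta>'' h"
  shows "chain_hom B \<delta> B'' \<delta>'' (\<lambda>n x. frag_extend (h n) (g n x))"
  unfolding chain_hom_def
proof (intro conjI allI ballI)
  fix n x assume x: "x \<in> B n"
  show "nonneg (frag_extend (h n) (g n x))"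
    using chain_homD[OF g] chain_homD[OF h] x by (intro nonneg_frag_extend) blast+
  show "keys (frag_extend (h n) (g n x)) \<subseteq> B'' n"
    using chain_homD[OF g] chain_homD[OF h] x by (intro keys_frag_extend_subset) blast
next
  fix x assume "x \<in> B 0"
  then show "coeff_sum (frag_extend (h 0) (g 0 x)) = 1"
    using chain_homD[OF g] chain_homD[OF h] by (subst coeff_sum_frag_extend) blast+
next
  fix n x assume x: "x \<in> B (Suc n)"
  have "frag_extend (\<lambda>x. frag_extend (h n) (g n x)) (\<delta> n x) = frag_extend (h n) (frag_extend (g n) (\<delta> n x))"
    by (simp add: frag_extend_compose)
  also have "\<dots> = frag_extend (h n) (frag_extend (\<delta>' n) (g (Suc n) x))"
    using chain_homD(4)[OF g x] by simp
  also have "\<dots> = frag_extend (\<delta>'' n) (frag_extend (h (Suc n)) (g (Suc n) x))"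
    using chain_homD(2)[OF g x] chain_homD(4)[OF h] by (rule frag_extend_chain_map)
  finally show "frag_extend (\<lambda>x. frag_extend (h n) (g n x)) (\<delta> n x) =
    frag_extend (\<delta>'' n) (frag_extend (h (Suc n)) (g (Suc n) x))" .
qed

section \<open>Moves and unions as linear conditions\<close>

lemma count_mset_set_if: "finite A \<Longrightarrow> count (mset_set A) x = (if x \<in> A then 1 else 0)"
  by (cases "x \<in> A") auto

text \<open>Two truncated differences, taken in both directions, record exactly one signed
  difference; so the two multiset equations amount to one equation of integral chains.\<close>

lemma (in parity_structure) moves_iff_bd:
  assumes "finite S" "S \<subseteq> cells C (Suc n)" "finite M" "finite P"
  shows "moves C n (mset_set S) (mset_set M) (mset_set P) \<longleftrightarrow>
    frag_extend (cell_bd C n) (set_chain S) = set_chain P - set_chain M"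
proof -
  have m: "int (count (Phi_minus C n (mset_set S)) z) = lookup (\<Sum>x\<in>S. set_chain (mface C n x)) z" for z
    using assms(1,2) finite_faces
    by (auto simp: Phi_minus_def sum_unfold_sum_mset[symmetric] count_sum lookup_sum
        lookup_set_chain subset_iff count_mset_set_if intro!: sum.cong)
  have p: "int (count (Phi_plus C n (mset_set S)) z) = lookup (\<Sum>x\<in>S. set_chain (pface C n x)) z" for z
    using assms(1,2) finite_faces
    by (auto simp: Phi_plus_def sum_unfold_sum_mset[symmetric] count_sum lookup_sum
        lookup_set_chain subset_iff count_mset_set_if intro!: sum.cong)
  have bd: "lookup (frag_extend (cell_bd C n) (set_chain S)) z
      = int (count (Phi_plus C n (mset_set S)) z) - int (count (Phi_minus C n (mset_set S)) z)" for z
    unfolding m p using assms(1)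
    by (simp add: frag_extend_set_chain cell_bd_def sum_subtractf lookup_minus)
  have diff: "a - b = m - p \<and> b - a = p - m \<longleftrightarrow> int b - int a = int p - int m" for a b m p
    by arith
  have "moves C n (mset_set S) (mset_set M) (mset_set P) \<longleftrightarrow>
      (\<forall>z. int (count (Phi_plus C n (mset_set S)) z) - int (count (Phi_minus C n (mset_set S)) z)
        = int (count (mset_set P) z) - int (count (mset_set M) z))"
    unfolding moves_def bd_minus_def bd_plus_def multiset_eq_iff count_diff all_conj_distrib[symmetric] diff
    by (rule refl)
  also have "\<dots> \<longleftrightarrow> frag_extend (cell_bd C n) (set_chain S) = set_chain P - set_chain M"
    using assms(3,4)
    by (auto simp: poly_mapping_eq_iff fun_eq_iff bd lookup_minus lookup_set_chain count_mset_set_if)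
  finally show ?thesis .
qed

text \<open>From left to right, strong induction on the degree: the equations below \<open>n\<close>
  make the unions over the faces disjoint, and then moving in degree \<open>n\<close> is the chain
  map equation there. From right to left, well-formedness is recovered from the image of a generator
  being a cell.\<close>

lemma wpc_hom_iff_chain_hom:
  assumes C: "parity_complex C" and D: "parity_complex D"
  shows "f \<in> wpc_hom C D \<longleftrightarrow> (\<forall>n. f n \<in> cells C n \<rightarrow>\<^sub>E Fpow (cells D n)) \<and>
    chain_hom (cells C) (cell_bd C) (cells D) (cell_bd D) (\<lambda>n x. set_chain (f n x))"
    (is "_ \<longleftrightarrow> ?ext \<and> ?hom")
proof (cases ?ext)
  case False
  then show ?thesis by (auto simp: wpc_hom_def)
next
  case ext: True
  interpret PC: parity_structure C using C by (simp add: parity_complex_def)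
  interpret PD: parity_structure D using D by (simp add: parity_complex_def)
  interpret S: steiner_data "cells C" "cell_bd C" by (rule parity_complex_steiner_data[OF C])
  interpret T: steiner_data "cells D" "cell_bd D" by (rule parity_complex_steiner_data[OF D])
  let ?g = "\<lambda>n x. set_chain (f n x)"
  have fin: "finite (f n x)" and sub: "f n x \<subseteq> cells D n" if "x \<in> cells C n" for n x
    using ext that by (auto simp: Fpow_def PiE_def Pi_def)
  have g: "nonneg (?g n x) \<and> keys (?g n x) \<subseteq> cells D n" if "x \<in> cells C n" for n x
    using fin sub that by (auto simp: keys_set_chain)
  text \<open>
    The union of the \<open>f n y\<close> is disjoint because the image of a unital chain is a cell, whose
    coefficients are at most \<open>1\<close>. This needs the chain map property below degree \<open>n\<close> only.
  \<close>
  have union: "set_chain (\<Union>y\<in>Y. f n y) = frag_extend (?g n) (set_chain Y)"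
    if aug: "\<And>x. x \<in> cells C 0 \<Longrightarrow> coeff_sum (?g 0 x) = 1"
      and chain: "\<And>m x. m < n \<Longrightarrow> x \<in> cells C (Suc m) \<Longrightarrow>
        frag_extend (?g m) (cell_bd C m x) = frag_extend (cell_bd D m) (?g (Suc m) x)"
      and Y: "S.cell n (set_chain Y)" "finite Y" for n Y
  proof -
    have "T.cell n (frag_extend (?g n) (set_chain Y))"
      by (rule cell_image_upto[OF S.steiner_data_axioms T.steiner_data_axioms g aug chain Y(1)])
    then have "lookup (frag_extend (?g n) (set_chain Y)) z \<le> 1" for z
      by (rule T.cell_le_1)
    moreover have "Y \<subseteq> cells C n" using S.cell_keys[OF Y(1)] Y(2) by (simp add: keys_set_chain)
    ultimately show ?thesis
      using Y(2) fin by (simp add: frag_extend_set_chain) (rule set_chain_UN; auto)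
  qed
  have bd_iff: "moves D n (mset_set (f (Suc n) x))
        (mset_set (\<Union>y\<in>mface C n x. f n y)) (mset_set (\<Union>y\<in>pface C n x. f n y)) \<longleftrightarrow>
      frag_extend (?g n) (cell_bd C n x) = frag_extend (cell_bd D n) (?g (Suc n) x)"
    if aug: "\<And>x. x \<in> cells C 0 \<Longrightarrow> coeff_sum (?g 0 x) = 1"
      and chain: "\<And>m x. m < n \<Longrightarrow> x \<in> cells C (Suc m) \<Longrightarrow>
        frag_extend (?g m) (cell_bd C m x) = frag_extend (cell_bd D m) (?g (Suc m) x)"
      and x: "x \<in> cells C (Suc n)" for n x
  proof -
    have cells: "S.cell n (set_chain (mface C n x))" "S.cell n (set_chain (pface C n x))"
      using S.unit_chain_faces[OF x] S.unit_chain_cell by (simp_all add: PC.neg_pos_cell_bd[OF x])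
    have finite: "finite (\<Union>y\<in>mface C n x. f n y)" "finite (\<Union>y\<in>pface C n x. f n y)"
      using PC.finite_faces[OF x] PC.faces_subset[OF x] fin by (auto 4 4)
    show ?thesis
      using PD.moves_iff_bd[OF fin[OF x] sub[OF x] finite] union[OF aug chain cells(1)] union[OF aug chain cells(2)]
        PC.finite_faces[OF x] by (auto simp: cell_bd_def frag_extend_diff)
  qed
  show ?thesis
  proof
    assume f: "f \<in> wpc_hom C D"
    have aug: "coeff_sum (?g 0 x) = 1" if "x \<in> cells C 0" for x
    proof -
      have "well_formed D 0 (f 0 x)" using f that by (simp add: wpc_hom_def)
      then have "is_singleton (f 0 x)" by (simp add: well_formed_def)
      then show ?thesis by (auto elim!: is_singletonE)
    qed
    have "frag_extend (?g n) (cell_bd C n x) = frag_extend (cell_bd D n) (?g (Suc n) x)"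
      if "x \<in> cells C (Suc n)" for n x
      using that
    proof (induction n arbitrary: x rule: less_induct)
      case (less n)
      then show ?case using bd_iff[OF aug less.IH less.prems] f by (simp add: wpc_hom_def)
    qed
    then show "?ext \<and> ?hom" using ext g aug by (simp add: chain_hom_def)
  next
    assume "?ext \<and> ?hom"
    then have hom: ?hom by blast
    have "well_formed D n (f n x)" if x: "x \<in> cells C n" for n x
    proof -
      have "T.cell n (?g n x)"
        using cell_image[OF S.steiner_data_axioms T.steiner_data_axioms hom S.cell_generator[OF x]] by simp
      \<comment> \<open>\<open>cell_well_formed\<close> speaks of the skeleton of
        \<open>cell_bd D\<close>; by \<open>neg_pos_cell_bd\<close> its faces are those of
        \<open>D\<close>.\<close>
      then have "well_formed (skeleton (cells D) (cell_bd D)) n (f n x)"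
        using T.cell_well_formed fin[OF x] by (metis keys_set_chain)
      then show ?thesis
        by (cases n) (fastforce simp: well_formed_def PD.neg_pos_cell_bd keys_set_chain PD.finite_faces subset_iff)+
    qed
    moreover have "moves D n (mset_set (f (Suc n) x))
        (mset_set (\<Union>y\<in>mface C n x. f n y)) (mset_set (\<Union>y\<in>pface C n x. f n y))"
      if "x \<in> cells C (Suc n)" for n x
      using bd_iff[of n x] chain_homD[OF hom] that by blast
    ultimately show "f \<in> wpc_hom C D" using ext by (simp add: wpc_hom_def)
  qed
qed

section \<open>Linear combinations in preordered groups\<close>

context preordered_comm_group
begin

lemma order_rel_carrier: "x \<preceq> y \<Longrightarrow> x \<in> carrier A \<and> y \<in> carrier A"
  using preorder by (auto simp: preorder_on_def)

lemma order_rel_trans: "x \<preceq> y \<Longrightarrow> y \<preceq> z \<Longrightarrow> x \<preceq> z"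
  using preorder by (auto simp: preorder_on_def trans_def)

text \<open>Translation invariance lets the positive cone determine the order, so a description of
  the cone by a basis describes the order too.\<close>

lemma order_rel_diff:
  assumes "x \<in> carrier A" "y \<in> carrier A"
  shows "x \<preceq> y \<longleftrightarrow> y \<otimes> inv x \<in> pos_cone A"
proof
  assume "x \<preceq> y"
  then have "x \<otimes> inv x \<preceq> y \<otimes> inv x" using assms by (intro translation) auto
  then show "y \<otimes> inv x \<in> pos_cone A" using assms by (simp add: pos_cone_def)
next
  assume "y \<otimes> inv x \<in> pos_cone A"
  then have "\<one> \<otimes> x \<preceq> (y \<otimes> inv x) \<otimes> x" using assms by (intro translation) (auto simp: pos_cone_def)
  then show "x \<preceq> y" using assms by (simp add: m_assoc)
qed

lemma one_in_pos_cone: "\<one> \<in> pos_cone A"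
  using preorder by (auto simp: pos_cone_def preorder_on_def refl_on_def)

lemma pos_cone_mult:
  assumes "x \<in> pos_cone A" "y \<in> pos_cone A"
  shows "x \<otimes> y \<in> pos_cone A"
proof -
  have xy: "x \<in> carrier A" "y \<in> carrier A" "\<one> \<preceq> x" "\<one> \<preceq> y" using assms by (auto simp: pos_cone_def)
  then have "\<one> \<otimes> y \<preceq> x \<otimes> y" by (intro translation)
  then show ?thesis using xy order_rel_trans[of \<one> y "x \<otimes> y"] by (simp add: pos_cone_def)
qed

text \<open>Padding with zero exponents brings two combinations over a common index set before they
  are added.\<close>

lemma int_lincomb_superset:
  assumes "finite F" "keys c \<subseteq> F" "F \<subseteq> carrier A"
  shows "int_lincomb A c = finprod A (\<lambda>b. b [^] lookup c b) F"
  unfolding int_lincomb_def using assms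
  by (intro finprod_mono_neutral_cong_left) (auto simp: in_keys_iff)

lemma int_lincomb_0 [simp]: "int_lincomb A 0 = \<one>"
  by (simp add: int_lincomb_def)

lemma int_lincomb_closed: "keys c \<subseteq> carrier A \<Longrightarrow> int_lincomb A c \<in> carrier A"
  unfolding int_lincomb_def by (intro finprod_closed) auto

lemma int_lincomb_frag_of: "b \<in> carrier A \<Longrightarrow> int_lincomb A (frag_of b) = b"
  by (simp add: int_lincomb_def)

lemma int_lincomb_add:
  assumes "keys c \<subseteq> carrier A" "keys d \<subseteq> carrier A"
  shows "int_lincomb A (c + d) = int_lincomb A c \<otimes> int_lincomb A d"
proof -
  let ?F = "keys c \<union> keys d"
  have "int_lincomb A (c + d) = finprod A (\<lambda>b. b [^] lookup (c + d) b) ?F"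
    using assms Poly_Mapping.keys_add[of c d] by (intro int_lincomb_superset) auto
  also have "\<dots> = finprod A (\<lambda>b. b [^] lookup c b \<otimes> b [^] lookup d b) ?F"
    using assms by (intro finprod_cong') (auto simp: lookup_add int_pow_mult)
  also have "\<dots> = finprod A (\<lambda>b. b [^] lookup c b) ?F \<otimes> finprod A (\<lambda>b. b [^] lookup d b) ?F"
    using assms by (intro finprod_multf) auto
  also have "finprod A (\<lambda>b. b [^] lookup c b) ?F = int_lincomb A c"
    using assms by (intro int_lincomb_superset[symmetric]) auto
  also have "finprod A (\<lambda>b. b [^] lookup d b) ?F = int_lincomb A d"
    using assms by (intro int_lincomb_superset[symmetric]) auto
  finally show ?thesis .
qed

lemma int_lincomb_diff:
  assumes "keys c \<subseteq> carrier A" "keys d \<subseteq> carrier A"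
  shows "int_lincomb A (c - d) = int_lincomb A c \<otimes> inv (int_lincomb A d)"
proof -
  have k: "keys (c - d) \<subseteq> carrier A" using assms keys_diff[of c d] by blast
  have "int_lincomb A (c - d) \<otimes> int_lincomb A d = int_lincomb A c"
    using int_lincomb_add[OF k assms(2)] by simp
  then show ?thesis
    using int_lincomb_closed[OF k] int_lincomb_closed[OF assms(1)] int_lincomb_closed[OF assms(2)]
    by (metis inv_solve_right)
qed

lemma nat_lincomb_eq_int_lincomb: "nat_lincomb A c = int_lincomb A (Poly_Mapping.map int c)"
  by (simp add: nat_lincomb_def int_lincomb_def keys_map_int lookup_map_int int_pow_int)

lemma int_lincomb_pos_cone:
  assumes "nonneg c" "keys c \<subseteq> pos_cone A"
  shows "int_lincomb A c \<in> pos_cone A"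
  using assms
proof (induction c rule: chain_size_induct)
  case (step c)
  show ?case
  proof (cases "c = 0")
    case True
    then show ?thesis using one_in_pos_cone by simp
  next
    case False
    then obtain b where b: "b \<in> keys c" by (metis all_not_in_conv keys_eq_empty)
    have k: "keys (c - frag_of b) \<subseteq> pos_cone A" "b \<in> pos_cone A"
      using b step.prems keys_diff[of c "frag_of b"] by (auto simp: keys_frag_of)
    then have "int_lincomb A ((c - frag_of b) + frag_of b) = int_lincomb A (c - frag_of b) \<otimes> b"
      by (subst int_lincomb_add) (auto simp: int_lincomb_frag_of pos_cone_def)
    then show ?thesis using step.IH[OF b k(1)] k(2) pos_cone_mult by simp
  qed
qed

end

section \<open>Coordinates on augmented directed complexes\<close>

text \<open>An isomorphism of \<open>K\<close> with the free complex on generators \<open>B\<close>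
  with boundary \<open>\<delta>\<close>. The generators may belong to another type than
  \<open>K\<close>, and the same ones may present several complexes.\<close>

locale presentation = augmented_directed_complex K for K :: "'a adc" +
  fixes B :: "nat \<Rightarrow> 'b set" and \<delta> :: "nat \<Rightarrow> 'b \<Rightarrow> 'b \<Rightarrow>\<^sub>0 int" and \<phi> :: "nat \<Rightarrow> 'a \<Rightarrow> 'b \<Rightarrow>\<^sub>0 int"
  assumes coord_bij: "bij_betw (\<phi> n) (carrier (grp K n)) {c. keys c \<subseteq> B n}"
    and coord_mult: "\<lbrakk>x \<in> carrier (grp K n); y \<in> carrier (grp K n)\<rbrakk> \<Longrightarrow> \<phi> n (x \<otimes>\<^bsub>grp K n\<^esub> y) = \<phi> n x + \<phi> n y"
    and coord_le: "\<lbrakk>x \<in> carrier (grp K n); y \<in> carrier (grp K n)\<rbrakk> \<Longrightarrow>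
      x \<preceq>\<^bsub>grp K n\<^esub> y \<longleftrightarrow> nonneg (\<phi> n y - \<phi> n x)"
    and coord_bd: "x \<in> carrier (grp K (Suc n)) \<Longrightarrow> \<phi> n (bd K n x) = frag_extend (\<delta> n) (\<phi> (Suc n) x)"
    and coord_aug: "x \<in> carrier (grp K 0) \<Longrightarrow> aug K x = coeff_sum (\<phi> 0 x)"

sublocale augmented_directed_complex \<subseteq> A: preordered_comm_group "grp K n" for n
  by (rule grp)

lemma (in augmented_directed_complex) bd_closed:
  "x \<in> carrier (grp K (Suc n)) \<Longrightarrow> bd K n x \<in> carrier (grp K n)"
  using bd_hom[of n] by (auto simp: hom_def)

context presentation
begin

definition elem :: "nat \<Rightarrow> ('b \<Rightarrow>\<^sub>0 int) \<Rightarrow> 'a" where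
  "elem n = inv_into (carrier (grp K n)) (\<phi> n)"

lemma coord_keys: "x \<in> carrier (grp K n) \<Longrightarrow> keys (\<phi> n x) \<subseteq> B n"
  using coord_bij[of n] by (auto simp: bij_betw_def)

lemma elem_closed: "keys c \<subseteq> B n \<Longrightarrow> elem n c \<in> carrier (grp K n)"
  unfolding elem_def using coord_bij[of n] by (intro inv_into_into) (auto simp: bij_betw_def)

lemma coord_elem: "keys c \<subseteq> B n \<Longrightarrow> \<phi> n (elem n c) = c"
  unfolding elem_def using coord_bij[of n] by (intro f_inv_into_f) (auto simp: bij_betw_def)

lemma elem_coord: "x \<in> carrier (grp K n) \<Longrightarrow> elem n (\<phi> n x) = x"
  unfolding elem_def using coord_bij[of n] by (intro inv_into_f_f) (auto simp: bij_betw_def)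

lemma coord_eqI: "\<lbrakk>x \<in> carrier (grp K n); y \<in> carrier (grp K n); \<phi> n x = \<phi> n y\<rbrakk> \<Longrightarrow> x = y"
  by (metis elem_coord)

lemma coord_one [simp]: "\<phi> n \<one>\<^bsub>grp K n\<^esub> = 0"
  using coord_mult[of "\<one>\<^bsub>grp K n\<^esub>" n "\<one>\<^bsub>grp K n\<^esub>"] by simp

lemma coord_inv: "x \<in> carrier (grp K n) \<Longrightarrow> \<phi> n (inv\<^bsub>grp K n\<^esub> x) = - \<phi> n x"
  using coord_mult[of x n "inv\<^bsub>grp K n\<^esub> x"] by (simp add: add_eq_0_iff)

lemma elem_add: "keys c \<subseteq> B n \<Longrightarrow> keys d \<subseteq> B n \<Longrightarrow> elem n (c + d) = elem n c \<otimes>\<^bsub>grp K n\<^esub> elem n d"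
  by (intro coord_eqI[of _ n]) (simp_all add: coord_mult coord_elem elem_closed keys_add_subset)

lemma pos_cone_iff: "x \<in> pos_cone (grp K n) \<longleftrightarrow> x \<in> carrier (grp K n) \<and> nonneg (\<phi> n x)"
  by (auto simp: pos_cone_def coord_le)

text \<open>The meet condition is tested on the coordinatewise minimum of \<open>p\<close> and
  \<open>q\<close>: being a common lower bound, it is nonpositive, which for nonnegative coordinates
  means disjoint supports.\<close>

lemma is_parts_iff:
  assumes x: "x \<in> carrier (grp K n)"
  shows "is_parts (grp K n) x p q \<longleftrightarrow> p \<in> carrier (grp K n) \<and> q \<in> carrier (grp K n) \<and>
    \<phi> n p = pos_chain (\<phi> n x) \<and> \<phi> n q = neg_chain (\<phi> n x)" (is "?L \<longleftrightarrow> ?R")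
proof
  assume L: ?L
  then have pq: "p \<in> carrier (grp K n)" "q \<in> carrier (grp K n)" "nonneg (\<phi> n p)" "nonneg (\<phi> n q)"
    by (auto simp: is_parts_def pos_cone_iff)
  have eq: "\<phi> n x = \<phi> n p - \<phi> n q"
    using L pq by (simp add: is_parts_def coord_mult coord_inv)
  \<comment> \<open>The coordinatewise minimum, written as p - max(0, p - q) so that its support is
    visibly inside \<open>B n\<close>.\<close>
  define m where "m = \<phi> n p - pos_chain (\<phi> n p - \<phi> n q)"
  have m: "lookup m z = min (lookup (\<phi> n p) z) (lookup (\<phi> n q) z)" for z
    by (simp add: m_def lookup_minus max_def min_def)
  have mB: "keys m \<subseteq> B n"
    using coord_keys[OF pq(1)] coord_keys[OF pq(2)] keys_pos_chain_subset[of "\<phi> n p - \<phi> n q"]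
      keys_diff[of "\<phi> n p" "\<phi> n q"] keys_diff[of "\<phi> n p" "pos_chain (\<phi> n p - \<phi> n q)"]
    unfolding m_def by blast
  have "elem n m \<preceq>\<^bsub>grp K n\<^esub> p" "elem n m \<preceq>\<^bsub>grp K n\<^esub> q"
    using pq mB by (simp_all add: coord_le elem_closed coord_elem nonneg_def lookup_minus m)
  then have "elem n m \<preceq>\<^bsub>grp K n\<^esub> \<one>\<^bsub>grp K n\<^esub>"
    using L elem_closed[OF mB] by (simp add: is_parts_def is_meet_def)
  then have "lookup m z \<le> 0" for z
    using mB by (simp add: coord_le elem_closed coord_elem nonneg_def)
  then have 0: "min (lookup (\<phi> n p) z) (lookup (\<phi> n q) z) \<le> 0" for z
    using m by metis
  have "lookup (\<phi> n p) z = max 0 (lookup (\<phi> n x) z)" "lookup (\<phi> n q) z = max 0 (- lookup (\<phi> n x) z)" for z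
    using 0[of z] nonnegD[OF pq(3), of z] nonnegD[OF pq(4), of z] unfolding eq lookup_minus by linarith+
  then show ?R using pq by (auto intro!: poly_mapping_eqI)
next
  assume R: ?R
  then have "x = p \<otimes>\<^bsub>grp K n\<^esub> inv\<^bsub>grp K n\<^esub> q"
    using x by (intro coord_eqI[of _ n]) (auto simp: coord_mult coord_inv pos_chain_minus_neg_chain)
  moreover have "is_meet (grp K n) p q \<one>\<^bsub>grp K n\<^esub>"
    unfolding is_meet_def
  proof (intro conjI ballI impI)
    fix c assume c: "c \<in> carrier (grp K n)" "c \<preceq>\<^bsub>grp K n\<^esub> p \<and> c \<preceq>\<^bsub>grp K n\<^esub> q"
    have "lookup (\<phi> n c) z \<le> 0" for z
      using c R nonnegD[of "pos_chain (\<phi> n x) - \<phi> n c" z] nonnegD[of "neg_chain (\<phi> n x) - \<phi> n c" z]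
      by (simp add: coord_le lookup_minus)
    then show "c \<preceq>\<^bsub>grp K n\<^esub> \<one>\<^bsub>grp K n\<^esub>"
      using c by (simp add: coord_le nonneg_def)
  qed (use R in \<open>auto simp: coord_le\<close>)
  ultimately show ?L using R by (simp add: is_parts_def pos_cone_iff)
qed

lemma pos_neg_part:
  assumes x: "x \<in> carrier (grp K n)"
  shows "pos_part (grp K n) x = elem n (pos_chain (\<phi> n x))" "neg_part (grp K n) x = elem n (neg_chain (\<phi> n x))"
proof -
  have k: "keys (pos_chain (\<phi> n x)) \<subseteq> B n" "keys (neg_chain (\<phi> n x)) \<subseteq> B n"
    using coord_keys[OF x] keys_pos_chain_subset[of "\<phi> n x"] keys_neg_chain_subset[of "\<phi> n x"] by auto
  have parts: "is_parts (grp K n) x (elem n (pos_chain (\<phi> n x))) (elem n (neg_chain (\<phi> n x)))"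
    using x k by (simp add: is_parts_iff elem_closed coord_elem)
  have unique: "p = elem n (pos_chain (\<phi> n x)) \<and> q = elem n (neg_chain (\<phi> n x))"
    if "is_parts (grp K n) x p q" for p q
    using that x elem_coord is_parts_iff by metis
  show "pos_part (grp K n) x = elem n (pos_chain (\<phi> n x))"
    unfolding pos_part_def using parts unique by (intro the_equality) blast+
  show "neg_part (grp K n) x = elem n (neg_chain (\<phi> n x))"
    unfolding neg_part_def using parts unique by (intro the_equality) blast+
qed

lemma coord_adc_bd:
  assumes "x \<in> carrier (grp K (Suc n))"
  shows "adc_bd_minus K n x \<in> carrier (grp K n)" "adc_bd_plus K n x \<in> carrier (grp K n)"
    "\<phi> n (adc_bd_minus K n x) = neg_chain (frag_extend (\<delta> n) (\<phi> (Suc n) x))"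
    "\<phi> n (adc_bd_plus K n x) = pos_chain (frag_extend (\<delta> n) (\<phi> (Suc n) x))"
proof -
  note bd = bd_closed[OF assms]
  have "keys (neg_chain (\<phi> n (bd K n x))) \<subseteq> B n" "keys (pos_chain (\<phi> n (bd K n x))) \<subseteq> B n"
    using coord_keys[OF bd] keys_neg_chain_subset[of "\<phi> n (bd K n x)"]
      keys_pos_chain_subset[of "\<phi> n (bd K n x)"] by auto
  then show "adc_bd_minus K n x \<in> carrier (grp K n)" "adc_bd_plus K n x \<in> carrier (grp K n)"
    "\<phi> n (adc_bd_minus K n x) = neg_chain (frag_extend (\<delta> n) (\<phi> (Suc n) x))"
    "\<phi> n (adc_bd_plus K n x) = pos_chain (frag_extend (\<delta> n) (\<phi> (Suc n) x))"
    using pos_neg_part[OF bd] coord_bd[OF assms]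
    by (simp_all add: adc_bd_minus_def adc_bd_plus_def elem_closed coord_elem)
qed

lemma aug_iter_bd_minus:
  "x \<in> carrier (grp K n) \<Longrightarrow> aug K (iter_bd_minus K n x) = coeff_sum (iter_neg \<delta> n (\<phi> n x))"
  by (induction n arbitrary: x) (simp_all add: coord_aug coord_adc_bd)

lemma aug_iter_bd_plus:
  "x \<in> carrier (grp K n) \<Longrightarrow> aug K (iter_bd_plus K n x) = coeff_sum (iter_pos \<delta> n (\<phi> n x))"
  by (induction n arbitrary: x) (simp_all add: coord_aug coord_adc_bd)

section \<open>The presented generators as a basis\<close>

definition gens :: "nat \<Rightarrow> 'a set" where
  "gens n = (\<lambda>b. elem n (frag_of b)) ` B n"

lemma gens_carrier: "gens n \<subseteq> carrier (grp K n)"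
  by (auto simp: gens_def intro!: elem_closed)

lemma coord_int_lincomb:
  assumes "keys c \<subseteq> carrier (grp K n)"
  shows "\<phi> n (int_lincomb (grp K n) c) = frag_extend (\<phi> n) c"
proof -
  \<comment> \<open>The support condition is carried through the induction because
    \<open>int_lincomb_diff\<close> asks for it at each difference.\<close>
  have "keys c \<subseteq> carrier (grp K n) \<and> \<phi> n (int_lincomb (grp K n) c) = frag_extend (\<phi> n) c"
    using assms
  proof (rule frag_induction)
    fix a b assume "keys a \<subseteq> carrier (grp K n) \<and> \<phi> n (int_lincomb (grp K n) a) = frag_extend (\<phi> n) a"
      "keys b \<subseteq> carrier (grp K n) \<and> \<phi> n (int_lincomb (grp K n) b) = frag_extend (\<phi> n) b"
    then show "keys (a - b) \<subseteq> carrier (grp K n) \<and> \<phi> n (int_lincomb (grp K n) (a - b)) = frag_extend (\<phi> n) (a - b)"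
      using keys_diff[of a b]
      by (auto simp: A.int_lincomb_diff A.int_lincomb_closed coord_mult coord_inv frag_extend_diff)
  qed (simp_all add: A.int_lincomb_frag_of keys_frag_of)
  then show ?thesis ..
qed

text \<open>Coefficients in \<open>int_lincomb\<close> are indexed by group elements, so a chain
  over \<open>B n\<close> must first be moved to the elements that it labels.\<close>

abbreviation relabel :: "nat \<Rightarrow> ('b \<Rightarrow>\<^sub>0 int) \<Rightarrow> 'a \<Rightarrow>\<^sub>0 int" where
  "relabel n \<equiv> frag_extend (\<lambda>b. frag_of (elem n (frag_of b)))"

lemma keys_relabel: "keys c \<subseteq> B n \<Longrightarrow> keys (relabel n c) \<subseteq> gens n"
  by (intro keys_frag_extend_subset) (auto simp: gens_def)

lemma int_lincomb_relabel:
  assumes "keys c \<subseteq> B n"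
  shows "int_lincomb (grp K n) (relabel n c) = elem n c"
proof -
  have k: "keys (relabel n c) \<subseteq> carrier (grp K n)"
    using keys_relabel[OF assms] gens_carrier by blast
  have "frag_extend (\<phi> n) (relabel n c) = frag_extend frag_of c"
    unfolding frag_extend_compose by (rule frag_extend_eq) (use assms in \<open>auto simp: coord_elem\<close>)
  then show ?thesis
    using A.int_lincomb_closed[OF k] assms coord_int_lincomb[OF k]
    by (intro coord_eqI[of _ n]) (auto simp: elem_closed coord_elem)
qed

lemma relabel_coord_int_lincomb:
  assumes "keys c \<subseteq> gens n"
  shows "relabel n (\<phi> n (int_lincomb (grp K n) c)) = c"
proof -
  have "relabel n (\<phi> n (int_lincomb (grp K n) c)) = frag_extend (\<lambda>x. relabel n (\<phi> n x)) c"
    using assms gens_carrier[of n] by (subst coord_int_lincomb) (auto simp: frag_extend_compose)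
  also have "\<dots> = frag_extend frag_of c"
    by (rule frag_extend_eq) (use assms in \<open>auto simp: gens_def coord_elem\<close>)
  finally show ?thesis by simp
qed

lemma group_basis_gens: "group_basis (grp K n) (gens n)"
  unfolding group_basis_def
proof (intro conjI ballI)
  show "gens n \<subseteq> pos_cone (grp K n)"
    by (auto simp: gens_def pos_cone_iff elem_closed coord_elem)
next
  fix a assume a: "a \<in> carrier (grp K n)"
  show "\<exists>!c. keys c \<subseteq> gens n \<and> a = int_lincomb (grp K n) c"
  proof (rule ex1I[of _ "relabel n (\<phi> n a)"])
    show "keys (relabel n (\<phi> n a)) \<subseteq> gens n \<and> a = int_lincomb (grp K n) (relabel n (\<phi> n a))"
      using a by (simp add: keys_relabel coord_keys int_lincomb_relabel elem_coord)
  qed (auto simp: relabel_coord_int_lincomb)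
next
  fix a assume a: "a \<in> pos_cone (grp K n)"
  then have a': "a \<in> carrier (grp K n)" "nonneg (\<phi> n a)" by (auto simp: pos_cone_iff)
  define c where "c = relabel n (\<phi> n a)"
  \<comment> \<open>Truncation to naturals is exact because \<open>c\<close> is nonnegative.
    Uniqueness among natural coefficients then follows from uniqueness among integers.\<close>
  define c' where "c' = Poly_Mapping.map nat c"
  have "nonneg c" unfolding c_def using a' by (intro nonneg_frag_extend) auto
  then have "lookup (Poly_Mapping.map int c') x = lookup c x" for x
    using nonnegD[of c x] by (simp add: lookup_map_int c'_def Poly_Mapping.map.rep_eq when_def)
  then have map: "Poly_Mapping.map int c' = c" by (intro poly_mapping_eqI)
  show "\<exists>!c. keys c \<subseteq> gens n \<and> a = nat_lincomb (grp K n) c"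
  proof (rule ex1I[of _ c'])
    have "keys c' = keys c" using map keys_map_int by metis
    then show "keys c' \<subseteq> gens n \<and> a = nat_lincomb (grp K n) c'"
      using a' unfolding A.nat_lincomb_eq_int_lincomb map
      by (simp add: c_def keys_relabel coord_keys int_lincomb_relabel elem_coord)
  next
    fix d assume d: "keys d \<subseteq> gens n \<and> a = nat_lincomb (grp K n) d"
    then have "Poly_Mapping.map int d = c"
      using relabel_coord_int_lincomb[of "Poly_Mapping.map int d" n]
      by (simp add: A.nat_lincomb_eq_int_lincomb keys_map_int c_def)
    then have "int (lookup d x) = int (lookup c' x)" for x
      using map lookup_map_int by metis
    then show "d = c'" by (intro poly_mapping_eqI) simp
  qed
qed

lemma strong_steiner:
  assumes "steiner_data B \<delta>"
  shows "strong_steiner_complex K"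
proof -
  interpret S: steiner_data B \<delta> by fact
  have unital: "unital_basis K gens"
    unfolding unital_basis_def
    using S.unital S.unit_chain_iter_pos[OF S.unit_chain_generator]
    by (auto simp: gens_def aug_iter_bd_minus aug_iter_bd_plus elem_closed coord_elem)
  \<comment> \<open>Comparison with a generator tests a single coefficient, since the others are
    nonnegative already.\<close>
  have le: "elem n (frag_of x) \<preceq>\<^bsub>grp K n\<^esub> y \<longleftrightarrow> 1 \<le> lookup (\<phi> n y) x"
    if "x \<in> B n" "y \<in> pos_cone (grp K n)" for n x y
    using that by (auto simp: coord_le elem_closed coord_elem pos_cone_iff nonneg_def lookup_minus split: if_splits)
  have pos: "adc_bd_minus K n y \<in> pos_cone (grp K n)" "adc_bd_plus K n y \<in> pos_cone (grp K n)"
    if "y \<in> carrier (grp K (Suc n))" for n y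
    using that by (auto simp: pos_cone_iff coord_adc_bd)
  obtain r where r: "partial_order_on (SIGMA n:UNIV. B n) r"
    and r1: "\<And>n x y. x \<in> B n \<Longrightarrow> y \<in> B (Suc n) \<Longrightarrow> lookup (\<delta> n y) x < 0 \<Longrightarrow> ((n, x), (Suc n, y)) \<in> r"
    and r2: "\<And>n x y. x \<in> B (Suc n) \<Longrightarrow> y \<in> B n \<Longrightarrow> 0 < lookup (\<delta> n x) y \<Longrightarrow> ((Suc n, x), (n, y)) \<in> r"
    using S.loop_free by meson
  let ?e = "\<lambda>(n, x). (n, elem n (frag_of x))"
  \<comment> \<open>The order is transported along \<open>?e\<close>. Injectivity identifies the
    middle points of composable pairs, as transitivity and antisymmetry need.\<close>
  define r' where "r' = (\<lambda>(p, q). (?e p, ?e q)) ` r"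
  have inj: "inj_on ?e (SIGMA n:UNIV. B n)"
  proof (rule inj_onI, clarsimp)
    fix n x y assume "x \<in> B n" "y \<in> B n" "elem n (frag_of x) = elem n (frag_of y)"
    then have "\<phi> n (elem n (frag_of x)) = \<phi> n (elem n (frag_of y))" by simp
    then show "x = y" using \<open>x \<in> B n\<close> \<open>y \<in> B n\<close> by (simp add: coord_elem frag_of_eq)
  qed
  have r_sub: "r \<subseteq> (SIGMA n:UNIV. B n) \<times> (SIGMA n:UNIV. B n)"
    using r by (rule partial_order_onD)
  have "partial_order_on (SIGMA n:UNIV. gens n) r'"
    unfolding order_on_defs
  proof (intro conjI)
    show "r' \<subseteq> (SIGMA n:UNIV. gens n) \<times> (SIGMA n:UNIV. gens n)"
      using r_sub by (fastforce simp: r'_def gens_def)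
    show "refl_on (SIGMA n:UNIV. gens n) r'"
      using partial_order_onD(1)[OF r] by (force simp: r'_def gens_def refl_on_def)
    show "trans r'"
    proof (rule transI)
      fix u v w assume "(u, v) \<in> r'" "(v, w) \<in> r'"
      then obtain a b b' c where *: "(a, b) \<in> r" "(b', c) \<in> r" "u = ?e a" "v = ?e b" "v = ?e b'" "w = ?e c"
        by (auto simp: r'_def)
      then have "b = b'" using inj_onD[OF inj, of b b'] r_sub by auto
      then have "(a, c) \<in> r" using * partial_order_onD(2)[OF r] by (auto dest: transD)
      then show "(u, w) \<in> r'" using * by (force simp: r'_def)
    qed
    show "antisym r'"
    proof (rule antisymI)
      fix u v assume "(u, v) \<in> r'" "(v, u) \<in> r'"
      then obtain a b b' a' where *: "(a, b) \<in> r" "(b', a') \<in> r" "u = ?e a" "v = ?e b" "v = ?e b'" "u = ?e a'"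
        by (auto simp: r'_def)
      then have "b = b'" "a = a'" using inj_onD[OF inj, of b b'] inj_onD[OF inj, of a a'] r_sub by auto
      then show "u = v" using * partial_order_onD(3)[OF r] by (auto dest: antisymD)
    qed
  qed
  moreover have "((n, elem n (frag_of x)), (Suc n, elem (Suc n) (frag_of y))) \<in> r'"
    if "x \<in> B n" "y \<in> B (Suc n)" "elem n (frag_of x) \<preceq>\<^bsub>grp K n\<^esub> adc_bd_minus K n (elem (Suc n) (frag_of y))" for n x y
  proof -
    have "lookup (\<delta> n y) x < 0"
      using that le[OF that(1) pos(1)[OF elem_closed[of "frag_of y"]]] by (simp add: coord_adc_bd elem_closed coord_elem)
    then show ?thesis using r1[OF that(1,2)] by (force simp: r'_def)
  qed
  moreover have "((Suc n, elem (Suc n) (frag_of y)), (n, elem n (frag_of x))) \<in> r'"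
    if "x \<in> B n" "y \<in> B (Suc n)" "elem n (frag_of x) \<preceq>\<^bsub>grp K n\<^esub> adc_bd_plus K n (elem (Suc n) (frag_of y))" for n x y
  proof -
    have "0 < lookup (\<delta> n y) x"
      using that le[OF that(1) pos(2)[OF elem_closed[of "frag_of y"]]] by (simp add: coord_adc_bd elem_closed coord_elem)
    then show ?thesis using r2[OF that(2,1)] by (force simp: r'_def)
  qed
  ultimately have "strongly_loop_free_basis K gens"
    unfolding strongly_loop_free_basis_def gens_def by blast
  then show ?thesis
    unfolding strong_steiner_complex_def adc_basis_def
    using unital group_basis_gens augmented_directed_complex_axioms by blast
qed

end

text \<open>The group half of the basis property provides the coordinates, its monoid half
  identifies the order; \<open>\<delta>\<close> is the boundary in these coordinates.\<close>

lemma (in augmented_directed_complex) basis_presentation: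
  assumes basis: "adc_basis K B" and unital: "unital_basis K B" and slf: "strongly_loop_free_basis K B"
  obtains \<delta> \<phi> where "steiner_data B \<delta>" "presentation K B \<delta> \<phi>"
proof -
  have pos: "B n \<subseteq> pos_cone (grp K n)" for n
    using basis by (simp add: adc_basis_def group_basis_def)
  then have car: "B n \<subseteq> carrier (grp K n)" for n by (auto simp: pos_cone_def)
  define \<phi> where "\<phi> n x = (THE c. keys c \<subseteq> B n \<and> x = int_lincomb (grp K n) c)" for n x
  have ex1: "\<exists>!c. keys c \<subseteq> B n \<and> x = int_lincomb (grp K n) c" if "x \<in> carrier (grp K n)" for n x
    using basis that by (simp add: adc_basis_def group_basis_def)
  have coord: "keys (\<phi> n x) \<subseteq> B n" "int_lincomb (grp K n) (\<phi> n x) = x" if "x \<in> carrier (grp K n)" for n x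
    using theI'[OF ex1[OF that]] by (simp_all add: \<phi>_def)
  have closed: "int_lincomb (grp K n) c \<in> carrier (grp K n)" if "keys c \<subseteq> B n" for n c
    using that car by (intro A.int_lincomb_closed) blast
  have lincomb: "\<phi> n (int_lincomb (grp K n) c) = c" if "keys c \<subseteq> B n" for n c
    unfolding \<phi>_def by (rule the1_equality) (use that closed ex1 in blast)+
  have gen: "\<phi> n b = frag_of b" if "b \<in> B n" for n b
    using lincomb[of "frag_of b" n] that car A.int_lincomb_frag_of[of b n] by (auto simp: subset_iff)
  have mult: "\<phi> n (x \<otimes>\<^bsub>grp K n\<^esub> y) = \<phi> n x + \<phi> n y"
    if "x \<in> carrier (grp K n)" "y \<in> carrier (grp K n)" for n x y
  proof -
    have "x \<otimes>\<^bsub>grp K n\<^esub> y = int_lincomb (grp K n) (\<phi> n x + \<phi> n y)"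
      using coord that car by (subst A.int_lincomb_add) (metis subset_trans)+
    then show ?thesis
      using lincomb[OF keys_add_subset[OF coord(1)[OF that(1)] coord(1)[OF that(2)]]] by simp
  qed
  have one: "\<phi> n \<one>\<^bsub>grp K n\<^esub> = 0" for n
    using lincomb[of 0 n] by simp
  have inv: "\<phi> n (inv\<^bsub>grp K n\<^esub> x) = - \<phi> n x" if "x \<in> carrier (grp K n)" for n x
    using mult[of x n "inv\<^bsub>grp K n\<^esub> x"] that one by (simp add: add_eq_0_iff)
  \<comment> \<open>Elements of the cone expand with natural coefficients, and uniqueness in the
    group identifies this expansion with the coordinates.\<close>
  have cone: "x \<in> pos_cone (grp K n) \<longleftrightarrow> nonneg (\<phi> n x)" if x: "x \<in> carrier (grp K n)" for n x
  proof
    assume "x \<in> pos_cone (grp K n)"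
    then obtain c where "keys c \<subseteq> B n" "x = nat_lincomb (grp K n) c"
      using basis unfolding adc_basis_def group_basis_def by blast
    then have "\<phi> n x = Poly_Mapping.map int c"
      using lincomb[of "Poly_Mapping.map int c" n] by (simp add: A.nat_lincomb_eq_int_lincomb keys_map_int)
    then show "nonneg (\<phi> n x)" by (simp add: nonneg_def lookup_map_int)
  next
    assume "nonneg (\<phi> n x)"
    then have "int_lincomb (grp K n) (\<phi> n x) \<in> pos_cone (grp K n)"
      using coord[OF x] pos[of n] by (intro A.int_lincomb_pos_cone) auto
    then show "x \<in> pos_cone (grp K n)" using coord[OF x] by simp
  qed
  define \<delta> where "\<delta> n b = \<phi> n (bd K n b)" for n b
  \<comment> \<open>An additive map is determined by its values on the basis. The target stays
    polymorphic, to cover both the boundary and the augmentation.\<close>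
  have extend: "h x = frag_extend g (\<phi> n x)"
    if x: "x \<in> carrier (grp K n)" and h: "\<And>x y. \<lbrakk>x \<in> carrier (grp K n); y \<in> carrier (grp K n)\<rbrakk>
        \<Longrightarrow> h (x \<otimes>\<^bsub>grp K n\<^esub> y) = h x + h y" and g: "\<And>b. b \<in> B n \<Longrightarrow> h b = g b"
    for n x and h :: "'a \<Rightarrow> 'c \<Rightarrow>\<^sub>0 int" and g
  proof -
    have h_inv: "h (inv\<^bsub>grp K n\<^esub> x) = - h x" if "x \<in> carrier (grp K n)" for x
      using h[of \<open>\<one>\<^bsub>grp K n\<^esub>\<close> \<open>\<one>\<^bsub>grp K n\<^esub>\<close>] h[of x "inv\<^bsub>grp K n\<^esub> x"] that by (simp add: add_eq_0_iff)
    have "keys (\<phi> n x) \<subseteq> B n \<and> h (int_lincomb (grp K n) (\<phi> n x)) = frag_extend g (\<phi> n x)"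
      using coord(1)[OF x]
    proof (rule frag_induction)
      fix a b assume "keys a \<subseteq> B n \<and> h (int_lincomb (grp K n) a) = frag_extend g a"
        "keys b \<subseteq> B n \<and> h (int_lincomb (grp K n) b) = frag_extend g b"
      then show "keys (a - b) \<subseteq> B n \<and> h (int_lincomb (grp K n) (a - b)) = frag_extend g (a - b)"
        using keys_diff[of a b] car[of n] closed[of a n] closed[of b n] A.int_lincomb_diff[of a n b]
        by (auto simp: h h_inv frag_extend_diff)
    next
      show "keys 0 \<subseteq> B n \<and> h (int_lincomb (grp K n) 0) = frag_extend g 0"
        using h[of \<open>\<one>\<^bsub>grp K n\<^esub>\<close> \<open>\<one>\<^bsub>grp K n\<^esub>\<close>] by simp
    next
      fix b assume "b \<in> B n"
      then show "keys (frag_of b) \<subseteq> B n \<and> h (int_lincomb (grp K n) (frag_of b)) = frag_extend g (frag_of b)"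
        using car[of n] A.int_lincomb_frag_of[of b n] g by (auto simp: keys_frag_of)
    qed
    then show ?thesis using coord(2)[OF x] by simp
  qed
  have bd: "\<phi> n (bd K n x) = frag_extend (\<delta> n) (\<phi> (Suc n) x)" if "x \<in> carrier (grp K (Suc n))" for n x
    using that hom_mult[OF bd_hom[of n]] bd_closed
    by (intro extend[of x "Suc n" "\<lambda>x. \<phi> n (bd K n x)"]) (auto simp: mult \<delta>_def)
  have aug: "aug K x = coeff_sum (\<phi> 0 x)" if x: "x \<in> carrier (grp K 0)" for x
  proof -
    \<comment> \<open>The integer is read as a chain over \<open>unit\<close>, so that
      \<open>extend\<close> applies. On generators the augmentation is 1 by unitality in degree
      0.\<close>
    have "Poly_Mapping.single () (aug K x) = frag_extend (\<lambda>_. frag_of ()) (\<phi> 0 x)"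
    proof (rule extend[OF x])
      fix b assume "b \<in> B 0"
      then have "aug K (iter_bd_minus K 0 b) = 1"
        using unital unfolding unital_basis_def by blast
      then show "Poly_Mapping.single () (aug K b) = frag_of ()" by simp
    next
      fix x y assume "x \<in> carrier (grp K 0)" "y \<in> carrier (grp K 0)"
      then show "Poly_Mapping.single () (aug K (x \<otimes>\<^bsub>grp K 0\<^esub> y)) =
        Poly_Mapping.single () (aug K x) + Poly_Mapping.single () (aug K y)"
        using hom_mult[OF aug_hom] by (simp add: single_add)
    qed
    then show ?thesis by (metis coeff_sum_eq_frag_extend lookup_single_eq)
  qed
  have pres: "presentation K B \<delta> \<phi>"
  proof
    fix n
    show "bij_betw (\<phi> n) (carrier (grp K n)) {c. keys c \<subseteq> B n}"
      by (rule bij_betw_byWitness[where f' = "int_lincomb (grp K n)"]) (auto simp: coord(2) lincomb closed dest: subsetD[OF coord(1)])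
  next
    fix n x y assume xy: "x \<in> carrier (grp K n)" "y \<in> carrier (grp K n)"
    then show "x \<preceq>\<^bsub>grp K n\<^esub> y \<longleftrightarrow> nonneg (\<phi> n y - \<phi> n x)"
      by (simp add: A.order_rel_diff cone mult inv)
  qed (simp_all add: mult bd aug)
  interpret P: presentation K B \<delta> \<phi> by fact
  have "steiner_data B \<delta>"
  proof
    fix n x assume "x \<in> B (Suc n)"
    then show "keys (\<delta> n x) \<subseteq> B n"
      unfolding \<delta>_def using car by (intro coord bd_closed) blast
  next
    fix n x assume x: "x \<in> B (Suc (Suc n))"
    then have "x \<in> carrier (grp K (Suc (Suc n)))" using car by blast
    then show "frag_extend (\<delta> n) (\<delta> (Suc n) x) = 0"
      using bd[of "bd K (Suc n) x" n] bd_bd[of x n] bd_closed[of x "Suc n"] one by (simp add: \<delta>_def)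
  next
    fix x assume "x \<in> B (Suc 0)"
    then have "x \<in> carrier (grp K (Suc 0))" using car by blast
    then show "coeff_sum (\<delta> 0 x) = 0"
      using aug[of "bd K 0 x"] aug_bd[of x] bd_closed[of x 0] by (simp add: \<delta>_def)
  next
    fix n x assume x: "x \<in> B n"
    then show "coeff_sum (iter_neg \<delta> n (frag_of x)) = 1"
      using P.aug_iter_bd_minus[of x n] car[of n] gen[OF x] unital by (auto simp: unital_basis_def)
  next
    have le: "x \<preceq>\<^bsub>grp K n\<^esub> y \<longleftrightarrow> 1 \<le> lookup (\<phi> n y) x"
      if "x \<in> B n" "y \<in> carrier (grp K n)" "nonneg (\<phi> n y)" for n x y
      using that car[of n]
      by (auto simp: P.coord_le gen[OF that(1)] subset_iff nonneg_def lookup_minus split: if_splits)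
    have minus: "x \<preceq>\<^bsub>grp K n\<^esub> adc_bd_minus K n y" if "x \<in> B n" "y \<in> B (Suc n)" "lookup (\<delta> n y) x < 0" for n x y
      using that car[of "Suc n"] gen[of y "Suc n"] P.coord_adc_bd[of y n] le[OF that(1), of "adc_bd_minus K n y"]
      by auto
    have plus: "x \<preceq>\<^bsub>grp K n\<^esub> adc_bd_plus K n y" if "x \<in> B n" "y \<in> B (Suc n)" "0 < lookup (\<delta> n y) x" for n x y
      using that car[of "Suc n"] gen[of y "Suc n"] P.coord_adc_bd[of y n] le[OF that(1), of "adc_bd_plus K n y"]
      by auto
    show "\<exists>r. partial_order_on (SIGMA n:UNIV. B n) r \<and>
      (\<forall>n. \<forall>x\<in>B n. \<forall>y\<in>B (Suc n). lookup (\<delta> n y) x < 0 \<longrightarrow> ((n, x), Suc n, y) \<in> r) \<and>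
      (\<forall>n. \<forall>x\<in>B (Suc n). \<forall>y\<in>B n. 0 < lookup (\<delta> n x) y \<longrightarrow> ((Suc n, x), n, y) \<in> r)"
      using slf minus plus unfolding strongly_loop_free_basis_def by meson
  qed
  then show ?thesis using that pres by blast
qed

text \<open>The skeleton of the basis data is an actual parity complex over the same
  \<open>'a\<close>, and its \<open>cell_bd\<close> agrees with \<open>\<delta>\<close> on all
  chains that occur.\<close>

lemma strong_steiner_presentation:
  fixes K :: "'a adc"
  assumes "strong_steiner_complex K"
  obtains C :: "'a parity_structure" and \<phi> where "parity_complex C" "presentation K (cells C) (cell_bd C) \<phi>"
proof -
  interpret augmented_directed_complex K using assms by (simp add: strong_steiner_complex_def)
  obtain B where B: "adc_basis K B" "unital_basis K B" "strongly_loop_free_basis K B"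
    using assms by (auto simp: strong_steiner_complex_def)
  obtain \<delta> \<phi> where S: "steiner_data B \<delta>" and P: "presentation K B \<delta> \<phi>"
    using basis_presentation[OF B] .
  interpret S: steiner_data B \<delta> by (rule S)
  interpret P: presentation K B \<delta> \<phi> by (rule P)
  have "presentation K B (cell_bd (skeleton B \<delta>)) \<phi>"
    by unfold_locales (auto simp: P.coord_bij P.coord_mult P.coord_le P.coord_bd P.coord_aug
        S.frag_extend_skeleton P.coord_keys)
  then show ?thesis
    using that[of "skeleton B \<delta>" \<phi>] S.skeleton_parity_complex by simp
qed

section \<open>Fully faithful and essentially surjective functors\<close>

text \<open>Objects \<open>G d\<close> and isomorphisms \<open>\<theta> d\<close> are chosen.
  Equations in \<open>C\<close> are checked after applying \<open>F\<close>, which is injective on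
  arrows, and functoriality of the conjugates is checked after composing with
  \<open>\<theta>\<close>.\<close>

lemma equivalent_categoriesI:
  fixes C :: "('o1, 'm1) cat" and D :: "('o2, 'm2) cat" and F :: "('o1, 'm1, 'o2, 'm2) fctr"
  assumes "category C" "category D" "cat_functor C D F"
    and ff: "\<And>a b. \<lbrakk>a \<in> Ob C; b \<in> Ob C\<rbrakk> \<Longrightarrow>
      bij_betw (arr_map F a b) (Hom C a b) (Hom D (ob_map F a) (ob_map F b))"
    and es: "\<And>d. d \<in> Ob D \<Longrightarrow> \<exists>a\<in>Ob C. \<exists>f. is_iso D (ob_map F a) d f"
  shows "equivalent_categories C D"
proof -
  interpret C: category C by fact
  interpret D: category D by fact
  interpret F: cat_functor C D F by fact
  let ?F = "ob_map F"
  obtain G where G: "\<And>d. d \<in> Ob D \<Longrightarrow> G d \<in> Ob C \<and> (\<exists>f. is_iso D (?F (G d)) d f)"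
    using es by metis
  have G_ob [simp]: "G d \<in> Ob C" if "d \<in> Ob D" for d using G that by blast
  obtain \<theta> where \<theta>: "\<And>d. d \<in> Ob D \<Longrightarrow> is_iso D (?F (G d)) d (\<theta> d)"
    using G by metis
  have \<theta>_in [simp]: "\<theta> d \<in> Hom D (?F (G d)) d" if "d \<in> Ob D" for d
    using \<theta>[OF that] by (simp add: is_iso_def)
  obtain \<theta>' where \<theta>': "\<And>d. d \<in> Ob D \<Longrightarrow> \<theta>' d \<in> Hom D d (?F (G d)) \<and>
      Comp D (?F (G d)) d (?F (G d)) (\<theta>' d) (\<theta> d) = Id D (?F (G d)) \<and>
      Comp D d (?F (G d)) d (\<theta> d) (\<theta>' d) = Id D d"
    using \<theta> unfolding is_iso_def by metis
  have \<theta>'_in [simp]: "\<theta>' d \<in> Hom D d (?F (G d))"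
    and \<theta>'\<theta>: "Comp D (?F (G d)) d (?F (G d)) (\<theta>' d) (\<theta> d) = Id D (?F (G d))"
    and \<theta>\<theta>': "Comp D d (?F (G d)) d (\<theta> d) (\<theta>' d) = Id D d" if "d \<in> Ob D" for d
    using \<theta>'[OF that] by blast+
  define L where "L a b = inv_into (Hom C a b) (arr_map F a b)" for a b
  have L_in [simp]: "L a b g \<in> Hom C a b" and FL [simp]: "arr_map F a b (L a b g) = g"
    if "a \<in> Ob C" "b \<in> Ob C" "g \<in> Hom D (?F a) (?F b)" for a b g
    using ff[OF that(1,2)] that(3) unfolding L_def bij_betw_def
    by (auto intro: inv_into_into f_inv_into_f)
  have eqI: "f = g" if "a \<in> Ob C" "b \<in> Ob C" "f \<in> Hom C a b" "g \<in> Hom C a b"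
    "arr_map F a b f = arr_map F a b g" for a b f g
    using ff[OF that(1,2)] that(3-) by (auto simp: bij_betw_def dest: inj_onD)
  note [simp] = F.ob_map_in F.arr_map_in D.Comp_in C.Comp_in C.Id_in D.Id_in
  \<comment> \<open>\<open>f\<close> transported along the chosen isomorphisms; its lift through
    \<open>F\<close> is the inverse functor on arrows.\<close>
  define conj where "conj d e f = Comp D (?F (G d)) e (?F (G e)) (\<theta>' e) (Comp D (?F (G d)) d e f (\<theta> d))" for d e f
  have conj_in [simp]: "conj d e f \<in> Hom D (?F (G d)) (?F (G e))"
    if "d \<in> Ob D" "e \<in> Ob D" "f \<in> Hom D d e" for d e f
    using that unfolding conj_def by (intro D.Comp_in[of _ e] D.Comp_in[of _ d]) auto
  have \<theta>_conj: "Comp D (?F (G d)) (?F (G e)) e (\<theta> e) (conj d e f) = Comp D (?F (G d)) d e f (\<theta> d)"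
    if "d \<in> Ob D" "e \<in> Ob D" "f \<in> Hom D d e" for d e f
  proof -
    have "Comp D (?F (G d)) d e f (\<theta> d) \<in> Hom D (?F (G d)) e"
      using that by (intro D.Comp_in[of _ d]) auto
    then show ?thesis
      using that unfolding conj_def
      by (subst D.Comp_assoc) (auto simp: \<theta>\<theta>' D.Comp_Id_left)
  qed
  \<comment> \<open>A left inverse makes \<open>\<theta> d\<close> cancellable on the left.\<close>
  have \<theta>_cancel: "u = v" if "d \<in> Ob D" "c \<in> Ob D" "u \<in> Hom D c (?F (G d))" "v \<in> Hom D c (?F (G d))"
    "Comp D c (?F (G d)) d (\<theta> d) u = Comp D c (?F (G d)) d (\<theta> d) v" for c d u v
  proof -
    have "w = Comp D c d (?F (G d)) (\<theta>' d) (Comp D c (?F (G d)) d (\<theta> d) w)"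
      if "w \<in> Hom D c (?F (G d))" for w
      using that \<open>d \<in> Ob D\<close> \<open>c \<in> Ob D\<close> by (subst D.Comp_assoc) (auto simp: \<theta>'\<theta> D.Comp_Id_left)
    then show ?thesis using that by metis
  qed
  have conj_Id: "conj d d (Id D d) = Id D (?F (G d))" if "d \<in> Ob D" for d
    using that by (simp add: conj_def D.Comp_Id_left \<theta>'\<theta>)
  have conj_Comp: "conj a c (Comp D a b c g f) = Comp D (?F (G a)) (?F (G b)) (?F (G c)) (conj b c g) (conj a b f)"
    if "a \<in> Ob D" "b \<in> Ob D" "c \<in> Ob D" "f \<in> Hom D a b" "g \<in> Hom D b c" for a b c f g
  proof (rule \<theta>_cancel[of c "?F (G a)"])
    have "Comp D (?F (G a)) (?F (G c)) c (\<theta> c) (conj a c (Comp D a b c g f))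
        = Comp D (?F (G a)) a c (Comp D a b c g f) (\<theta> a)"
      using that by (intro \<theta>_conj) auto
    also have "\<dots> = Comp D (?F (G a)) b c g (Comp D (?F (G a)) a b f (\<theta> a))"
      using that by (subst D.Comp_assoc) auto
    also have "\<dots> = Comp D (?F (G a)) b c g (Comp D (?F (G a)) (?F (G b)) b (\<theta> b) (conj a b f))"
      using that by (simp add: \<theta>_conj)
    also have "\<dots> = Comp D (?F (G a)) (?F (G b)) c (Comp D (?F (G b)) b c g (\<theta> b)) (conj a b f)"
      using that by (subst D.Comp_assoc) auto
    also have "\<dots> = Comp D (?F (G a)) (?F (G b)) c (Comp D (?F (G b)) (?F (G c)) c (\<theta> c) (conj b c g)) (conj a b f)"
      using that by (simp add: \<theta>_conj)
    also have "\<dots> = Comp D (?F (G a)) (?F (G c)) c (\<theta> c)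
        (Comp D (?F (G a)) (?F (G b)) (?F (G c)) (conj b c g) (conj a b f))"
      using that by (subst D.Comp_assoc) auto
    finally show "Comp D (?F (G a)) (?F (G c)) c (\<theta> c) (conj a c (Comp D a b c g f)) =
      Comp D (?F (G a)) (?F (G c)) c (\<theta> c) (Comp D (?F (G a)) (?F (G b)) (?F (G c)) (conj b c g) (conj a b f))" .
  qed (use that in \<open>auto intro!: conj_in D.Comp_in[of _ b] D.Comp_in[of _ "?F (G b)"]\<close>)
  define G' where "G' = \<lparr>ob_map = G, arr_map = (\<lambda>d e f. L (G d) (G e) (conj d e f))\<rparr>"
  have G'_simps [simp]: "ob_map G' = G" "arr_map G' = (\<lambda>d e f. L (G d) (G e) (conj d e f))"
    by (simp_all add: G'_def)
  have "cat_functor D C G'"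
  proof
    fix a assume "a \<in> Ob D"
    then show "arr_map G' a a (Id D a) = Id C (ob_map G' a)"
      by (auto intro!: eqI[of "G a" "G a"] simp: conj_Id F.arr_map_Id)
  next
    fix a b c f g assume *: "a \<in> Ob D" "b \<in> Ob D" "c \<in> Ob D" "f \<in> Hom D a b" "g \<in> Hom D b c"
    then have comp: "conj a c (Comp D a b c g f) \<in> Hom D (?F (G a)) (?F (G c))"
      by (intro conj_in D.Comp_in[of _ b])
    have Lc: "Comp C (G a) (G b) (G c) (L (G b) (G c) (conj b c g)) (L (G a) (G b) (conj a b f)) \<in> Hom C (G a) (G c)"
      using * by (intro C.Comp_in[of _ "G b"]) auto
    have "L (G a) (G c) (conj a c (Comp D a b c g f))
        = Comp C (G a) (G b) (G c) (L (G b) (G c) (conj b c g)) (L (G a) (G b) (conj a b f))"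
      using * comp Lc by (intro eqI[of "G a" "G c"]) (auto simp: conj_Comp F.arr_map_Comp)
    then show "arr_map G' a c (Comp D a b c g f)
      = Comp C (ob_map G' a) (ob_map G' b) (ob_map G' c) (arr_map G' b c g) (arr_map G' a b f)" by simp
  qed auto
  moreover have "natural_isomorphism D D (comp_fctr F G') id_fctr \<theta>"
    by unfold_locales (auto simp: comp_fctr_def id_fctr_def \<theta> \<theta>_conj)
  \<comment> \<open>The unit lifts \<open>\<theta>'\<close> at \<open>?F a\<close>, so its equations
    reduce to those between \<open>\<theta>\<close> and \<open>\<theta>'\<close>.\<close>
  moreover have "natural_isomorphism C C id_fctr (comp_fctr G' F) (\<lambda>a. L a (G (?F a)) (\<theta>' (?F a)))"
  proof
    fix a assume a: "a \<in> Ob C"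
    let ?\<eta> = "L a (G (?F a)) (\<theta>' (?F a))" and ?\<eta>' = "L (G (?F a)) a (\<theta> (?F a))"
    have in1: "?\<eta> \<in> Hom C a (G (?F a))" "?\<eta>' \<in> Hom C (G (?F a)) a" using a by auto
    have "Comp C a (G (?F a)) a ?\<eta>' ?\<eta> = Id C a"
      using a in1 by (intro eqI[of a a] C.Comp_in[of _ "G (?F a)"])
        (auto simp: F.arr_map_Comp F.arr_map_Id \<theta>\<theta>')
    moreover have "Comp C (G (?F a)) a (G (?F a)) ?\<eta> ?\<eta>' = Id C (G (?F a))"
      using a in1 by (intro eqI[of "G (?F a)" "G (?F a)"] C.Comp_in[of _ a])
        (auto simp: F.arr_map_Comp F.arr_map_Id \<theta>'\<theta>)
    ultimately show "is_iso C (ob_map id_fctr a) (ob_map (comp_fctr G' F) a) ?\<eta>"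
      using in1 by (auto simp: is_iso_def id_fctr_def comp_fctr_def)
  next
    fix a b f assume *: "a \<in> Ob C" "b \<in> Ob C" "f \<in> Hom C a b"
    let ?Ff = "arr_map F a b f"
    have in1: "L a (G (?F a)) (\<theta>' (?F a)) \<in> Hom C a (G (?F a))" "L b (G (?F b)) (\<theta>' (?F b)) \<in> Hom C b (G (?F b))"
      "L (G (?F a)) (G (?F b)) (conj (?F a) (?F b) ?Ff) \<in> Hom C (G (?F a)) (G (?F b))" using * by auto
    have "Comp D (?F a) (?F b) (?F (G (?F b))) (\<theta>' (?F b)) ?Ff
        = Comp D (?F a) (?F (G (?F a))) (?F (G (?F b))) (conj (?F a) (?F b) ?Ff) (\<theta>' (?F a))"
    proof -
      have "Comp D (?F a) (?F (G (?F a))) (?F (G (?F b))) (conj (?F a) (?F b) ?Ff) (\<theta>' (?F a))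
          = Comp D (?F a) (?F b) (?F (G (?F b))) (\<theta>' (?F b))
            (Comp D (?F a) (?F (G (?F a))) (?F b) (Comp D (?F (G (?F a))) (?F a) (?F b) ?Ff (\<theta> (?F a))) (\<theta>' (?F a)))"
        unfolding conj_def using * by (subst D.Comp_assoc) (auto intro!: D.Comp_in[of _ "?F a"])
      also have "Comp D (?F a) (?F (G (?F a))) (?F b) (Comp D (?F (G (?F a))) (?F a) (?F b) ?Ff (\<theta> (?F a))) (\<theta>' (?F a))
          = Comp D (?F a) (?F a) (?F b) ?Ff (Comp D (?F a) (?F (G (?F a))) (?F a) (\<theta> (?F a)) (\<theta>' (?F a)))"
        using * by (subst D.Comp_assoc) auto
      also have "\<dots> = ?Ff" using * by (simp add: \<theta>\<theta>' D.Comp_Id_right)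
      finally show ?thesis by simp
    qed
    then have "Comp C a b (G (?F b)) (L b (G (?F b)) (\<theta>' (?F b))) f
        = Comp C a (G (?F a)) (G (?F b)) (L (G (?F a)) (G (?F b)) (conj (?F a) (?F b) ?Ff)) (L a (G (?F a)) (\<theta>' (?F a)))"
      using * in1 C.Comp_in[of a b "G (?F b)" f "L b (G (?F b)) (\<theta>' (?F b))"]
        C.Comp_in[of a "G (?F a)" "G (?F b)" "L a (G (?F a)) (\<theta>' (?F a))" "L (G (?F a)) (G (?F b)) (conj (?F a) (?F b) ?Ff)"]
      by (intro eqI[of a "G (?F b)"]) (auto simp: F.arr_map_Comp)
    then show "Comp C (ob_map id_fctr a) (ob_map id_fctr b) (ob_map (comp_fctr G' F) b)
          (L b (G (?F b)) (\<theta>' (?F b))) (arr_map id_fctr a b f)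
        = Comp C (ob_map id_fctr a) (ob_map (comp_fctr G' F) a) (ob_map (comp_fctr G' F) b)
          (arr_map (comp_fctr G' F) a b f) (L a (G (?F a)) (\<theta>' (?F a)))"
      by (simp add: id_fctr_def comp_fctr_def)
  qed
  ultimately show ?thesis
    unfolding equivalent_categories_def using assms(1-3) by blast
qed

lemma category_full_subcategory:
  assumes "category C"
  shows "category (full_subcategory C S)"
proof -
  interpret category C by fact
  show ?thesis
    by unfold_locales (auto simp: full_subcategory_def Id_in Comp_in Comp_Id_left Comp_Id_right Comp_assoc)
qed

section \<open>The categories of parity complexes and of augmented directed complexes\<close>

lemma adc_homD:
  assumes "f \<in> adc_hom K L"
  shows "f n \<in> extensional (carrier (grp K n))" "f n \<in> hom (grp K n) (grp L n)"
    "x \<preceq>\<^bsub>grp K n\<^esub> y \<Longrightarrow> f n x \<preceq>\<^bsub>grp L n\<^esub> f n y"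
    "x \<in> carrier (grp K (Suc n)) \<Longrightarrow> f n (bd K n x) = bd L n (f (Suc n) x)"
    "x \<in> carrier (grp K 0) \<Longrightarrow> aug L (f 0 x) = aug K x"
  using assms by (simp_all add: adc_hom_def)

lemma adc_hom_closed: "f \<in> adc_hom K L \<Longrightarrow> x \<in> carrier (grp K n) \<Longrightarrow> f n x \<in> carrier (grp L n)"
  using adc_homD(2)[of f K L n] by (auto simp: hom_def)

lemma adc_hom_eqI:
  assumes "f \<in> adc_hom K L" "g \<in> adc_hom K L" "\<And>n x. x \<in> carrier (grp K n) \<Longrightarrow> f n x = g n x"
  shows "f = g"
  using adc_homD(1)[OF assms(1)] adc_homD(1)[OF assms(2)] assms(3) by (metis ext extensionalityI)

lemma adc_hom_restrict_id:
  assumes "augmented_directed_complex K"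
  shows "(\<lambda>n. \<lambda>x\<in>carrier (grp K n). x) \<in> adc_hom K K"
proof -
  interpret augmented_directed_complex K by fact
  show ?thesis
    using A.order_rel_carrier bd_closed by (auto simp: adc_hom_def hom_def)
qed

lemma adc_hom_compose:
  assumes "augmented_directed_complex K" and f: "f \<in> adc_hom K L" and g: "g \<in> adc_hom L M"
  shows "(\<lambda>n. compose (carrier (grp K n)) (g n) (f n)) \<in> adc_hom K M"
proof -
  interpret augmented_directed_complex K by fact
  show ?thesis
    unfolding adc_hom_def mem_Collect_eq
  proof (intro conjI allI impI ballI)
    fix n
    show "compose (carrier (grp K n)) (g n) (f n) \<in> hom (grp K n) (grp M n)"
      using adc_homD(2)[OF f, of n] adc_homD(2)[OF g, of n] by (auto simp: hom_def compose_def Pi_def)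
  qed (use adc_homD[OF f] adc_homD[OF g] adc_hom_closed[OF f] A.order_rel_carrier bd_closed in
      \<open>auto simp: compose_def\<close>)
qed

lemma category_ADC: "category ADC"
proof
  fix K L and f assume *: "K \<in> Ob ADC" "L \<in> Ob ADC" "f \<in> Hom ADC K L"
  then have f: "f \<in> adc_hom K L" by (simp add: ADC_def)
  show "Comp ADC K L L (Id ADC L) f = f"
    using adc_homD(1)[OF f] adc_hom_closed[OF f]
    by (fastforce simp: ADC_def compose_def extensional_def)
  show "Comp ADC K K L f (Id ADC K) = f"
    using adc_homD(1)[OF f]
    by (fastforce simp: ADC_def compose_def extensional_def)
next
  fix K L M N and f g h
  assume *: "K \<in> Ob ADC" "L \<in> Ob ADC" "M \<in> Ob ADC" "N \<in> Ob ADC"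
    "f \<in> Hom ADC K L" "g \<in> Hom ADC L M" "h \<in> Hom ADC M N"
  then show "Comp ADC K M N h (Comp ADC K L M g f) = Comp ADC K L N (Comp ADC L M N h g) f"
    using adc_hom_closed[of f K L] by (auto simp: ADC_def compose_def fun_eq_iff restrict_def)
qed (auto simp: ADC_def adc_hom_restrict_id intro!: adc_hom_compose)

lemma category_SSC: "category SSC"
  unfolding SSC_def by (rule category_full_subcategory[OF category_ADC])

section \<open>The category of parity complexes\<close>

lemma wpc_hom_closed: "f \<in> wpc_hom C D \<Longrightarrow> x \<in> cells C n \<Longrightarrow> f n x \<subseteq> cells D n \<and> finite (f n x)"
  by (auto simp: wpc_hom_def PiE_def Pi_def Fpow_def)

text \<open>The image of a generator under \<open>f\<close> is a cell, and so is the image of that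
  under \<open>g\<close>; coefficients at most 1 make the union disjoint.\<close>

lemma set_chain_Comp:
  assumes C: "parity_complex C" and D: "parity_complex D" and E: "parity_complex E"
    and f: "f \<in> wpc_hom C D" and g: "g \<in> wpc_hom D E" and x: "x \<in> cells C n"
  shows "set_chain (\<Union>y\<in>f n x. g n y) = frag_extend (\<lambda>y. set_chain (g n y)) (set_chain (f n x))"
proof -
  interpret S: steiner_data "cells C" "cell_bd C" by (rule parity_complex_steiner_data[OF C])
  interpret T: steiner_data "cells D" "cell_bd D" by (rule parity_complex_steiner_data[OF D])
  interpret U: steiner_data "cells E" "cell_bd E" by (rule parity_complex_steiner_data[OF E])
  have "T.cell n (set_chain (f n x))"
    using cell_image[OF S.steiner_data_axioms T.steiner_data_axioms _ S.cell_generator[OF x]]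
      f wpc_hom_iff_chain_hom[OF C D] by fastforce
  then have "U.cell n (frag_extend (\<lambda>y. set_chain (g n y)) (set_chain (f n x)))"
    using cell_image[OF T.steiner_data_axioms U.steiner_data_axioms]
      g wpc_hom_iff_chain_hom[OF D E] by blast
  then have "lookup (frag_extend (\<lambda>y. set_chain (g n y)) (set_chain (f n x))) z \<le> 1" for z
    by (rule U.cell_le_1)
  moreover note wpc_hom_closed[OF f x]
  ultimately show ?thesis
    using wpc_hom_closed[OF g]
    by (simp add: frag_extend_set_chain) (rule set_chain_UN; blast)
qed

lemma wpc_hom_Comp:
  assumes C: "parity_complex C" and D: "parity_complex D" and E: "parity_complex E"
    and f: "f \<in> wpc_hom C D" and g: "g \<in> wpc_hom D E"
  shows "(\<lambda>n. \<lambda>x\<in>cells C n. \<Union>y\<in>f n x. g n y) \<in> wpc_hom C E"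
  unfolding wpc_hom_iff_chain_hom[OF C E]
proof (intro conjI allI)
  fix n
  show "(\<lambda>x\<in>cells C n. \<Union>y\<in>f n x. g n y) \<in> cells C n \<rightarrow>\<^sub>E Fpow (cells E n)"
    using wpc_hom_closed[OF f] wpc_hom_closed[OF g] by (fastforce simp: Fpow_def)
next
  let ?h = "\<lambda>n x. frag_extend (\<lambda>y. set_chain (g n y)) (set_chain (f n x))"
  have "chain_hom (cells C) (cell_bd C) (cells E) (cell_bd E) ?h"
    using f g chain_hom_compose unfolding wpc_hom_iff_chain_hom[OF C D] wpc_hom_iff_chain_hom[OF D E] by blast
  then show "chain_hom (cells C) (cell_bd C) (cells E) (cell_bd E)
      (\<lambda>n x. set_chain ((\<lambda>x\<in>cells C n. \<Union>y\<in>f n x. g n y) x))"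
    by (rule chain_hom_cong[OF parity_complex_steiner_data[OF C]]) (simp add: set_chain_Comp[OF assms])
qed

lemma wpc_hom_Id:
  assumes C: "parity_complex C"
  shows "(\<lambda>n. \<lambda>x\<in>cells C n. {x}) \<in> wpc_hom C C"
  unfolding wpc_hom_iff_chain_hom[OF C C]
proof (intro conjI allI)
  have "chain_hom (cells C) (cell_bd C) (cells C) (cell_bd C) (\<lambda>n. frag_of)"
    by (simp add: chain_hom_def keys_frag_of)
  then show "chain_hom (cells C) (cell_bd C) (cells C) (cell_bd C) (\<lambda>n x. set_chain ((\<lambda>x\<in>cells C n. {x}) x))"
    by (rule chain_hom_cong[OF parity_complex_steiner_data[OF C]]) simp
qed (auto simp: Fpow_def)

text \<open>Closure under composition goes through the chains of parity complexes, so the laws are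
  established for \<open>PC\<close> directly.\<close>

lemma category_PC: "category (PC :: ('a parity_structure, nat \<Rightarrow> 'a \<Rightarrow> 'a set) cat)"
proof
  fix C D :: "'a parity_structure" and f assume *: "C \<in> Ob PC" "D \<in> Ob PC" "f \<in> Hom PC C D"
  then have f: "f \<in> wpc_hom C D" by (simp add: PC_def full_subcategory_def WPC_def)
  then have undef: "f n \<in> extensional (cells C n)" for n by (auto simp: wpc_hom_def PiE_def)
  show "Comp PC C D D (Id PC D) f = f"
  proof (intro ext)
    fix n x
    have "(\<Union>y\<in>f n x. (\<lambda>x\<in>cells D n. {x}) y) = f n x" if "x \<in> cells C n"
      using wpc_hom_closed[OF f that] by (auto simp: restrict_def split: if_splits)
    then show "Comp PC C D D (Id PC D) f n x = f n x"
      using extensional_arb[OF undef, of x n] by (cases "x \<in> cells C n") (simp_all add: PC_def full_subcategory_def WPC_def)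
  qed
  show "Comp PC C C D f (Id PC C) = f"
  proof (intro ext)
    fix n x
    show "Comp PC C C D f (Id PC C) n x = f n x"
      using extensional_arb[OF undef, of x n] by (cases "x \<in> cells C n") (simp_all add: PC_def full_subcategory_def WPC_def)
  qed
next
  fix C D E E' :: "'a parity_structure" and f g h
  assume *: "C \<in> Ob PC" "D \<in> Ob PC" "E \<in> Ob PC" "E' \<in> Ob PC"
    "f \<in> Hom PC C D" "g \<in> Hom PC D E" "h \<in> Hom PC E E'"
  then have f: "f \<in> wpc_hom C D" by (simp add: PC_def full_subcategory_def WPC_def)
  show "Comp PC C E E' h (Comp PC C D E g f) = Comp PC C D E' (Comp PC D E E' h g) f"
  proof (intro ext)
    fix n x
    have "(\<Union>y\<in>f n x. (\<lambda>y\<in>cells D n. \<Union>z\<in>g n y. h n z) y) = (\<Union>y\<in>f n x. \<Union>z\<in>g n y. h n z)"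
      if "x \<in> cells C n"
      using wpc_hom_closed[OF f that] by (intro SUP_cong) auto
    then show "Comp PC C E E' h (Comp PC C D E g f) n x = Comp PC C D E' (Comp PC D E E' h g) f n x"
      by (cases "x \<in> cells C n") (simp_all add: PC_def full_subcategory_def WPC_def)
  qed
qed (auto simp: PC_def full_subcategory_def WPC_def intro: wpc_hom_Id wpc_hom_Comp)

section \<open>Morphisms in coordinates\<close>

text \<open>Both complexes are arbitrary presented ones, so that free complexes can be compared with
  each other and with a given complex.\<close>

locale presentation_pair =
  K: presentation K "cells C" "cell_bd C" \<phi> + L: presentation L "cells D" "cell_bd D" \<psi>
  for K :: "'a adc" and C :: "'a parity_structure" and \<phi>
    and L :: "'a adc" and D :: "'a parity_structure" and \<psi> +
  assumes C: "parity_complex C" and D: "parity_complex D"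
begin

sublocale S: steiner_data "cells C" "cell_bd C" by (rule parity_complex_steiner_data[OF C])
sublocale T: steiner_data "cells D" "cell_bd D" by (rule parity_complex_steiner_data[OF D])

definition extend_hom :: "(nat \<Rightarrow> 'a \<Rightarrow> 'a set) \<Rightarrow> nat \<Rightarrow> 'a \<Rightarrow> 'a" where
  "extend_hom f n = (\<lambda>x\<in>carrier (grp K n). L.elem n (frag_extend (\<lambda>b. set_chain (f n b)) (\<phi> n x)))"

lemma extend_hom:
  assumes f: "f \<in> wpc_hom C D" and x: "x \<in> carrier (grp K n)"
  shows "extend_hom f n x \<in> carrier (grp L n)"
    "\<psi> n (extend_hom f n x) = frag_extend (\<lambda>b. set_chain (f n b)) (\<phi> n x)"
proof -
  have "chain_hom (cells C) (cell_bd C) (cells D) (cell_bd D) (\<lambda>n x. set_chain (f n x))"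
    using f wpc_hom_iff_chain_hom[OF C D] by blast
  then have "keys (frag_extend (\<lambda>b. set_chain (f n b)) (\<phi> n x)) \<subseteq> cells D n"
    using K.coord_keys[OF x] by (intro keys_frag_extend_subset) (blast dest: chain_homD(2))
  then show "extend_hom f n x \<in> carrier (grp L n)"
    "\<psi> n (extend_hom f n x) = frag_extend (\<lambda>b. set_chain (f n b)) (\<phi> n x)"
    using x by (simp_all add: extend_hom_def L.elem_closed L.coord_elem)
qed

lemma extend_hom_in:
  assumes f: "f \<in> wpc_hom C D"
  shows "extend_hom f \<in> adc_hom K L"
  unfolding adc_hom_def mem_Collect_eq
proof (intro conjI allI impI ballI)
  have hom: "chain_hom (cells C) (cell_bd C) (cells D) (cell_bd D) (\<lambda>n x. set_chain (f n x))"
    using f wpc_hom_iff_chain_hom[OF C D] by blast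
  note e = extend_hom[OF f]
  fix n
  show "extend_hom f n \<in> extensional (carrier (grp K n))" by (simp add: extend_hom_def)
  show "extend_hom f n \<in> hom (grp K n) (grp L n)"
    by (rule homI) (auto intro!: L.coord_eqI[of _ n] simp: e L.coord_mult K.coord_mult frag_extend_add)
  show "extend_hom f n x \<preceq>\<^bsub>grp L n\<^esub> extend_hom f n y" if "x \<preceq>\<^bsub>grp K n\<^esub> y" for x y
  proof -
    have "x \<in> carrier (grp K n)" "y \<in> carrier (grp K n)"
      using that K.A.order_rel_carrier by auto
    then show ?thesis
      using that by (simp add: K.coord_le L.coord_le e nonneg_frag_extend flip: frag_extend_diff)
  qed
  show "extend_hom f n (bd K n x) = bd L n (extend_hom f (Suc n) x)" if x: "x \<in> carrier (grp K (Suc n))" for x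
    using x frag_extend_chain_map[OF K.coord_keys[OF x] chain_homD(4)[OF hom]]
    by (intro L.coord_eqI[of _ n]) (auto simp: e K.bd_closed L.bd_closed K.coord_bd L.coord_bd)
  show "aug L (extend_hom f 0 x) = aug K x" if x: "x \<in> carrier (grp K 0)" for x
    using x K.coord_keys[OF x] chain_homD(3)[OF hom]
    by (simp add: e L.coord_aug K.coord_aug) (rule coeff_sum_frag_extend, blast)
qed

lemma extend_hom_inj: "inj_on extend_hom (wpc_hom C D)"
proof (rule inj_onI)
  fix f g assume f: "f \<in> wpc_hom C D" and g: "g \<in> wpc_hom C D" and eq: "extend_hom f = extend_hom g"
  show "f = g"
  proof (intro ext)
    fix n b
    show "f n b = g n b"
    proof (cases "b \<in> cells C n")
      case True
      then have x: "K.elem n (frag_of b) \<in> carrier (grp K n)" "\<phi> n (K.elem n (frag_of b)) = frag_of b"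
        by (simp_all add: K.elem_closed K.coord_elem keys_frag_of)
      have "set_chain (f n b) = set_chain (g n b)"
        using extend_hom(2)[OF f x(1)] extend_hom(2)[OF g x(1)] eq x(2) by simp
      then show ?thesis
        using wpc_hom_closed[OF f True] wpc_hom_closed[OF g True] by (metis keys_set_chain)
    next
      case False
      then show ?thesis using f g by (simp add: wpc_hom_def PiE_def extensional_def)
    qed
  qed
qed

text \<open>The matrix \<open>g\<close> of \<open>h\<close> sends generators to cells. By
  \<open>chain_hom_set_chain\<close> the supports of its values lose nothing, and they form the
  required morphism.\<close>

lemma extend_hom_surj:
  assumes h: "h \<in> adc_hom K L"
  shows "\<exists>f\<in>wpc_hom C D. extend_hom f = h"
proof -
  define g where "g n b = \<psi> n (h n (K.elem n (frag_of b)))" for n b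
  note hc = adc_hom_closed[OF h]
  have mult: "h n (x \<otimes>\<^bsub>grp K n\<^esub> y) = h n x \<otimes>\<^bsub>grp L n\<^esub> h n y"
    if "x \<in> carrier (grp K n)" "y \<in> carrier (grp K n)" for n x y
    using hom_mult[OF adc_homD(2)[OF h] that] .
  have elem: "\<psi> n (h n (K.elem n c)) = frag_extend (g n) c" if "keys c \<subseteq> cells C n" for n c
  proof -
    have "keys c \<subseteq> cells C n \<and> \<psi> n (h n (K.elem n c)) = frag_extend (g n) c"
      using that
    proof (rule frag_induction)
      have "h n \<one>\<^bsub>grp K n\<^esub> = \<one>\<^bsub>grp L n\<^esub>"
        using K.A.is_group L.A.is_group adc_homD(2)[OF h] by (intro hom_one) auto
      moreover have "K.elem n 0 = \<one>\<^bsub>grp K n\<^esub>"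
        by (intro K.coord_eqI[of _ n]) (auto simp: K.elem_closed K.coord_elem)
      ultimately show "keys 0 \<subseteq> cells C n \<and> \<psi> n (h n (K.elem n 0)) = frag_extend (g n) 0" by simp
    next
      fix a b assume ab: "keys a \<subseteq> cells C n \<and> \<psi> n (h n (K.elem n a)) = frag_extend (g n) a"
        "keys b \<subseteq> cells C n \<and> \<psi> n (h n (K.elem n b)) = frag_extend (g n) b"
      then have k: "keys (a - b) \<subseteq> cells C n" using keys_diff[of a b] by blast
      \<comment> \<open>The difference is handled by adding \<open>b\<close> back, which only needs
        additivity.\<close>
      have "\<psi> n (h n (K.elem n ((a - b) + b))) = \<psi> n (h n (K.elem n (a - b))) + \<psi> n (h n (K.elem n b))"
        using ab k by (simp only: K.elem_add mult L.coord_mult hc K.elem_closed)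
      then show "keys (a - b) \<subseteq> cells C n \<and> \<psi> n (h n (K.elem n (a - b))) = frag_extend (g n) (a - b)"
        using ab k by (simp add: frag_extend_diff)
    qed (simp add: g_def keys_frag_of)
    then show ?thesis ..
  qed
  have coord: "\<psi> n (h n x) = frag_extend (g n) (\<phi> n x)" if "x \<in> carrier (grp K n)" for n x
    using elem[OF K.coord_keys[OF that]] by (simp add: K.elem_coord that)
  have gen: "K.elem n (frag_of b) \<in> carrier (grp K n)" "\<phi> n (K.elem n (frag_of b)) = frag_of b"
    if "b \<in> cells C n" for n b
    using that by (simp_all add: K.elem_closed K.coord_elem keys_frag_of)
  have hom: "chain_hom (cells C) (cell_bd C) (cells D) (cell_bd D) g"
    unfolding chain_hom_def
  proof (intro conjI allI ballI)
    fix n b assume b: "b \<in> cells C n"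
    show "keys (g n b) \<subseteq> cells D n"
      unfolding g_def by (intro L.coord_keys hc gen b)
    have "\<one>\<^bsub>grp K n\<^esub> \<preceq>\<^bsub>grp K n\<^esub> K.elem n (frag_of b)"
      using gen[OF b] by (simp add: K.coord_le)
    then have "h n \<one>\<^bsub>grp K n\<^esub> \<preceq>\<^bsub>grp L n\<^esub> h n (K.elem n (frag_of b))" by (rule adc_homD(3)[OF h])
    then show "nonneg (g n b)"
      using gen[OF b] by (simp add: L.coord_le hc coord)
  next
    fix b assume b: "b \<in> cells C 0"
    then show "coeff_sum (g 0 b) = 1"
      using adc_homD(5)[OF h gen(1)[OF b]] gen[OF b] by (simp add: K.coord_aug L.coord_aug hc g_def)
  next
    fix n b assume b: "b \<in> cells C (Suc n)"
    have "\<psi> n (h n (bd K n (K.elem (Suc n) (frag_of b)))) = \<psi> n (bd L n (h (Suc n) (K.elem (Suc n) (frag_of b))))"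
      using adc_homD(4)[OF h gen(1)[OF b]] by simp
    then show "frag_extend (g n) (cell_bd C n b) = frag_extend (cell_bd D n) (g (Suc n) b)"
      using gen[OF b] by (simp add: coord K.bd_closed K.coord_bd L.coord_bd hc)
  qed
  define f where "f n = (\<lambda>b\<in>cells C n. keys (g n b))" for n
  have fg: "set_chain (f n b) = g n b" if "b \<in> cells C n" for n b
    using chain_hom_set_chain[OF S.steiner_data_axioms T.steiner_data_axioms hom that] that by (simp add: f_def)
  have f: "f \<in> wpc_hom C D"
    unfolding wpc_hom_iff_chain_hom[OF C D]
  proof (intro conjI allI)
    have "keys (g n b) \<in> Fpow (cells D n)" if "b \<in> cells C n" for n b
      using chain_homD(2)[OF hom that] by (simp add: Fpow_def)
    then show "f n \<in> cells C n \<rightarrow>\<^sub>E Fpow (cells D n)" for n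
      unfolding f_def by (intro restrict_PiE_iff[THEN iffD2] ballI)
    show "chain_hom (cells C) (cell_bd C) (cells D) (cell_bd D) (\<lambda>n x. set_chain (f n x))"
      using hom by (rule chain_hom_cong[OF S.steiner_data_axioms]) (rule fg)
  qed
  have "extend_hom f = h"
  proof (rule adc_hom_eqI[OF extend_hom_in[OF f] h])
    fix n x assume x: "x \<in> carrier (grp K n)"
    have "frag_extend (\<lambda>b. set_chain (f n b)) (\<phi> n x) = frag_extend (g n) (\<phi> n x)"
      using K.coord_keys[OF x] fg by (intro frag_extend_eq) blast
    then show "extend_hom f n x = h n x"
      using x by (intro L.coord_eqI[of _ n]) (auto simp: extend_hom[OF f] coord hc)
  qed
  then show ?thesis using f by blast
qed

lemma extend_hom_bij: "bij_betw extend_hom (wpc_hom C D) (adc_hom K L)"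
  using extend_hom_inj extend_hom_in extend_hom_surj by (fastforce simp: bij_betw_def)

end

lemma extend_hom_Id:
  assumes "presentation_pair K C \<phi> K C \<phi>"
  shows "presentation_pair.extend_hom K \<phi> K \<phi> (\<lambda>n. \<lambda>x\<in>cells C n. {x}) = (\<lambda>n. \<lambda>x\<in>carrier (grp K n). x)"
proof -
  interpret presentation_pair K C \<phi> K C \<phi> by fact
  have "frag_extend (\<lambda>b. set_chain ((\<lambda>x\<in>cells C n. {x}) b)) (\<phi> n x) = frag_extend frag_of (\<phi> n x)"
    if "x \<in> carrier (grp K n)" for n x
    using K.coord_keys[OF that] by (intro frag_extend_eq) auto
  then show ?thesis by (auto simp: extend_hom_def fun_eq_iff restrict_def K.elem_coord)
qed

text \<open>With three independent presentations this gives both functoriality and the inverse laws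
  in \<open>iso_of_presentations\<close>.\<close>

lemma extend_hom_Comp:
  assumes KL: "presentation_pair K C \<phi> L D \<psi>" and LM: "presentation_pair L D \<psi> M E \<chi>"
    and KM: "presentation_pair K C \<phi> M E \<chi>"
    and f: "f \<in> wpc_hom C D" and g: "g \<in> wpc_hom D E"
  shows "presentation_pair.extend_hom K \<phi> M \<chi> (\<lambda>n. \<lambda>x\<in>cells C n. \<Union>y\<in>f n x. g n y) =
    (\<lambda>n. compose (carrier (grp K n)) (presentation_pair.extend_hom L \<psi> M \<chi> g n) (presentation_pair.extend_hom K \<phi> L \<psi> f n))"
proof -
  interpret KL: presentation_pair K C \<phi> L D \<psi> by fact
  interpret LM: presentation_pair L D \<psi> M E \<chi> by fact
  interpret KM: presentation_pair K C \<phi> M E \<chi> by fact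
  let ?gf = "\<lambda>n. \<lambda>x\<in>cells C n. \<Union>y\<in>f n x. g n y"
  have gf: "?gf \<in> wpc_hom C E" by (rule wpc_hom_Comp[OF KL.C KL.D LM.D f g])
  show ?thesis
  proof (rule adc_hom_eqI[OF KM.extend_hom_in[OF gf]])
    show "(\<lambda>n. compose (carrier (grp K n)) (LM.extend_hom g n) (KL.extend_hom f n)) \<in> adc_hom K M"
      by (rule adc_hom_compose[OF KL.K.augmented_directed_complex_axioms KL.extend_hom_in[OF f] LM.extend_hom_in[OF g]])
  next
    fix n x assume x: "x \<in> carrier (grp K n)"
    have "frag_extend (\<lambda>b. set_chain (?gf n b)) (\<phi> n x)
        = frag_extend (\<lambda>b. frag_extend (\<lambda>y. set_chain (g n y)) (set_chain (f n b))) (\<phi> n x)"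
      using KL.K.coord_keys[OF x] set_chain_Comp[OF KL.C KL.D LM.D f g] by (intro frag_extend_eq) auto
    then show "KM.extend_hom ?gf n x = compose (carrier (grp K n)) (LM.extend_hom g n) (KL.extend_hom f n) x"
      using x KM.extend_hom[OF gf x] KL.extend_hom[OF f x] LM.extend_hom[OF g KL.extend_hom(1)[OF f x]]
      by (intro LM.L.coord_eqI[of _ n]) (auto simp: compose_def frag_extend_compose)
  qed
qed

section \<open>The free augmented directed complex on a parity complex\<close>

text \<open>An arbitrary choice, injective as soon as some injection exists; it carries the free
  groups into the universe \<open>'a\<close>.\<close>

definition chain_code :: "('a \<Rightarrow>\<^sub>0 int) \<Rightarrow> 'a" where
  "chain_code = (SOME e. inj e)"

definition chain_decode :: "'a \<Rightarrow> 'a \<Rightarrow>\<^sub>0 int" where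
  "chain_decode = inv_into UNIV chain_code"

definition free_group :: "'a set \<Rightarrow> 'a preordered_group" where
  "free_group B = \<lparr>carrier = chain_code ` {c. keys c \<subseteq> B},
     monoid.mult = (\<lambda>x y. chain_code (chain_decode x + chain_decode y)), one = chain_code 0,
     order_rel = {(x, y) \<in> chain_code ` {c. keys c \<subseteq> B} \<times> chain_code ` {c. keys c \<subseteq> B}.
       nonneg (chain_decode y - chain_decode x)}\<rparr>"

definition free_adc :: "'a parity_structure \<Rightarrow> 'a adc" where
  "free_adc C = \<lparr>grp = (\<lambda>n. free_group (cells C n)),
     bd = (\<lambda>n x. chain_code (frag_extend (cell_bd C n) (chain_decode x))),
     aug = (\<lambda>x. coeff_sum (chain_decode x))\<rparr>"

text \<open>A free abelian group on an infinite set is equipollent to that set, and over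
  \<open>UNIV\<close> its carrier consists of all chains.\<close>

lemma inj_chain_code:
  assumes "infinite (UNIV :: 'a set)"
  shows "inj (chain_code :: _ \<Rightarrow> 'a)"
proof -
  have "carrier (free_Abelian_group (UNIV :: 'a set)) \<lesssim> (UNIV :: 'a set)"
    by (intro eqpoll_imp_lepoll eqpoll_free_Abelian_group_infinite assms)
  moreover have "carrier (free_Abelian_group (UNIV :: 'a set)) = UNIV"
    by (auto simp: free_Abelian_group_def)
  ultimately have "\<exists>e :: ('a \<Rightarrow>\<^sub>0 int) \<Rightarrow> 'a. inj e" by (auto simp: lepoll_def)
  then show ?thesis unfolding chain_code_def by (rule someI_ex)
qed

lemma decode_code: "infinite (UNIV :: 'a set) \<Longrightarrow> chain_decode (chain_code c :: 'a) = c"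
  unfolding chain_decode_def by (rule inv_f_f[OF inj_chain_code])

lemma preordered_free_group:
  assumes inf: "infinite (UNIV :: 'a set)"
  shows "preordered_comm_group (free_group (B :: 'a set))"
proof -
  note [simp] = decode_code[OF inf]
  have closed: "x \<otimes>\<^bsub>free_group B\<^esub> y \<in> carrier (free_group B)"
    if "x \<in> carrier (free_group B)" "y \<in> carrier (free_group B)" for x y
    using that by (auto simp: free_group_def simp del: subset_iff intro!: imageI)
      (metis keys_add_subset subsetD)
  interpret comm_group "free_group B"
  proof (rule comm_groupI)
    fix x assume "x \<in> carrier (free_group B)"
    then obtain c where "x = chain_code c" "keys c \<subseteq> B" by (auto simp: free_group_def)
    then show "\<exists>y\<in>carrier (free_group B). y \<otimes>\<^bsub>free_group B\<^esub> x = \<one>\<^bsub>free_group B\<^esub>"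
      by (intro bexI[of _ "chain_code (- c)"]) (auto simp: free_group_def)
  qed (use closed in \<open>auto simp: free_group_def ac_simps\<close>)
  show ?thesis
  proof
    show "preorder_on (carrier (free_group B)) (order_rel (free_group B))"
      by (auto simp: free_group_def preorder_on_def refl_on_def trans_def nonneg_def lookup_minus intro: order_trans)
    show "a \<otimes>\<^bsub>free_group B\<^esub> c \<preceq>\<^bsub>free_group B\<^esub> b \<otimes>\<^bsub>free_group B\<^esub> c"
      if "a \<preceq>\<^bsub>free_group B\<^esub> b" "c \<in> carrier (free_group B)" for a b c
      using that closed[of a c] closed[of b c] by (auto simp: free_group_def)
  qed
qed

lemma presentation_free_adc:
  assumes inf: "infinite (UNIV :: 'a set)" and C: "parity_complex (C :: 'a parity_structure)"
  shows "presentation (free_adc C) (cells C) (cell_bd C) (\<lambda>n. chain_decode)"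
proof -
  interpret S: steiner_data "cells C" "cell_bd C" by (rule parity_complex_steiner_data[OF C])
  note [simp] = decode_code[OF inf]
  have [simp]: "chain_code c \<in> carrier (free_group B) \<longleftrightarrow> keys c \<subseteq> B" for c and B :: "'a set"
    by (simp add: free_group_def inj_image_mem_iff[OF inj_chain_code[OF inf]])
  have carE: "\<exists>c. x = chain_code c \<and> keys c \<subseteq> B" if "x \<in> carrier (free_group B)" for x and B :: "'a set"
    using that by (auto simp: free_group_def)
  have free_simps [simp]: "chain_decode (x \<otimes>\<^bsub>free_group B\<^esub> y) = chain_decode x + chain_decode y"
    "x \<otimes>\<^bsub>free_group B\<^esub> y = chain_code (chain_decode x + chain_decode y)"
    "\<one>\<^bsub>free_group B\<^esub> = chain_code 0"
    "x \<preceq>\<^bsub>free_group B\<^esub> y \<longleftrightarrow> x \<in> carrier (free_group B) \<and> y \<in> carrier (free_group B) \<and>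
      nonneg (chain_decode y - chain_decode x)" for x y and B :: "'a set"
    by (auto simp: free_group_def)
  have adc_simps [simp]: "grp (free_adc C) n = free_group (cells C n)"
    "bd (free_adc C) n x = chain_code (frag_extend (cell_bd C n) (chain_decode x))"
    "aug (free_adc C) x = coeff_sum (chain_decode x)" for n x
    by (simp_all add: free_adc_def)
  interpret augmented_directed_complex "free_adc C"
  proof (rule augmented_directed_complex.intro)
    fix n
    show "preordered_comm_group (grp (free_adc C) n)" by (simp add: preordered_free_group[OF inf])
    show "bd (free_adc C) n \<in> hom (grp (free_adc C) (Suc n)) (grp (free_adc C) n)"
      by (rule homI) (auto dest!: carE dest: subsetD[OF S.keys_bdry] simp: frag_extend_add)
    show "bd (free_adc C) n (bd (free_adc C) (Suc n) x) = \<one>\<^bsub>grp (free_adc C) n\<^esub>"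
      if "x \<in> carrier (grp (free_adc C) (Suc (Suc n)))" for x
      using that by (auto dest!: carE simp: S.bdry_bdry)
  next
    show "aug (free_adc C) \<in> hom (grp (free_adc C) 0) integer_group"
      by (rule homI) (auto simp: integer_group_def)
    show "aug (free_adc C) x \<le> aug (free_adc C) y" if "x \<preceq>\<^bsub>grp (free_adc C) 0\<^esub> y" for x y
    proof -
      have "0 \<le> coeff_sum (chain_decode y - chain_decode x)"
        using that unfolding coeff_sum_def by (intro sum_nonneg nonnegD) simp
      then show ?thesis by simp
    qed
    show "aug (free_adc C) (bd (free_adc C) 0 x) = 0" if "x \<in> carrier (grp (free_adc C) (Suc 0))" for x
      using that by (auto dest!: carE simp: S.coeff_sum_bdry)
  qed
  show ?thesis
  proof
    show "bij_betw chain_decode (carrier (grp (free_adc C) n)) {c. keys c \<subseteq> cells C n}" for n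
      by (rule bij_betw_byWitness[where f' = chain_code]) (auto dest!: carE)
  qed auto
qed

section \<open>The equivalence\<close>

lemma strong_steiner_free_adc:
  assumes "infinite (UNIV :: 'a set)" "parity_complex (C :: 'a parity_structure)"
  shows "strong_steiner_complex (free_adc C)"
  using presentation.strong_steiner[OF presentation_free_adc] assms parity_complex_steiner_data by blast

definition free_fctr ::
    "('a parity_structure, nat \<Rightarrow> 'a \<Rightarrow> 'a set, 'a adc, nat \<Rightarrow> 'a \<Rightarrow> 'a) fctr" where
  "free_fctr = \<lparr>ob_map = free_adc,
     arr_map = (\<lambda>C D. presentation_pair.extend_hom (free_adc C) (\<lambda>n. chain_decode) (free_adc D) (\<lambda>n. chain_decode))\<rparr>"

lemma Ob_PC: "Ob PC = {C. parity_complex C}"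
  using parity_complex_weak by (auto simp: PC_def full_subcategory_def WPC_def)

lemma PC_simps: "Hom PC = wpc_hom" "Id PC C = (\<lambda>n. \<lambda>x\<in>cells C n. {x})"
    "Comp PC C D E g f = (\<lambda>n. \<lambda>x\<in>cells C n. \<Union>y\<in>f n x. g n y)"
  by (simp_all add: PC_def full_subcategory_def WPC_def)

lemma Ob_SSC: "Ob SSC = {K. strong_steiner_complex K}"
  by (auto simp: SSC_def full_subcategory_def ADC_def strong_steiner_complex_def)

lemma SSC_simps: "Hom SSC = adc_hom" "Id SSC K = (\<lambda>n. \<lambda>x\<in>carrier (grp K n). x)"
    "Comp SSC K L M g f = (\<lambda>n. compose (carrier (grp K n)) (g n) (f n))"
  by (simp_all add: SSC_def full_subcategory_def ADC_def)

text \<open>The identity of \<open>C\<close>, read in the coordinates of \<open>K\<close> and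
  \<open>L\<close>, extends to maps both ways. Their composites extend the identity again, hence are
  identities.\<close>

lemma iso_of_presentations:
  fixes C :: "'a parity_structure" and K L :: "'a adc"
  assumes C: "parity_complex C" and K: "presentation K (cells C) (cell_bd C) \<phi>"
    and L: "presentation L (cells C) (cell_bd C) \<psi>"
  shows "\<exists>f. is_iso SSC K L f"
proof -
  let ?I = "\<lambda>n. \<lambda>x\<in>cells C n. {x}"
  have II: "(\<lambda>n. \<lambda>x\<in>cells C n. \<Union>y\<in>?I n x. ?I n y) = ?I" by (auto simp: fun_eq_iff restrict_def)
  have I: "?I \<in> wpc_hom C C" by (rule wpc_hom_Id[OF C])
  have KL: "presentation_pair K C \<phi> L C \<psi>" and LK: "presentation_pair L C \<psi> K C \<phi>"
    and KK: "presentation_pair K C \<phi> K C \<phi>" and LL: "presentation_pair L C \<psi> L C \<psi>"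
    using C K L by (simp_all add: presentation_pair_def presentation_pair_axioms_def)
  let ?f = "presentation_pair.extend_hom K \<phi> L \<psi> ?I" and ?g = "presentation_pair.extend_hom L \<psi> K \<phi> ?I"
  have "Comp SSC K L K ?g ?f = Id SSC K" "Comp SSC L K L ?f ?g = Id SSC L"
    using extend_hom_Comp[OF KL LK KK I I] extend_hom_Comp[OF LK KL LL I I]
      extend_hom_Id[OF KK] extend_hom_Id[OF LL] unfolding SSC_simps II by simp_all
  then have "is_iso SSC K L ?f"
    using presentation_pair.extend_hom_in[OF KL I] presentation_pair.extend_hom_in[OF LK I]
    by (auto simp: is_iso_def SSC_simps)
  then show ?thesis by blast
qed

theorem theorem5p2:
  assumes "infinite (UNIV :: 'a set)"
  shows "equivalent_categories
    (PC :: ('a parity_structure, nat \<Rightarrow> 'a \<Rightarrow> 'a set) cat)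
    (SSC :: ('a adc, nat \<Rightarrow> 'a \<Rightarrow> 'a) cat)"
proof (rule equivalent_categoriesI[OF category_PC category_SSC])
  note free = presentation_free_adc[OF assms]
  have pair: "presentation_pair (free_adc C) C (\<lambda>n. chain_decode) (free_adc D) D (\<lambda>n. chain_decode)"
    if "parity_complex C" "parity_complex D" for C D :: "'a parity_structure"
    using that free by (simp add: presentation_pair_def presentation_pair_axioms_def)
  show "cat_functor (PC :: ('a parity_structure, nat \<Rightarrow> 'a \<Rightarrow> 'a set) cat) SSC free_fctr"
    by unfold_locales (auto simp: free_fctr_def Ob_PC Ob_SSC PC_simps SSC_simps strong_steiner_free_adc[OF assms]
        pair presentation_pair.extend_hom_in[OF pair] extend_hom_Id intro!: extend_hom_Comp)
  show "bij_betw (arr_map free_fctr C D) (Hom PC C D) (Hom SSC (ob_map free_fctr C) (ob_map free_fctr D))"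
    if "C \<in> Ob PC" "D \<in> Ob PC" for C D :: "'a parity_structure"
    using that pair[of C D] by (simp add: free_fctr_def Ob_PC PC_simps SSC_simps presentation_pair.extend_hom_bij)
  \<comment> \<open>\<open>K\<close> is presented by some parity complex \<open>C\<close>, and so is
    \<open>free_adc C\<close>.\<close>
  show "\<exists>C\<in>Ob PC. \<exists>f. is_iso SSC (ob_map free_fctr C) K f" if "K \<in> Ob SSC" for K :: "'a adc"
  proof -
    have "strong_steiner_complex K" using that by (simp add: Ob_SSC)
    then obtain C :: "'a parity_structure" and \<phi> where C: "parity_complex C" and K: "presentation K (cells C) (cell_bd C) \<phi>"
      by (rule strong_steiner_presentation)
    then show ?thesis
      using iso_of_presentations[OF C free[OF C] K] by (auto simp: Ob_PC free_fctr_def)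
  qed
qed

end
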